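(* The metric spray of the $L^2$ metric $(\cdot,\cdot)^\alpha$ on $\Gamma(Herm^+(E))$ exists and is given by $$B_h(v,w)=\tfrac12 vh^{-1}w+\tfrac12 wh^{-1}v,\qquad h\in\Gamma(Herm^+(E)),\ v,w\in\Gamma(Herm(E)).$$
   Context: $M$ is a closed, oriented, smooth manifold, $E\to M$ a smooth complex vector bundle of rank $r$, $g$ a fixed smooth Riemannian metric on $M$ with volume form $\mu_g$, and $\alpha:M\to\mathbb{R}$ a fixed smooth function with $\alpha>-1/r$. $Sesqui(E)$ is the bundle of sesquilinear forms on the fibers of $E$ (linear in the first, conjugate-linear in the second argument), $Herm(E)$ the real subbundle of Hermitian forms, $Herm^+(E)$ the open subbundle of positive definite ones; $\Gamma(\cdot)$ denotes smooth sections. For $h\in\Gamma(Herm^+(E))$ and $v\in\Gamma(Sesqui(E))$, $h^{-1}v\in\Gamma(End(E))$ is defined by $v(a,b)=h(a,(h^{-1}v)b)$; the map $v\mapsto h^{-1}v$ is a bijection $\Gamma(Sesqui(E))\to\Gamma(End(E))$. The expression $vh^{-1}w$ denotes the element of $\Gamma(Sesqui(E))$ with $h^{-1}(vh^{-1}w)=(h^{-1}v)(h^{-1}w)$ (composition of endomorphisms). $\Gamma(Herm(E))$ is a Fréchet space with the $C^\infty$ topology and $\Gamma(Herm^+(E))$ is an open convex cone in it, with tangent spaces identified with $\Gamma(Herm(E))$. The $L^2$ metric is the weak Riemannian metric $(v,w)_h^\alpha=\int_M\big(tr(h^{-1}vh^{-1}w)+\alpha\,tr(h^{-1}v)\,tr(h^{-1}w)\big)\mu_g$.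 Its metric spray (if it exists, it is unique) is the smooth map $B:\Gamma(Herm^+(E))\times\Gamma(Herm(E))\times\Gamma(Herm(E))\to\Gamma(Herm(E))$, symmetric bilinear in $(v,w)$, such that $(B_h(v,v),l)_h^\alpha=\frac12D(v,v)_h^\alpha(l)-D(v,l)_h^\alpha(v)$ for all $h,v,l$, where $D(\cdot,\cdot)_h^\alpha(l)$ denotes the derivative with respect to $h$ in direction $l$. *)

theory Defs
  imports "HOL-Analysis.Analysis" "HOL-Library.Function_Algebras"
begin

section \<open>Real vector space structure on function types\<close>

instantiation "fun" :: (type, real_vector) real_vector
begin

definition scaleR_fun :: "real \<Rightarrow> ('a \<Rightarrow> 'b) \<Rightarrow> 'a \<Rightarrow> 'b" where
  "scaleR_fun c f = (\<lambda>x. c *\<^sub>R f x)"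

instance
  by standard (auto simp: scaleR_fun_def fun_eq_iff algebra_simps)

end

section \<open>Smooth functions of n real variables\<close>

text \<open>
  Points of \<open>n\<close>-dimensional coordinate space are the extensional functions on \<open>{..<n}\<close>, so that
  \<open>n\<close> is an ordinary natural number (possibly 0) and Lebesgue measure is the product measure
  \<open>Pi\<^sub>M {..<n} (\<lambda>_. lborel)\<close>.  The subspace topology inherited from \<open>nat \<Rightarrow> real\<close> is the
  usual one, as all coordinates outside \<open>{..<n}\<close> are constant.
\<close>

definition coords :: "nat \<Rightarrow> (nat \<Rightarrow> real) set" where
  "coords n = {..<n} \<rightarrow>\<^sub>E UNIV"

definition partial_deriv ::
    "nat \<Rightarrow> ((nat \<Rightarrow> real) \<Rightarrow> 'b::real_normed_vector) \<Rightarrow> (nat \<Rightarrow> real) \<Rightarrow> 'b" where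
  "partial_deriv i f y = vector_derivative (\<lambda>t. f (y(i := t))) (at (y i))"

primrec partials ::
    "nat list \<Rightarrow> ((nat \<Rightarrow> real) \<Rightarrow> 'b::real_normed_vector) \<Rightarrow> (nat \<Rightarrow> real) \<Rightarrow> 'b" where
  "partials [] f = f"
| "partials (i # is) f = partial_deriv i (partials is f)"

text \<open>Smooth on a (relatively) open set \<open>W\<close> of \<open>coords n\<close>: all partial derivatives of all orders
  exist and are continuous.\<close>

definition smooth_fun_on ::
    "nat \<Rightarrow> (nat \<Rightarrow> real) set \<Rightarrow> ((nat \<Rightarrow> real) \<Rightarrow> 'b::real_normed_vector) \<Rightarrow> bool" where
  "smooth_fun_on n W f \<longleftrightarrow>
     (\<forall>is \<in> lists {..<n}. continuous_on W (partials is f) \<and>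
        (\<forall>i<n. \<forall>y\<in>W. (\<lambda>t. partials is f (y(i := t))) differentiable at (y i)))"

definition det_upto :: "nat \<Rightarrow> (nat \<Rightarrow> nat \<Rightarrow> real) \<Rightarrow> real" where
  "det_upto n a = (\<Sum>p | p permutes {..<n}. of_int (sign p) * (\<Prod>i<n. a i (p i)))"

section \<open>Oriented manifolds, Riemannian metrics and their volume\<close>

type_synonym 'm chart = "'m set \<times> ('m \<Rightarrow> nat \<Rightarrow> real)"

abbreviation chart_inv :: "'m chart \<Rightarrow> (nat \<Rightarrow> real) \<Rightarrow> 'm" where
  "chart_inv c \<equiv> inv_into (fst c) (snd c)"

definition is_chart :: "nat \<Rightarrow> 'm::topological_space chart \<Rightarrow> bool" where
  "is_chart n c \<longleftrightarrow> open (fst c) \<and> openin (top_of_set (coords n)) (snd c ` fst c) \<and>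
     homeomorphism (fst c) (snd c ` fst c) (snd c) (chart_inv c)"

definition transition :: "'m chart \<Rightarrow> 'm chart \<Rightarrow> (nat \<Rightarrow> real) \<Rightarrow> nat \<Rightarrow> real" where
  "transition c d y = snd d (chart_inv c y)"

text \<open>\<open>jacobian_at c d x k i\<close> is the derivative of the \<open>k\<close>-th coordinate of \<open>d\<close> with respect to the
  \<open>i\<close>-th coordinate of \<open>c\<close>, at the point \<open>x\<close> of the manifold.\<close>

definition jacobian_at :: "'m chart \<Rightarrow> 'm chart \<Rightarrow> 'm \<Rightarrow> nat \<Rightarrow> nat \<Rightarrow> real" where
  "jacobian_at c d x k i = partial_deriv i (\<lambda>y. transition c d y k) (snd c x)"

definition oriented_atlas :: "nat \<Rightarrow> 'm::topological_space chart set \<Rightarrow> bool" where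
  "oriented_atlas n A \<longleftrightarrow>
     (\<forall>c\<in>A. is_chart n c) \<and> (\<Union>c\<in>A. fst c) = UNIV \<and>
     (\<forall>c\<in>A. \<forall>d\<in>A.
        (\<forall>k<n. smooth_fun_on n (snd c ` (fst c \<inter> fst d)) (\<lambda>y. transition c d y k)) \<and>
        (\<forall>x\<in>fst c \<inter> fst d. det_upto n (jacobian_at c d x) > 0))"

text \<open>The Hausdorff and second countability axioms are carried by the sort of the type \<open>'m\<close>.\<close>

definition closed_oriented_manifold ::
    "nat \<Rightarrow> 'm::{t2_space, second_countable_topology} chart set \<Rightarrow> bool" where
  "closed_oriented_manifold n A \<longleftrightarrow> compact (UNIV :: 'm set) \<and> oriented_atlas n A"

definition smooth_scalar ::
    "nat \<Rightarrow> 'm chart set \<Rightarrow> ('m \<Rightarrow> real) \<Rightarrow> bool" where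
  "smooth_scalar n A f \<longleftrightarrow> (\<forall>c\<in>A. smooth_fun_on n (snd c ` fst c) (\<lambda>y. f (chart_inv c y)))"

text \<open>A Riemannian metric, as a smooth symmetric positive definite covariant 2-tensor field:
  \<open>g c x i j\<close> is the \<open>(i, j)\<close>-component of the metric at \<open>x\<close> in the chart \<open>c\<close>.\<close>

type_synonym 'm metric_components = "'m chart \<Rightarrow> 'm \<Rightarrow> nat \<Rightarrow> nat \<Rightarrow> real"

definition riemannian_metric :: "nat \<Rightarrow> 'm chart set \<Rightarrow> 'm metric_components \<Rightarrow> bool" where
  "riemannian_metric n A g \<longleftrightarrow>
     (\<forall>c\<in>A. \<forall>i<n. \<forall>j<n. smooth_fun_on n (snd c ` fst c) (\<lambda>y. g c (chart_inv c y) i j)) \<and>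
     (\<forall>c\<in>A. \<forall>x\<in>fst c. \<forall>i<n. \<forall>j<n. g c x i j = g c x j i) \<and>
     (\<forall>c\<in>A. \<forall>x\<in>fst c. \<forall>\<xi>. (\<exists>i<n. \<xi> i \<noteq> 0) \<longrightarrow> (\<Sum>i<n. \<Sum>j<n. g c x i j * \<xi> i * \<xi> j) > 0) \<and>
     (\<forall>c\<in>A. \<forall>d\<in>A. \<forall>x\<in>fst c \<inter> fst d. \<forall>i<n. \<forall>j<n.
        g c x i j = (\<Sum>k<n. \<Sum>l<n. jacobian_at c d x k i * jacobian_at c d x l j * g d x k l))"

text \<open>
  In a positively oriented chart the volume form is
  \<open>sqrt (det g\<^sub>i\<^sub>j) dy\<^sub>1 \<and> \<dots> \<and> dy\<^sub>n\<close>.  Integration against it over the oriented manifold is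
  integration against the Borel measure that is given by this density in every chart of the
  oriented atlas; these local densities determine the measure uniquely.
\<close>

definition is_volume_measure ::
    "nat \<Rightarrow> 'm::topological_space chart set \<Rightarrow> 'm metric_components \<Rightarrow> 'm measure \<Rightarrow> bool" where
  "is_volume_measure n A g \<mu> \<longleftrightarrow> sets \<mu> = sets borel \<and>
     (\<forall>c\<in>A. \<forall>S\<in>sets borel. S \<subseteq> fst c \<longrightarrow>
        emeasure \<mu> S =
          (\<integral>\<^sup>+ y. ennreal (sqrt (det_upto n (g c (chart_inv c y)))) * indicator (snd c ` S) y
             \<partial>(Pi\<^sub>M {..<n} (\<lambda>_. lborel))))"

section \<open>Smooth complex vector bundles\<close>

text \<open>
  The fibres are \<open>CARD('r)\<close>-dimensional complex subspaces of a complex vector space \<open>'v\<close>.  The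
  latter is a mere container for the fibres (their algebraic direct sum will do) and carries no
  topology; the smooth structure of the bundle is given by the local trivializations \<open>(V, \<tau>)\<close>,
  where \<open>\<tau> x\<close> is an isomorphism from the fibre over \<open>x \<in> V\<close> to \<open>\<complex>\<^sup>r\<close>.
\<close>

record ('m, 'v, 'r) vector_bundle =
  cscale :: "complex \<Rightarrow> 'v \<Rightarrow> 'v"
  fibre :: "'m \<Rightarrow> 'v set"
  trivs :: "('m set \<times> ('m \<Rightarrow> 'v \<Rightarrow> complex ^ 'r::finite)) set"

definition fibre_iso ::
    "('m, 'v::ab_group_add, 'r::finite) vector_bundle \<Rightarrow> 'm \<Rightarrow> ('v \<Rightarrow> complex ^ 'r) \<Rightarrow> bool" where
  "fibre_iso E x f \<longleftrightarrow> bij_betw f (fibre E x) UNIV \<and>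
     (\<forall>a\<in>fibre E x. \<forall>b\<in>fibre E x. f (a + b) = f a + f b) \<and>
     (\<forall>z. \<forall>a\<in>fibre E x. f (cscale E z a) = z *s f a)"

text \<open>The transition matrices of the bundle are the matrices of \<open>\<tau>' x \<circ> (\<tau> x)\<^sup>-\<^sup>1\<close>.\<close>

definition smooth_complex_vector_bundle ::
    "nat \<Rightarrow> 'm::topological_space chart set \<Rightarrow> ('m, 'v::ab_group_add, 'r::finite) vector_bundle \<Rightarrow> bool"
  where
  "smooth_complex_vector_bundle n A E \<longleftrightarrow>
     vector_space (cscale E) \<and> (\<forall>x. module.subspace (cscale E) (fibre E x)) \<and>
     (\<forall>(V, \<tau>)\<in>trivs E. open V \<and> (\<forall>x\<in>V. fibre_iso E x (\<tau> x))) \<and>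
     (\<Union>(V, \<tau>)\<in>trivs E. V) = UNIV \<and>
     (\<forall>c\<in>A. \<forall>(V, \<tau>)\<in>trivs E. \<forall>(V', \<tau>')\<in>trivs E. \<forall>i j.
        smooth_fun_on n (snd c ` (fst c \<inter> V \<inter> V'))
          (\<lambda>y. let x = chart_inv c y in matrix (\<tau>' x \<circ> inv_into (fibre E x) (\<tau> x)) $ i $ j))"

section \<open>Sections of bundles of forms\<close>

text \<open>
  A section of the bundle of sesquilinear forms assigns to \<open>x\<close> a form on the fibre over \<open>x\<close>, which is
  extended by 0 to arguments outside the fibre; sections are thus equal as functions iff they are equal
  as sections.
\<close>

type_synonym ('m, 'v) form_field = "'m \<Rightarrow> 'v \<Rightarrow> 'v \<Rightarrow> complex"

definition sesquilinear_on_fibre ::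
    "('m, 'v::ab_group_add, 'r::finite) vector_bundle \<Rightarrow> 'm \<Rightarrow> ('v \<Rightarrow> 'v \<Rightarrow> complex) \<Rightarrow> bool" where
  "sesquilinear_on_fibre E x s \<longleftrightarrow>
     (\<forall>a\<in>fibre E x. \<forall>a'\<in>fibre E x. \<forall>b\<in>fibre E x. s (a + a') b = s a b + s a' b) \<and>
     (\<forall>a\<in>fibre E x. \<forall>b\<in>fibre E x. \<forall>b'\<in>fibre E x. s a (b + b') = s a b + s a b') \<and>
     (\<forall>z. \<forall>a\<in>fibre E x. \<forall>b\<in>fibre E x. s (cscale E z a) b = z * s a b) \<and>
     (\<forall>z. \<forall>a\<in>fibre E x. \<forall>b\<in>fibre E x. s a (cscale E z b) = cnj z * s a b) \<and>
     (\<forall>a b. a \<notin> fibre E x \<or> b \<notin> fibre E x \<longrightarrow> s a b = 0)"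

text \<open>The matrix entries of a form field in the frame given by the trivialization \<open>\<tau>\<close>, as functions of
  the coordinates of the chart \<open>c\<close>.\<close>

definition local_entry ::
    "('m, 'v, 'r::finite) vector_bundle \<Rightarrow> 'm chart \<Rightarrow> ('m \<Rightarrow> 'v \<Rightarrow> complex ^ 'r) \<Rightarrow> 'r \<Rightarrow> 'r \<Rightarrow>
     ('m, 'v) form_field \<Rightarrow> (nat \<Rightarrow> real) \<Rightarrow> complex" where
  "local_entry E c \<tau> i j v y =
     (let x = chart_inv c y; e = (\<lambda>k. inv_into (fibre E x) (\<tau> x) (axis k 1)) in v x (e i) (e j))"

definition sesqui_sections ::
    "nat \<Rightarrow> 'm chart set \<Rightarrow> ('m, 'v::ab_group_add, 'r::finite) vector_bundle \<Rightarrow> ('m, 'v) form_field set"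
  where
  "sesqui_sections n A E = {v. (\<forall>x. sesquilinear_on_fibre E x (v x)) \<and>
     (\<forall>c\<in>A. \<forall>(V, \<tau>)\<in>trivs E. \<forall>i j. smooth_fun_on n (snd c ` (fst c \<inter> V)) (local_entry E c \<tau> i j v))}"

definition herm_sections ::
    "nat \<Rightarrow> 'm chart set \<Rightarrow> ('m, 'v::ab_group_add, 'r::finite) vector_bundle \<Rightarrow> ('m, 'v) form_field set"
  where
  "herm_sections n A E = {v \<in> sesqui_sections n A E.
     \<forall>x. \<forall>a\<in>fibre E x. \<forall>b\<in>fibre E x. v x b a = cnj (v x a b)}"

definition pos_herm_sections ::
    "nat \<Rightarrow> 'm chart set \<Rightarrow> ('m, 'v::ab_group_add, 'r::finite) vector_bundle \<Rightarrow> ('m, 'v) form_field set"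
  where
  "pos_herm_sections n A E = {h \<in> herm_sections n A E.
     \<forall>x. \<forall>a\<in>fibre E x. a \<noteq> 0 \<longrightarrow> Re (h x a a) > 0}"

text \<open>
  The \<open>C\<^sup>\<infinity>\<close> topology, generated by the balls of the seminorms
  \<open>sup\<^sub>K |\<partial>\<^sup>\<beta> v\<^sub>i\<^sub>j|\<close>, where \<open>K\<close> is a compact subset of the coordinate domain of a chart and a trivialization.
\<close>

definition smooth_topology ::
    "nat \<Rightarrow> 'm chart set \<Rightarrow> ('m, 'v::ab_group_add, 'r::finite) vector_bundle \<Rightarrow> ('m, 'v) form_field topology"
  where
  "smooth_topology n A E = topology_generated_by
     {{w \<in> herm_sections n A E.
         \<forall>y\<in>K. cmod (partials is (local_entry E c \<tau> i j (w - v)) y) < \<epsilon>} | v c V \<tau> K is i j \<epsilon>.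
       v \<in> herm_sections n A E \<and> c \<in> A \<and> (V, \<tau>) \<in> trivs E \<and> compact K \<and>
       K \<subseteq> snd c ` (fst c \<inter> V) \<and> is \<in> lists {..<n} \<and> \<epsilon> > 0}"

section \<open>Smooth maps between locally convex spaces\<close>

text \<open>
  \<open>f\<close> is smooth on the open subset \<open>U\<close> of \<open>X\<close> (in the sense of Michal, Bastiani and Hamilton): the
  iterated directional derivatives \<open>D k x u = d\<^sup>kf(x; u\<^sub>0, \<dots>, u\<^sub>k\<^sub>-\<^sub>1)\<close> exist for all \<open>k\<close>, and are jointly
  continuous in \<open>x\<close> and the \<open>k\<close> directions.  The spaces are the vector subspaces \<open>topspace X\<close>,
  \<open>topspace Y\<close> of the types \<open>'a\<close>, \<open>'b\<close>.
\<close>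

definition frechet_smooth_on ::
    "'a::real_vector topology \<Rightarrow> 'b::real_vector topology \<Rightarrow> 'a set \<Rightarrow> ('a \<Rightarrow> 'b) \<Rightarrow> bool" where
  "frechet_smooth_on X Y U f \<longleftrightarrow>
     (\<exists>D :: nat \<Rightarrow> 'a \<Rightarrow> (nat \<Rightarrow> 'a) \<Rightarrow> 'b.
        (\<forall>x\<in>U. \<forall>u. D 0 x u = f x) \<and>
        (\<forall>k. continuous_map
               (prod_topology (subtopology X U) (product_topology (\<lambda>_. X) {..<k})) Y
               (\<lambda>(x, u). D k x u)) \<and>
        (\<forall>k. \<forall>x\<in>U. \<forall>u \<in> {..<Suc k} \<rightarrow>\<^sub>E topspace X.
           limitin Y
             (\<lambda>t::real. (1 / t) *\<^sub>R (D k (x + t *\<^sub>R u k) (restrict u {..<k}) - D k x (restrict u {..<k})))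
             (D (Suc k) x u) (at 0)))"

section \<open>The L2 metric and its spray\<close>

type_synonym ('m, 'v) endo_field = "'m \<Rightarrow> 'v \<Rightarrow> 'v"

text \<open>\<open>endo_of E h v\<close> is the endomorphism field \<open>h\<^sup>-\<^sup>1v\<close>; \<open>form_of E h\<close> is the inverse of the
  bijection \<open>v \<mapsto> h\<^sup>-\<^sup>1v\<close>.\<close>

definition endo_of ::
    "('m, 'v::ab_group_add, 'r::finite) vector_bundle \<Rightarrow> ('m, 'v) form_field \<Rightarrow> ('m, 'v) form_field \<Rightarrow>
     ('m, 'v) endo_field" where
  "endo_of E h v x b =
     (if b \<in> fibre E x then THE b'. b' \<in> fibre E x \<and> (\<forall>a\<in>fibre E x. v x a b = h x a b') else 0)"

definition form_of ::
    "('m, 'v::ab_group_add, 'r::finite) vector_bundle \<Rightarrow> ('m, 'v) form_field \<Rightarrow> ('m, 'v) endo_field \<Rightarrow>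
     ('m, 'v) form_field" where
  "form_of E h T x a b = (if a \<in> fibre E x \<and> b \<in> fibre E x then h x a (T x b) else 0)"

text \<open>\<open>form_mult E h v w\<close> is \<open>v h\<^sup>-\<^sup>1 w\<close>.\<close>

definition form_mult ::
    "('m, 'v::ab_group_add, 'r::finite) vector_bundle \<Rightarrow> ('m, 'v) form_field \<Rightarrow> ('m, 'v) form_field \<Rightarrow>
     ('m, 'v) form_field \<Rightarrow> ('m, 'v) form_field" where
  "form_mult E h v w = form_of E h (\<lambda>x. endo_of E h v x \<circ> endo_of E h w x)"

text \<open>The trace of an endomorphism of the fibre over \<open>x\<close>, computed in an arbitrary basis.\<close>

definition fibre_trace ::
    "('m, 'v::ab_group_add, 'r::finite) vector_bundle \<Rightarrow> 'm \<Rightarrow> ('v \<Rightarrow> 'v) \<Rightarrow> complex" where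
  "fibre_trace E x T =
     (let f = (SOME f. fibre_iso E x f) in trace (matrix (f \<circ> T \<circ> inv_into (fibre E x) f)))"

text \<open>For Hermitian \<open>h\<close>, \<open>v\<close>, \<open>w\<close> the integrand is real.\<close>

definition L2_metric ::
    "('m, 'v::ab_group_add, 'r::finite) vector_bundle \<Rightarrow> 'm measure \<Rightarrow> ('m \<Rightarrow> real) \<Rightarrow>
     ('m, 'v) form_field \<Rightarrow> ('m, 'v) form_field \<Rightarrow> ('m, 'v) form_field \<Rightarrow> complex" where
  "L2_metric E \<mu> \<alpha> h v w =
     (\<integral>x. fibre_trace E x (endo_of E h v x \<circ> endo_of E h w x)
         + complex_of_real (\<alpha> x) * fibre_trace E x (endo_of E h v x) * fibre_trace E x (endo_of E h w x)
       \<partial>\<mu>)"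

definition is_metric_spray ::
    "nat \<Rightarrow> 'm chart set \<Rightarrow> ('m, 'v::ab_group_add, 'r::finite) vector_bundle \<Rightarrow> 'm measure \<Rightarrow> ('m \<Rightarrow> real) \<Rightarrow>
     (('m, 'v) form_field \<Rightarrow> ('m, 'v) form_field \<Rightarrow> ('m, 'v) form_field \<Rightarrow> ('m, 'v) form_field) \<Rightarrow> bool"
  where
  "is_metric_spray n A E \<mu> \<alpha> B \<longleftrightarrow>
     (let H = herm_sections n A E; P = pos_herm_sections n A E; X = smooth_topology n A E in
      (\<forall>h\<in>P. \<forall>v\<in>H. \<forall>w\<in>H. B h v w \<in> H) \<and>
      frechet_smooth_on (prod_topology X (prod_topology X X)) X (P \<times> H \<times> H) (\<lambda>(h, v, w). B h v w) \<and>
      (\<forall>h\<in>P. \<forall>v\<in>H. \<forall>w\<in>H. B h v w = B h w v) \<and>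
      (\<forall>h\<in>P. \<forall>v\<in>H. \<forall>v'\<in>H. \<forall>w\<in>H. \<forall>s s'. B h (s *\<^sub>R v + s' *\<^sub>R v') w = s *\<^sub>R B h v w + s' *\<^sub>R B h v' w) \<and>
      (\<forall>h\<in>P. \<forall>v\<in>H. \<forall>l\<in>H. \<exists>D1 D2.
         ((\<lambda>t. L2_metric E \<mu> \<alpha> (h + t *\<^sub>R l) v v) has_vector_derivative D1) (at 0) \<and>
         ((\<lambda>t. L2_metric E \<mu> \<alpha> (h + t *\<^sub>R v) v l) has_vector_derivative D2) (at 0) \<and>
         L2_metric E \<mu> \<alpha> h (B h v v) l = (1 / 2) *\<^sub>R D1 - D2))"

end

theory Submission
  imports Defs "Jordan_Normal_Form.Determinant"
begin

text \<open>
  In a frame, \<open>v h\<^sup>-\<^sup>1 w\<close> is the matrix product \<open>V H\<^sup>-\<^sup>1 W\<close>, whose entries are rational in those of \<open>V\<close>, \<open>H\<close>,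
  \<open>W\<close>; hence the product is continuous in the smooth topology.  The resolvent identity
  \<open>K\<^sup>-\<^sup>1 - H\<^sup>-\<^sup>1 = - K\<^sup>-\<^sup>1 (K - H) H\<^sup>-\<^sup>1\<close> expresses difference quotients exactly through such products, so
  continuity alone gives all directional derivatives of the candidate spray, and also the derivative of
  the integrand of the metric, uniformly on the compact manifold.  Comparing the derivatives under the
  integral is then the cyclicity of the trace.  Uniqueness holds because
  \<open>tr (D\<^sup>2) + \<alpha> (tr D)\<^sup>2\<close> with \<open>D = h\<^sup>-\<^sup>1 d\<close> is positive unless \<open>d = 0\<close> (by \<open>\<alpha> > - 1/r\<close> and
  Cauchy-Schwarz in an \<open>h\<close>-orthonormal frame) and nonempty open sets have positive volume; polarization
  recovers \<open>B\<close> from its diagonal.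
\<close>

text \<open>The obstacle is the notion of smoothness: directional derivatives of every order must
  exist and be jointly continuous in the point and in all directions. Two devices meet it. Limits in
  the smooth topology are rewritten as convergence of local matrices along an arbitrary filter, so
  that one lemma on v h^-1 w, joint in h, v and w, serves along \<open>at 0\<close> for difference
  quotients, along \<open>atin Z p\<close> for continuity on product spaces, and with constant
  families for smoothness of sections. Since differentiating h^-1 produces only further products a
  h^-1 b, the derivatives of all orders are values of formal terms in this product, a class closed
  under formal differentiation. These products are in general not Hermitian, whereas the topology
  lives on Hermitian fields. The analysis is therefore done on all sesquilinear fields, and the
  Hermitian part is taken at the very end.\<close>

no_notation Matrix.vec_index (infixl "$" 100)
no_notation Matrix.scalar_prod (infix "\<bullet>" 70)
hide_const (open) Determinant.det Matrix.mat Matrix.row Matrix.vec Matrix.transpose_mat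
hide_type (open) Matrix.vec
hide_fact (open) Matrix.vec_eq_iff Matrix.mat_def Matrix.row_def Determinant.det_def

section \<open>Convergence of functions with all their partial derivatives\<close>

text \<open>\<open>partial_deriv\<close> differentiates along a two-sided line, while W is open only
  relative to \<open>coords n\<close>. The line moves a coordinate below n and so stays in
  \<open>coords n\<close>; near the base point it therefore stays in W, and derivatives on W depend
  only on values on W.\<close>

lemma coords_line_open:
  assumes "openin (top_of_set (coords n)) W" "y \<in> W" "i < n"
  shows "open {t. y(i := t) \<in> W}"
proof -
  obtain T where T: "open T" "W = coords n \<inter> T"
    using assms(1) by (auto simp: openin_open)
  have "y(i := t) \<in> coords n" for t
    using assms T by (auto simp: coords_def PiE_iff extensional_def)
  then have "{t. y(i := t) \<in> W} = (\<lambda>t. y(i := t)) -` T"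
    using T by auto
  moreover have "continuous_on UNIV (\<lambda>t. y(i := t))"
  proof (rule continuous_on_coordinatewise_then_product)
    show "continuous_on UNIV (\<lambda>t. (y(i := t)) j)" for j
      by (cases "j = i") (auto intro: continuous_on_id continuous_on_const)
  qed
  ultimately show ?thesis
    using T open_vimage by metis
qed

lemma eventually_coords_line:
  assumes "openin (top_of_set (coords n)) W" "y \<in> W" "i < n"
  shows "\<forall>\<^sub>F t in nhds (y i). y(i := t) \<in> W"
  using coords_line_open[OF assms] assms(2) by (auto simp: eventually_nhds)

definition diff_coord :: "nat \<Rightarrow> ((nat \<Rightarrow> real) \<Rightarrow> 'b::real_normed_vector) \<Rightarrow> (nat \<Rightarrow> real) \<Rightarrow> bool" where
  "diff_coord i f y \<longleftrightarrow> (\<lambda>t. f (y(i := t))) differentiable at (y i)"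

lemma diff_coord_iff:
  "diff_coord i f y \<longleftrightarrow>
     ((\<lambda>t. f (y(i := t))) has_vector_derivative partial_deriv i f y) (at (y i))"
  unfolding diff_coord_def partial_deriv_def by (rule vector_derivative_works)

lemma partial_derivI:
  "((\<lambda>t. f (y(i := t))) has_vector_derivative d) (at (y i)) \<Longrightarrow>
     diff_coord i f y \<and> partial_deriv i f y = d"
  unfolding diff_coord_def partial_deriv_def
  by (auto intro: vector_derivative_at differentiableI_vector)

lemma diff_coord_cong:
  assumes "openin (top_of_set (coords n)) W" "y \<in> W" "i < n"
    and "\<And>y. y \<in> W \<Longrightarrow> f y = f' y"
  shows "diff_coord i f y \<longleftrightarrow> diff_coord i f' y"
    and "partial_deriv i f y = partial_deriv i f' y"
proof -
  \<comment> \<open>\<open>vector_derivative\<close> is a choice from this predicate, so equal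
    predicates give equal partial derivatives even where no derivative exists.\<close>
  have "(\<lambda>D. ((\<lambda>t. f (y(i := t))) has_vector_derivative D) (at (y i))) =
      (\<lambda>D. ((\<lambda>t. f' (y(i := t))) has_vector_derivative D) (at (y i)))"
    using eventually_coords_line[OF assms(1-3)] assms(2,4)
    by (auto intro!: ext has_vector_derivative_cong_ev elim!: eventually_mono)
  then have "vector_derivative (\<lambda>t. f (y(i := t))) (at (y i)) =
      vector_derivative (\<lambda>t. f' (y(i := t))) (at (y i))"
      "(\<exists>D. ((\<lambda>t. f (y(i := t))) has_vector_derivative D) (at (y i))) \<longleftrightarrow>
      (\<exists>D. ((\<lambda>t. f' (y(i := t))) has_vector_derivative D) (at (y i)))"
    unfolding vector_derivative_def by metis+
  then show "diff_coord i f y \<longleftrightarrow> diff_coord i f' y"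
    and "partial_deriv i f y = partial_deriv i f' y"
    unfolding diff_coord_def partial_deriv_def
    by (simp_all, blast intro: differentiableI_vector dest: vector_derivative_works[THEN iffD1])
qed

text \<open>
  \<open>ck_lim k n W F f g\<close>: the functions \<open>f q\<close> converge to \<open>g\<close> along \<open>F\<close>, uniformly on compact subsets of
  \<open>W\<close> and together with their partial derivatives of order at most \<open>k\<close>.  For a constant family this
  says that \<open>g\<close> is of class \<open>C\<^sup>k\<close>, so that one set of closure rules serves both for the smoothness of
  sections and for the continuity of operations in the smooth topology.
\<close>

abbreviation c0_lim ::
    "(nat \<Rightarrow> real) set \<Rightarrow> 'q filter \<Rightarrow> ('q \<Rightarrow> (nat \<Rightarrow> real) \<Rightarrow> 'b::real_normed_vector) \<Rightarrow>
     ((nat \<Rightarrow> real) \<Rightarrow> 'b) \<Rightarrow> bool" where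
  "c0_lim W F f g \<equiv>
     (\<forall>K. compact K \<longrightarrow> K \<subseteq> W \<longrightarrow> uniform_limit K f g F) \<and>
     (\<forall>\<^sub>F q in F. continuous_on W (f q)) \<and> continuous_on W g"

primrec ck_lim ::
    "nat \<Rightarrow> nat \<Rightarrow> (nat \<Rightarrow> real) set \<Rightarrow> 'q filter \<Rightarrow> ('q \<Rightarrow> (nat \<Rightarrow> real) \<Rightarrow> 'b::real_normed_vector) \<Rightarrow>
     ((nat \<Rightarrow> real) \<Rightarrow> 'b) \<Rightarrow> bool" where
  "ck_lim 0 n W F f g \<longleftrightarrow> c0_lim W F f g"
| "ck_lim (Suc k) n W F f g \<longleftrightarrow> c0_lim W F f g \<and> (\<forall>i<n.
     (\<forall>\<^sub>F q in F. \<forall>y\<in>W. diff_coord i (f q) y) \<and> (\<forall>y\<in>W. diff_coord i g y) \<and>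
     ck_lim k n W F (\<lambda>q. partial_deriv i (f q)) (partial_deriv i g))"

text \<open>The product rule at order k + 1 leaves undifferentiated factors, which must be available
  at order k.\<close>

lemma ck_lim_lower: "ck_lim (Suc k) n W F f g \<Longrightarrow> ck_lim k n W F f g"
proof (induction k arbitrary: f g)
  case (Suc k)
  show ?case
    unfolding ck_lim.simps(2)[of k]
  proof (intro conjI allI impI)
    fix i assume "i < n"
    with Suc.prems[unfolded ck_lim.simps(2)[of "Suc k"]]
    show "\<forall>\<^sub>F q in F. \<forall>y\<in>W. diff_coord i (f q) y" "\<forall>y\<in>W. diff_coord i g y"
      "ck_lim k n W F (\<lambda>q. partial_deriv i (f q)) (partial_deriv i g)"
      by (auto intro: Suc.IH)
  qed (use Suc.prems in auto)
qed simp

lemma ck_lim_0: "ck_lim k n W F f g \<Longrightarrow> ck_lim 0 n W F f g"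
  by (cases k) auto

lemma ck_lim_cong:
  fixes g g' :: "(nat \<Rightarrow> real) \<Rightarrow> 'b::real_normed_vector"
  assumes "openin (top_of_set (coords n)) W"
    and "ck_lim k n W F f g" "\<forall>\<^sub>F q in F. \<forall>y\<in>W. f q y = f' q y" "\<And>y. y \<in> W \<Longrightarrow> g y = g' y"
  shows "ck_lim k n W F f' g'"
proof -
  have step0: "ck_lim 0 n W F f' g'"
    if lim: "ck_lim 0 n W F f g" and eq: "\<forall>\<^sub>F q in F. \<forall>y\<in>W. f q y = f' q y"
      "\<And>y. y \<in> W \<Longrightarrow> g y = g' y" for f f' and g g' :: "(nat \<Rightarrow> real) \<Rightarrow> 'b"
  proof -
    have "uniform_limit K f' g' F" if K: "compact K" "K \<subseteq> W" for K
    proof (rule uniform_limit_cong[THEN iffD1])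
      show "uniform_limit K f g F" using lim K by simp
      show "\<forall>\<^sub>F q in F. \<forall>y\<in>K. f q y = f' q y"
        using eq(1) by (rule eventually_mono) (use K in blast)
      show "g y = g' y" if "y \<in> K" for y using eq(2) that K by blast
    qed
    moreover have "\<forall>\<^sub>F q in F. continuous_on W (f' q)"
      using eq(1) lim[simplified, THEN conjunct2, THEN conjunct1]
      by eventually_elim (auto intro: continuous_on_eq)
    moreover have "continuous_on W g'"
      using lim eq(2) by (auto intro: continuous_on_eq)
    ultimately show ?thesis by simp
  qed
  show ?thesis
    using assms(2-)
  proof (induction k arbitrary: f g f' g')
    case 0
    then show ?case by (rule step0)
  next
    case (Suc k)
    have base: "ck_lim 0 n W F f' g'"
      by (rule step0[OF Suc.prems(1)[THEN ck_lim_0] Suc.prems(2,3)])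
    have "(\<forall>\<^sub>F q in F. \<forall>y\<in>W. diff_coord i (f' q) y) \<and> (\<forall>y\<in>W. diff_coord i g' y) \<and>
       ck_lim k n W F (\<lambda>q. partial_deriv i (f' q)) (partial_deriv i g')" if i: "i < n" for i
    proof (intro conjI)
      have *: "\<forall>\<^sub>F q in F. \<forall>y\<in>W. diff_coord i (f q) y" "\<forall>y\<in>W. diff_coord i g y"
        "ck_lim k n W F (\<lambda>q. partial_deriv i (f q)) (partial_deriv i g)"
        using Suc.prems(1) i by auto
      have D: "diff_coord i a y \<longleftrightarrow> diff_coord i b y" "partial_deriv i a y = partial_deriv i b y"
        if "\<forall>y\<in>W. a y = b y" "y \<in> W" for y and a b :: "(nat \<Rightarrow> real) \<Rightarrow> 'b"
        using diff_coord_cong[OF assms(1) that(2) i] that(1) by blast+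
      show "\<forall>\<^sub>F q in F. \<forall>y\<in>W. diff_coord i (f' q) y"
        using *(1) Suc.prems(2)
      proof eventually_elim
        case (elim q)
        then show ?case using D(1) by blast
      qed
      show "\<forall>y\<in>W. diff_coord i g' y"
        using *(2) Suc.prems(3) D(1)[of g g'] by blast
      show "ck_lim k n W F (\<lambda>q. partial_deriv i (f' q)) (partial_deriv i g')"
      proof (rule Suc.IH[OF *(3)])
        show "\<forall>\<^sub>F q in F. \<forall>y\<in>W. partial_deriv i (f q) y = partial_deriv i (f' q) y"
          using Suc.prems(2)
        proof eventually_elim
          case (elim q)
          then show ?case using D(2) by blast
        qed
        show "partial_deriv i g y = partial_deriv i g' y" if "y \<in> W" for y
          using Suc.prems(3) D(2)[of g g'] that by blast
      qed
    qed
    with base show ?case by simp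
  qed
qed

text \<open>Covers coefficients that vary with the parameter but not with the point, as in
  \<open>sec_lim_scaleR\<close>.\<close>

lemma ck_lim_const_tendsto:
  fixes b :: "'b::real_normed_vector"
  shows "(a \<longlongrightarrow> b) F \<Longrightarrow> ck_lim k n W F (\<lambda>q _. a q) (\<lambda>_. b)"
proof (induction k arbitrary: a b)
  case 0
  then show ?case by (auto simp: uniform_limit_iff tendsto_iff)
next
  case (Suc k)
  have "diff_coord i (\<lambda>_. c) y \<and> partial_deriv i (\<lambda>_. c) y = 0" for i y and c :: "'b"
    by (rule partial_derivI) (rule has_vector_derivative_const)
  then have "\<And>i c y. diff_coord i (\<lambda>_. c :: 'b) y" "\<And>i c. partial_deriv i (\<lambda>_. c :: 'b) = (\<lambda>_. 0)"
    by auto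
  then show ?case
    using Suc.IH[OF tendsto_const[of "0 :: 'b"]] ck_lim_0[OF Suc.IH[OF Suc.prems]] by simp
qed

lemma ck_lim_const: "ck_lim k n W F (\<lambda>_ _. a) (\<lambda>_. a)"
  by (rule ck_lim_const_tendsto) (rule tendsto_const)

text \<open>The calculus rules deliver derivatives as formulas valid only on W, and for the family
  only eventually along F, not as literal values of \<open>partial_deriv\<close>; this rule accepts
  them in that form.\<close>

lemma ck_lim_SucI:
  fixes g :: "(nat \<Rightarrow> real) \<Rightarrow> 'b::real_normed_vector"
  assumes W: "openin (top_of_set (coords n)) W" and "ck_lim 0 n W F f g"
    and f: "\<And>i. i < n \<Longrightarrow> \<forall>\<^sub>F q in F. \<forall>y\<in>W. diff_coord i (f q) y \<and> partial_deriv i (f q) y = f' i q y"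
    and g: "\<And>i y. i < n \<Longrightarrow> y \<in> W \<Longrightarrow> diff_coord i g y \<and> partial_deriv i g y = g' i y"
    and lim: "\<And>i. i < n \<Longrightarrow> ck_lim k n W F (f' i) (g' i)"
  shows "ck_lim (Suc k) n W F f g"
  unfolding ck_lim.simps(2)
proof (intro conjI allI impI ballI)
  fix i assume i: "i < n"
  show "\<forall>\<^sub>F q in F. \<forall>y\<in>W. diff_coord i (f q) y"
    using f[OF i] by (rule eventually_mono) simp
  show "diff_coord i g y" if "y \<in> W" for y using g[OF i that] by simp
  show "ck_lim k n W F (\<lambda>q. partial_deriv i (f q)) (partial_deriv i g)"
  proof (rule ck_lim_cong[OF W lim[OF i]])
    show "\<forall>\<^sub>F q in F. \<forall>y\<in>W. f' i q y = partial_deriv i (f q) y"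
      using f[OF i] by (rule eventually_mono) simp
  qed (use g[OF i] in simp)
qed (use assms(2) in simp_all)

lemma ck_lim_SucD:
  assumes "ck_lim (Suc k) n W F f g" "i < n"
  shows "\<forall>\<^sub>F q in F. \<forall>y\<in>W. diff_coord i (f q) y" "y \<in> W \<Longrightarrow> diff_coord i g y"
    "ck_lim k n W F (\<lambda>q. partial_deriv i (f q)) (partial_deriv i g)"
  using assms by simp_all

section \<open>Closure of convergence under sums, products and reciprocals\<close>

lemma ck_lim_add:
  fixes g g' :: "(nat \<Rightarrow> real) \<Rightarrow> 'b::real_normed_vector"
  assumes W: "openin (top_of_set (coords n)) W"
  shows "ck_lim k n W F f g \<Longrightarrow> ck_lim k n W F f' g' \<Longrightarrow>
    ck_lim k n W F (\<lambda>q y. f q y + f' q y) (\<lambda>y. g y + g' y)"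
proof (induction k arbitrary: f g f' g')
  case 0
  then show ?case
    by (auto intro!: uniform_limit_add continuous_on_add elim: eventually_elim2)
next
  case (Suc k)
  have base: "ck_lim 0 n W F (\<lambda>q y. f q y + f' q y) (\<lambda>y. g y + g' y)"
    using Suc.prems[THEN ck_lim_0]
    by (auto intro!: uniform_limit_add continuous_on_add elim: eventually_elim2)
  have D: "diff_coord i (\<lambda>y. a y + b y) y \<and>
      partial_deriv i (\<lambda>y. a y + b y) y = partial_deriv i a y + partial_deriv i b y"
    if "diff_coord i a y" "diff_coord i b y" for i y and a b :: "(nat \<Rightarrow> real) \<Rightarrow> 'b"
    using that unfolding diff_coord_iff[of i a] diff_coord_iff[of i b]
    by (intro partial_derivI) (rule has_vector_derivative_add)
  note S = ck_lim_SucD[OF Suc.prems(1)] and S' = ck_lim_SucD[OF Suc.prems(2)]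
  show ?case
  proof (rule ck_lim_SucI[OF W base])
    fix i assume i: "i < n"
    show "\<forall>\<^sub>F q in F. \<forall>y\<in>W. diff_coord i (\<lambda>y. f q y + f' q y) y \<and>
        partial_deriv i (\<lambda>y. f q y + f' q y) y = partial_deriv i (f q) y + partial_deriv i (f' q) y"
      using S(1)[OF i] S'(1)[OF i] by eventually_elim (simp add: D)
    show "ck_lim k n W F (\<lambda>q y. partial_deriv i (f q) y + partial_deriv i (f' q) y)
        (\<lambda>y. partial_deriv i g y + partial_deriv i g' y)"
      by (rule Suc.IH[OF S(3)[OF i] S'(3)[OF i]])
  qed (rule D[OF S(2) S'(2)])
qed

lemma ck_lim_bounded_linear:
  fixes g :: "(nat \<Rightarrow> real) \<Rightarrow> 'b::real_normed_vector" and T :: "'b \<Rightarrow> 'c::real_normed_vector"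
  assumes W: "openin (top_of_set (coords n)) W" and T: "bounded_linear T"
  shows "ck_lim k n W F f g \<Longrightarrow> ck_lim k n W F (\<lambda>q y. T (f q y)) (\<lambda>y. T (g y))"
proof (induction k arbitrary: f g)
  case 0
  then show ?case
    by (auto intro!: bounded_linear.uniform_limit[OF T] bounded_linear.continuous_on[OF T]
        elim: eventually_mono)
next
  case (Suc k)
  have base: "ck_lim 0 n W F (\<lambda>q y. T (f q y)) (\<lambda>y. T (g y))"
    using Suc.prems[THEN ck_lim_0]
    by (auto intro!: bounded_linear.uniform_limit[OF T] bounded_linear.continuous_on[OF T]
        elim: eventually_mono)
  have D: "diff_coord i (\<lambda>y. T (a y)) y \<and>
      partial_deriv i (\<lambda>y. T (a y)) y = T (partial_deriv i a y)"
    if "diff_coord i a y" for i y and a :: "(nat \<Rightarrow> real) \<Rightarrow> 'b"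
    using that unfolding diff_coord_iff[of i a]
    by (intro partial_derivI) (rule bounded_linear.has_vector_derivative[OF T])
  note S = ck_lim_SucD[OF Suc.prems]
  show ?case
  proof (rule ck_lim_SucI[OF W base])
    fix i assume i: "i < n"
    show "\<forall>\<^sub>F q in F. \<forall>y\<in>W. diff_coord i (\<lambda>y. T (f q y)) y \<and>
        partial_deriv i (\<lambda>y. T (f q y)) y = T (partial_deriv i (f q) y)"
      using S(1)[OF i] by eventually_elim (simp add: D)
    show "ck_lim k n W F (\<lambda>q y. T (partial_deriv i (f q) y)) (\<lambda>y. T (partial_deriv i g y))"
      by (rule Suc.IH[OF S(3)[OF i]])
  qed (rule D[OF S(2)])
qed

text \<open>Uniform limits can be multiplied when the limits are bounded. On compact sets this
  follows from their continuity, which is why \<open>c0_lim\<close> records continuity of the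
  limit.\<close>

lemma ck_lim_0_mult:
  fixes g g' :: "(nat \<Rightarrow> real) \<Rightarrow> 'b::real_normed_algebra"
  assumes "ck_lim 0 n W F f g" "ck_lim 0 n W F f' g'"
  shows "ck_lim 0 n W F (\<lambda>q y. f q y * f' q y) (\<lambda>y. g y * g' y)"
proof -
  have "uniform_limit K (\<lambda>q y. f q y * f' q y) (\<lambda>y. g y * g' y) F" if "compact K" "K \<subseteq> W" for K
    using assms that
    by (intro uniform_lim_mult)
      (auto intro!: compact_imp_bounded compact_continuous_image intro: continuous_on_subset)
  moreover have "\<forall>\<^sub>F q in F. continuous_on W (\<lambda>y. f q y * f' q y)"
    using assms by (auto intro: continuous_on_mult elim: eventually_elim2)
  moreover have "continuous_on W (\<lambda>y. g y * g' y)"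
    using assms by (auto intro: continuous_on_mult)
  ultimately show ?thesis by simp
qed

lemma ck_lim_mult:
  fixes g g' :: "(nat \<Rightarrow> real) \<Rightarrow> 'b::real_normed_algebra"
  assumes W: "openin (top_of_set (coords n)) W"
  shows "ck_lim k n W F f g \<Longrightarrow> ck_lim k n W F f' g' \<Longrightarrow>
    ck_lim k n W F (\<lambda>q y. f q y * f' q y) (\<lambda>y. g y * g' y)"
proof (induction k arbitrary: f g f' g')
  case 0
  then show ?case by (rule ck_lim_0_mult)
next
  case (Suc k)
  have base: "ck_lim 0 n W F (\<lambda>q y. f q y * f' q y) (\<lambda>y. g y * g' y)"
    by (rule ck_lim_0_mult) (rule Suc.prems[THEN ck_lim_0])+
  have D: "diff_coord i (\<lambda>y. a y * b y) y \<and>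
      partial_deriv i (\<lambda>y. a y * b y) y = a y * partial_deriv i b y + partial_deriv i a y * b y"
    if "diff_coord i a y" "diff_coord i b y" for i y and a b :: "(nat \<Rightarrow> real) \<Rightarrow> 'b"
    using has_vector_derivative_mult[OF that[unfolded diff_coord_iff]]
    by (intro partial_derivI) simp
  note S = ck_lim_SucD[OF Suc.prems(1)] and S' = ck_lim_SucD[OF Suc.prems(2)]
  show ?case
  proof (rule ck_lim_SucI[OF W base])
    fix i assume i: "i < n"
    show "\<forall>\<^sub>F q in F. \<forall>y\<in>W. diff_coord i (\<lambda>y. f q y * f' q y) y \<and> partial_deriv i (\<lambda>y. f q y * f' q y) y =
        f q y * partial_deriv i (f' q) y + partial_deriv i (f q) y * f' q y"
      using S(1)[OF i] S'(1)[OF i] by eventually_elim (simp add: D)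
    show "ck_lim k n W F (\<lambda>q y. f q y * partial_deriv i (f' q) y + partial_deriv i (f q) y * f' q y)
        (\<lambda>y. g y * partial_deriv i g' y + partial_deriv i g y * g' y)"
      by (intro ck_lim_add[OF W] Suc.IH Suc.prems[THEN ck_lim_lower] S(3)[OF i] S'(3)[OF i])
  qed (rule D[OF S(2) S'(2)])
qed

lemma ck_lim_0_inverse:
  fixes g :: "(nat \<Rightarrow> real) \<Rightarrow> 'b::real_normed_field"
  assumes "ck_lim 0 n W F f g" "\<forall>\<^sub>F q in F. \<forall>y\<in>W. f q y \<noteq> 0" "\<And>y. y \<in> W \<Longrightarrow> g y \<noteq> 0"
  shows "ck_lim 0 n W F (\<lambda>q y. inverse (f q y)) (\<lambda>y. inverse (g y))"
proof -
  have "uniform_limit K (\<lambda>q y. inverse (f q y)) (\<lambda>y. inverse (g y)) F" if K: "compact K" "K \<subseteq> W" for K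
  proof (cases "K = {}")
    case False
    \<comment> \<open>Reciprocals preserve uniform convergence only away from 0; the minimum of |g|
      on the nonempty compact set K is the required positive lower bound.\<close>
    have "continuous_on K (\<lambda>y. norm (g y))"
      using assms K by (auto intro!: continuous_on_norm intro: continuous_on_subset)
    from continuous_attains_inf[OF K(1) False this]
    obtain z where z: "z \<in> K" "\<And>y. y \<in> K \<Longrightarrow> norm (g z) \<le> norm (g y)" by auto
    then have "norm (g z) > 0" using assms K by auto
    from uniform_lim_inverse[where f=f and F=F, OF _ z(2) this] show ?thesis
      using assms K by (auto simp: o_def)
  qed simp
  moreover have "\<forall>\<^sub>F q in F. continuous_on W (f q)" using assms by simp
  then have "\<forall>\<^sub>F q in F. continuous_on W (\<lambda>y. inverse (f q y))"
    using assms(2) by eventually_elim (auto intro!: continuous_on_inverse)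
  moreover have "continuous_on W (\<lambda>y. inverse (g y))"
    using assms by (auto intro: continuous_on_inverse)
  ultimately show ?thesis by simp
qed

text \<open>The derivative - f' / f^2 is a product of f' with copies of 1 / f, so the induction
  hypothesis for the same f and the product rule close the step.\<close>

lemma ck_lim_inverse:
  fixes g :: "(nat \<Rightarrow> real) \<Rightarrow> 'b::real_normed_field"
  assumes W: "openin (top_of_set (coords n)) W"
    and nz: "\<forall>\<^sub>F q in F. \<forall>y\<in>W. f q y \<noteq> 0" "\<And>y. y \<in> W \<Longrightarrow> g y \<noteq> 0"
  shows "ck_lim k n W F f g \<Longrightarrow> ck_lim k n W F (\<lambda>q y. inverse (f q y)) (\<lambda>y. inverse (g y))"
proof (induction k)
  case 0
  then show ?case using nz by (rule ck_lim_0_inverse)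
next
  case (Suc k)
  have base: "ck_lim 0 n W F (\<lambda>q y. inverse (f q y)) (\<lambda>y. inverse (g y))"
    by (rule ck_lim_0_inverse[OF Suc.prems[THEN ck_lim_0] nz])
  have D: "diff_coord i (\<lambda>y. inverse (a y)) y \<and>
      partial_deriv i (\<lambda>y. inverse (a y)) y = - (inverse (a y) * inverse (a y) * partial_deriv i a y)"
    if "diff_coord i a y" "a y \<noteq> 0" for i y and a :: "(nat \<Rightarrow> real) \<Rightarrow> 'b"
  proof (rule partial_derivI)
    have "((\<lambda>t. a (y(i := t))) has_derivative (\<lambda>h. h *\<^sub>R partial_deriv i a y)) (at (y i))"
      using that(1) by (simp add: diff_coord_iff has_vector_derivative_def)
    from Deriv.has_derivative_inverse[OF _ this] that(2)
    show "((\<lambda>t. inverse (a (y(i := t)))) has_vector_derivative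
        - (inverse (a y) * inverse (a y) * partial_deriv i a y)) (at (y i))"
      by (simp add: has_vector_derivative_def algebra_simps)
  qed
  have I: "ck_lim k n W F (\<lambda>q y. inverse (f q y)) (\<lambda>y. inverse (g y))"
    by (rule Suc.IH[OF ck_lim_lower[OF Suc.prems]])
  note S = ck_lim_SucD[OF Suc.prems]
  show ?case
  proof (rule ck_lim_SucI[OF W base])
    fix i assume i: "i < n"
    show "\<forall>\<^sub>F q in F. \<forall>y\<in>W. diff_coord i (\<lambda>y. inverse (f q y)) y \<and> partial_deriv i (\<lambda>y. inverse (f q y)) y =
        - (inverse (f q y) * inverse (f q y) * partial_deriv i (f q) y)"
      using S(1)[OF i] nz(1) by eventually_elim (simp add: D)
    show "ck_lim k n W F (\<lambda>q y. - (inverse (f q y) * inverse (f q y) * partial_deriv i (f q) y))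
        (\<lambda>y. - (inverse (g y) * inverse (g y) * partial_deriv i g y))"
      by (rule ck_lim_bounded_linear[OF W bounded_linear_minus[OF bounded_linear_ident]
            ck_lim_mult[OF W ck_lim_mult[OF W I I] S(3)[OF i]]])
  qed (rule D[OF S(2) nz(2)])
qed

lemma ck_lim_sum:
  assumes W: "openin (top_of_set (coords n)) W"
    and "\<And>j. j \<in> J \<Longrightarrow> ck_lim k n W F (\<lambda>q. f q j) (g j)"
  shows "ck_lim k n W F (\<lambda>q y. \<Sum>j\<in>J. f q j y) (\<lambda>y. \<Sum>j\<in>J. g j y)"
  using assms(2)
  by (induction J rule: infinite_finite_induct) (auto intro: ck_lim_const ck_lim_add[OF W])

lemma ck_lim_prod:
  fixes g :: "'j \<Rightarrow> (nat \<Rightarrow> real) \<Rightarrow> 'b::real_normed_field"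
  assumes W: "openin (top_of_set (coords n)) W"
    and "\<And>j. j \<in> J \<Longrightarrow> ck_lim k n W F (\<lambda>q. f q j) (g j)"
  shows "ck_lim k n W F (\<lambda>q y. \<Prod>j\<in>J. f q j y) (\<lambda>y. \<Prod>j\<in>J. g j y)"
  using assms(2)
  by (induction J rule: infinite_finite_induct) (auto intro: ck_lim_const ck_lim_mult[OF W])

section \<open>Comparison with iterated partial derivatives\<close>

lemma partials_append: "partials (is @ js) f = partials is (partials js f)"
  by (induction "is") auto

lemma smooth_fun_on_partial:
  assumes "smooth_fun_on n W f" "i < n"
  shows "smooth_fun_on n W (partial_deriv i f)"
proof -
  have "partials is (partial_deriv i f) = partials (is @ [i]) f" for "is"
    by (simp add: partials_append)
  then show ?thesis
    using assms by (auto simp: smooth_fun_on_def)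
qed

lemma smooth_fun_onD:
  assumes "smooth_fun_on n W f"
  shows "continuous_on W f" "i < n \<Longrightarrow> y \<in> W \<Longrightarrow> diff_coord i f y"
  using assms[unfolded smooth_fun_on_def, rule_format, of "[]"]
  by (auto simp: diff_coord_def)

text \<open>The seminorms of the smooth topology control each iterated derivative separately; this
  passes from them to the recursive form in which the closure rules are proved.\<close>

lemma ck_limI:
  assumes "\<forall>\<^sub>F q in F. smooth_fun_on n W (f q)" "smooth_fun_on n W g"
    and "\<And>is K. is \<in> lists {..<n} \<Longrightarrow> compact K \<Longrightarrow> K \<subseteq> W \<Longrightarrow>
      uniform_limit K (\<lambda>q. partials is (f q)) (partials is g) F"
  shows "ck_lim k n W F f g"
  using assms
proof (induction k arbitrary: f g)
  case 0
  have "\<forall>\<^sub>F q in F. continuous_on W (f q)"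
    using 0(1) by (rule eventually_mono) (rule smooth_fun_onD)
  then show ?case
    using 0(3)[of "[]"] smooth_fun_onD(1)[OF 0(2)] by auto
next
  case (Suc k)
  have base: "c0_lim W F f g"
    using eventually_mono[OF Suc.prems(1) smooth_fun_onD(1)] Suc.prems(3)[of "[]"]
      smooth_fun_onD(1)[OF Suc.prems(2)] by auto
  have step: "(\<forall>\<^sub>F q in F. \<forall>y\<in>W. diff_coord i (f q) y) \<and> (\<forall>y\<in>W. diff_coord i g y) \<and>
     ck_lim k n W F (\<lambda>q. partial_deriv i (f q)) (partial_deriv i g)" if i: "i < n" for i
  proof (intro conjI)
    show "\<forall>\<^sub>F q in F. \<forall>y\<in>W. diff_coord i (f q) y"
      using Suc.prems(1) by (rule eventually_mono) (use smooth_fun_onD(2) i in blast)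
    show "\<forall>y\<in>W. diff_coord i g y"
      using Suc.prems(2) smooth_fun_onD(2) i by blast
    show "ck_lim k n W F (\<lambda>q. partial_deriv i (f q)) (partial_deriv i g)"
    proof (rule Suc.IH)
      show "\<forall>\<^sub>F q in F. smooth_fun_on n W (partial_deriv i (f q))"
        using Suc.prems(1) by (rule eventually_mono) (use smooth_fun_on_partial i in blast)
      show "smooth_fun_on n W (partial_deriv i g)"
        using Suc.prems(2) i by (rule smooth_fun_on_partial)
      show "uniform_limit K (\<lambda>q. partials is (partial_deriv i (f q))) (partials is (partial_deriv i g)) F"
        if "is \<in> lists {..<n}" "compact K" "K \<subseteq> W" for "is" K
        using Suc.prems(3)[of "is @ [i]" K] that i by (simp add: partials_append)
    qed
  qed
  show ?case
    using base step by simp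
qed

lemma smooth_imp_ck_lim: "smooth_fun_on n W g \<Longrightarrow> ck_lim k n W F (\<lambda>_. g) g"
  by (rule ck_limI) (auto intro: uniform_limit_const)

text \<open>\<open>partials\<close> applies the head of its list last, whereas \<open>ck_lim\<close>
  peels off the innermost derivative; hence the induction from the end of the list.\<close>

lemma ck_lim_partials:
  assumes "\<And>k. ck_lim k n W F f g" "is \<in> lists {..<n}"
  shows "ck_lim k n W F (\<lambda>q. partials is (f q)) (partials is g)"
  using assms
proof (induction "is" arbitrary: f g rule: rev_induct)
  case (snoc i "is")
  have "ck_lim k n W F (\<lambda>q. partial_deriv i (f q)) (partial_deriv i g)" for k
    using snoc.prems(1)[of "Suc k"] snoc.prems(2) by simp
  from snoc.IH[OF this] snoc.prems(2) show ?case
    by (simp add: partials_append)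
qed simp

text \<open>What \<open>ck_lim\<close> demands of g alone does not mention F, so smoothness can be
  read off from convergence along any filter, even the trivial one.\<close>

lemma ck_lim_imp_smooth:
  assumes "\<And>k. ck_lim k n W F f g"
  shows "smooth_fun_on n W g"
  unfolding smooth_fun_on_def
proof (intro ballI conjI allI impI)
  fix "is" assume isl: "is \<in> lists {..<n}"
  show "continuous_on W (partials is g)"
    using ck_lim_partials[OF assms isl, of 0] by simp
  show "(\<lambda>t. partials is g (y(i := t))) differentiable at (y i)" if "i < n" "y \<in> W" for i y
    using ck_lim_partials[OF assms isl, of "Suc 0"] that by (auto simp: diff_coord_def)
qed

text \<open>Seminorm balls speak of derivatives of w - v, uniform limits of differences of
  derivatives; this connects the two.\<close>

lemma partials_diff:
  assumes W: "openin (top_of_set (coords n)) W"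
    and f: "smooth_fun_on n W f" and g: "smooth_fun_on n W g"
    and "is \<in> lists {..<n}" "y \<in> W"
  shows "partials is (\<lambda>y. f y - g y) y = partials is f y - partials is g y"
  using assms(4,5)
proof (induction "is" arbitrary: y rule: list.induct)
  case (Cons i "is")
  then have i: "i < n" and isl: "is \<in> lists {..<n}" by auto
  have "partial_deriv i (partials is (\<lambda>y. f y - g y)) y
      = partial_deriv i (\<lambda>y. partials is f y - partials is g y) y"
    by (rule diff_coord_cong(2)[OF W Cons.prems(2) i]) (rule Cons.IH[OF isl])
  also have "\<dots> = partial_deriv i (partials is f) y - partial_deriv i (partials is g) y"
  proof (rule partial_derivI[THEN conjunct2], rule has_vector_derivative_diff)
    have "diff_coord i (partials is f) y" "diff_coord i (partials is g) y"
      using f g isl i Cons.prems(2) by (auto simp: smooth_fun_on_def diff_coord_def)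
    then show "((\<lambda>t. partials is f (y(i := t))) has_vector_derivative partial_deriv i (partials is f) y) (at (y i))"
      "((\<lambda>t. partials is g (y(i := t))) has_vector_derivative partial_deriv i (partials is g) y) (at (y i))"
      by (simp_all add: diff_coord_iff)
  qed
  finally show ?case by simp
qed simp

section \<open>Hermitian matrices\<close>

lemma matrix_inv_mult:
  fixes A :: "'a::field^'n^'n"
  assumes "det A \<noteq> 0"
  shows "A ** matrix_inv A = mat 1" "matrix_inv A ** A = mat 1"
proof -
  have "\<exists>B. A ** B = mat 1 \<and> B ** A = mat 1"
    using assms invertible_det_nz[of A] by (simp add: invertible_def)
  then have "A ** matrix_inv A = mat 1 \<and> matrix_inv A ** A = mat 1"
    unfolding matrix_inv_def by (rule someI_ex)
  then show "A ** matrix_inv A = mat 1" "matrix_inv A ** A = mat 1" by auto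
qed

lemma matrix_inv_unique:
  fixes A :: "'a::field^'n^'n"
  assumes "det A \<noteq> 0" "A ** B = mat 1"
  shows "matrix_inv A = B"
  by (metis assms matrix_inv_mult(2) matrix_mul_assoc matrix_mul_lid matrix_mul_rid)

text \<open>Cramer's rule writes each entry of the inverse with sums, products and a single
  reciprocal, the operations under which \<open>ck_lim\<close> is closed.\<close>

lemma matrix_inv_cramer:
  fixes A :: "'a::field^'n^'n"
  assumes "det A \<noteq> 0"
  shows "matrix_inv A $ k $ j =
    det (\<chi> i l. if l = k then (if i = j then 1 else 0) else A $ i $ l) * inverse (det A)"
proof -
  have "A *v column j (matrix_inv A) = (\<chi> i. if i = j then 1 else 0)"
    using matrix_inv_mult(1)[OF assms]
    by (simp add: vec_eq_iff matrix_vector_mult_def matrix_matrix_mult_def column_def mat_def)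
  with cramer_lemma[of k A "column j (matrix_inv A)"]
  have "det (\<chi> i l. if l = k then (if i = j then 1 else 0) else A $ i $ l) = matrix_inv A $ k $ j * det A"
    by (simp add: column_def cong: if_cong)
  then show ?thesis using assms by simp
qed

definition herm_form :: "complex^'n^'n \<Rightarrow> complex^'n \<Rightarrow> complex^'n \<Rightarrow> complex" where
  "herm_form H x y = (\<Sum>i\<in>UNIV. \<Sum>j\<in>UNIV. x $ i * H $ i $ j * cnj (y $ j))"

definition adjoint_matrix :: "complex^'n^'m \<Rightarrow> complex^'m^'n" where
  "adjoint_matrix A = (\<chi> i j. cnj (A $ j $ i))"

definition hermitian_matrix :: "complex^'n^'n \<Rightarrow> bool" where
  "hermitian_matrix A \<longleftrightarrow> adjoint_matrix A = A"

definition posdef_matrix :: "complex^'n^'n \<Rightarrow> bool" where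
  "posdef_matrix A \<longleftrightarrow> hermitian_matrix A \<and> (\<forall>x. x \<noteq> 0 \<longrightarrow> Re (herm_form A x x) > 0)"

lemma adjoint_matrix_mult: "adjoint_matrix (A ** B) = adjoint_matrix B ** adjoint_matrix A"
  by (simp add: vec_eq_iff adjoint_matrix_def matrix_matrix_mult_def mult.commute)

lemma adjoint_adjoint_matrix [simp]: "adjoint_matrix (adjoint_matrix A) = A"
  by (simp add: vec_eq_iff adjoint_matrix_def)

lemma herm_form_scale:
  "herm_form H (a *s x) y = a * herm_form H x y"
  "herm_form H x (a *s y) = cnj a * herm_form H x y"
  by (simp_all add: herm_form_def sum_distrib_left mult_ac)

lemma herm_form_0 [simp]: "herm_form H 0 y = 0" "herm_form H x 0 = 0"
  by (simp_all add: herm_form_def)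

lemma herm_form_swap:
  assumes "hermitian_matrix H"
  shows "herm_form H y x = cnj (herm_form H x y)"
proof -
  have "cnj (H $ i $ j) = H $ j $ i" for i j
    using assms[unfolded hermitian_matrix_def]
    by (auto simp: vec_eq_iff adjoint_matrix_def)
  then show ?thesis
    unfolding herm_form_def
    by (subst sum.swap) (simp add: mult_ac)
qed

lemma posdef_det_nz:
  assumes "posdef_matrix H"
  shows "det H \<noteq> 0"
proof -
  have "x = 0" if "H *v x = 0" for x
  proof (rule ccontr)
    assume "x \<noteq> 0"
    \<comment> \<open>\<open>herm_form\<close> conjugates its second argument, so its value at the
      conjugate z of x is the sum of the z_i (H x)_i, which vanishes for x in the kernel.\<close>
    define z where "z = (\<chi> i. cnj (x $ i))"
    have "z \<noteq> 0" using \<open>x \<noteq> 0\<close> by (auto simp: z_def vec_eq_iff)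
    have "herm_form H z z = (\<Sum>i\<in>UNIV. z $ i * (H *v x) $ i)"
      by (simp add: herm_form_def z_def matrix_vector_mult_def sum_distrib_left mult_ac)
    then show False
      using assms that \<open>z \<noteq> 0\<close> by (auto simp: posdef_matrix_def)
  qed
  then have "\<exists>B. B ** H = mat 1"
    by (simp add: matrix_left_invertible_ker)
  then show ?thesis
    by (simp add: invertible_left_inverse invertible_det_nz[symmetric])
qed

text \<open>Gram-Schmidt without tracking spans: as long as fewer than \<open>CARD('n)\<close> orthonormal vectors have
  been found, their orthogonality conditions have a nonzero solution.\<close>

lemma posdef_orthonormal:
  fixes H :: "complex^'n^'n"
  assumes "posdef_matrix H" "finite I"
  shows "\<exists>b :: 'n \<Rightarrow> complex^'n. \<forall>i\<in>I. \<forall>j\<in>I. herm_form H (b i) (b j) = (if i = j then 1 else 0)"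
  using assms(2)
proof (induction I rule: finite_induct)
  case (insert j0 I)
  have herm: "hermitian_matrix H" using assms by (simp add: posdef_matrix_def)
  obtain b :: "'n \<Rightarrow> complex^'n"
    where b: "\<And>i j. i \<in> I \<Longrightarrow> j \<in> I \<Longrightarrow> herm_form H (b i) (b j) = (if i = j then 1 else 0)"
    using insert.IH by blast
  \<comment> \<open>The rows with index in I are the orthogonality conditions, all others are zero.
    As j0 is not in I, M is singular.\<close>
  define M :: "complex^'n^'n" where
    "M = (\<chi> i k. if i \<in> I then (\<Sum>j\<in>UNIV. H $ k $ j * cnj (b i $ j)) else 0)"
  have "row j0 M = 0"
    using insert.hyps by (simp add: M_def row_def vec_eq_iff)
  then have "det M = 0" by (rule det_zero_row)
  then have "\<not> (\<exists>B. B ** M = mat 1)"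
    using invertible_det_nz[of M] by (simp add: invertible_left_inverse)
  then obtain z where z: "M *v z = 0" "z \<noteq> 0"
    unfolding matrix_left_invertible_ker by blast
  have orth: "herm_form H z (b i) = 0" if "i \<in> I" for i
  proof -
    have "herm_form H z (b i) = (M *v z) $ i"
      using that by (simp add: herm_form_def M_def matrix_vector_mult_def sum_distrib_left mult_ac)
    then show ?thesis using z by simp
  qed
  define c where "c = Re (herm_form H z z)"
  have "c > 0" using assms z by (simp add: c_def posdef_matrix_def)
  have hz: "herm_form H z z = of_real c"
    using herm_form_swap[OF herm, of z z] by (auto simp: c_def complex_eq_iff)
  define z' where "z' = of_real (1 / sqrt c) *s z"
  have "herm_form H z' z' = of_real (1 / sqrt c * (1 / sqrt c) * c)"
    unfolding z'_def herm_form_scale hz by (simp only: complex_cnj_complex_of_real of_real_mult mult.assoc)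
  also have "1 / sqrt c * (1 / sqrt c) * c = 1"
    using \<open>c > 0\<close> by (simp add: field_simps)
  finally have 1: "herm_form H z' z' = 1" by simp
  have 2: "herm_form H z' (b i) = 0" "herm_form H (b i) z' = 0" if "i \<in> I" for i
    using orth[OF that] herm_form_swap[OF herm, of "b i" z]
    by (simp_all add: z'_def herm_form_scale)
  show ?case
    by (rule exI[of _ "b(j0 := z')"]) (use b 1 2 insert.hyps in auto)
qed simp

text \<open>With an H-orthonormal frame as the rows of B, the product on the left is the Gram matrix
  of the frame. Moving B to the other side of this one-sided inverse yields the formula for the
  inverse of H.\<close>

lemma posdef_diagonalize:
  fixes H :: "complex^'n^'n"
  assumes "posdef_matrix H"
  obtains B :: "complex^'n^'n" where "B ** H ** adjoint_matrix B = mat 1" "matrix_inv H = adjoint_matrix B ** B"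
proof -
  obtain b :: "'n \<Rightarrow> complex^'n"
    where b: "\<And>i j. herm_form H (b i) (b j) = (if i = j then 1 else 0)"
    using posdef_orthonormal[OF assms, of UNIV] by auto
  define B where "B = (\<chi> i. b i)"
  have "(B ** H ** adjoint_matrix B) $ i $ j = herm_form H (b i) (b j)" for i j
    unfolding herm_form_def B_def adjoint_matrix_def matrix_matrix_mult_def
    by (simp add: sum_distrib_right) (rule sum.swap)
  then have 1: "B ** H ** adjoint_matrix B = mat 1"
    by (simp add: vec_eq_iff b mat_def)
  then have "H ** adjoint_matrix B ** B = mat 1"
    using matrix_left_right_inverse[of B "H ** adjoint_matrix B"] by (simp add: matrix_mul_assoc)
  then have "matrix_inv H = adjoint_matrix B ** B"
    by (intro matrix_inv_unique posdef_det_nz assms) (simp add: matrix_mul_assoc)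
  with 1 that show ?thesis by blast
qed

text \<open>Cyclicity turns the traces of D and D D into those of M and M M, where M is the matrix
  of S in an H-orthonormal frame. M is Hermitian, so its trace t is real and tr (M M) is the sum T
  of all |M_ij|^2; its diagonal alone gives t^2 <= r T with r = \<open>CARD('n)\<close>.\<close>

lemma trace_form_posdef:
  fixes H S :: "complex^'n^'n"
  assumes H: "posdef_matrix H" and S: "hermitian_matrix S" and a: "a > - 1 / real CARD('n)"
  defines "D \<equiv> matrix_inv H ** S"
  obtains s where "trace (D ** D) + of_real a * trace D * trace D = of_real s" "s \<ge> 0" "s = 0 \<longleftrightarrow> S = 0"
proof -
  obtain B :: "complex^'n^'n" where B: "B ** H ** adjoint_matrix B = mat 1" "matrix_inv H = adjoint_matrix B ** B"
    by (rule posdef_diagonalize[OF H])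
  define M where "M = B ** S ** adjoint_matrix B"
  have tD: "trace D = trace M"
    unfolding D_def B(2) M_def matrix_mul_assoc[symmetric]
    by (subst trace_mul_sym) (simp add: matrix_mul_assoc)
  have "D ** D = adjoint_matrix B ** (B ** S ** adjoint_matrix B ** B ** S)"
    unfolding D_def B(2) by (simp add: matrix_mul_assoc)
  then have "trace (D ** D) = trace (B ** S ** adjoint_matrix B ** B ** S ** adjoint_matrix B)"
    using trace_mul_sym[of "adjoint_matrix B"] by simp
  then have tDD: "trace (D ** D) = trace (M ** M)"
    by (simp add: M_def matrix_mul_assoc)
  have "adjoint_matrix M = M"
    using S by (simp add: M_def hermitian_matrix_def adjoint_matrix_mult matrix_mul_assoc)
  then have "adjoint_matrix M $ j $ i = M $ j $ i" for i j by simp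
  then have Mh: "M $ j $ i = cnj (M $ i $ j)" for i j
    by (simp add: adjoint_matrix_def)
  define T where "T = (\<Sum>i\<in>UNIV. \<Sum>j\<in>UNIV. (cmod (M $ i $ j))\<^sup>2)"
  define t where "t = (\<Sum>i\<in>UNIV. Re (M $ i $ i))"
  have "trace (M ** M) = (\<Sum>i\<in>UNIV. \<Sum>j\<in>UNIV. M $ i $ j * M $ j $ i)"
    by (simp add: trace_def matrix_matrix_mult_def)
  also have "\<dots> = (\<Sum>i\<in>UNIV. \<Sum>j\<in>UNIV. M $ i $ j * cnj (M $ i $ j))"
  proof -
    have "M $ i $ j * M $ j $ i = M $ i $ j * cnj (M $ i $ j)" for i j
      using Mh[of j i] by (simp only:)
    then show ?thesis by (simp only:)
  qed
  finally have tMM: "trace (M ** M) = of_real T"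
    by (simp add: T_def complex_norm_square[symmetric])
  have diag: "M $ i $ i = of_real (Re (M $ i $ i))" for i
    using Mh[of i i] by (auto simp: complex_eq_iff)
  have tM: "trace M = of_real t"
    unfolding trace_def t_def of_real_sum by (rule sum.cong) (auto intro: diag)
  have "t\<^sup>2 \<le> (\<Sum>i\<in>UNIV. (Re (M $ i $ i))\<^sup>2) * real CARD('n)"
    unfolding t_def by (rule sum_squared_le_sum_of_squares)
  also have "(\<Sum>i\<in>UNIV. (Re (M $ i $ i))\<^sup>2) \<le> T"
    unfolding T_def
  proof (rule sum_mono)
    fix i
    have "(Re (M $ i $ i))\<^sup>2 \<le> (cmod (M $ i $ i))\<^sup>2"
      by (simp add: cmod_power2)
    also have "\<dots> \<le> (\<Sum>j\<in>UNIV. (cmod (M $ i $ j))\<^sup>2)"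
      by (rule member_le_sum) auto
    finally show "(Re (M $ i $ i))\<^sup>2 \<le> (\<Sum>j\<in>UNIV. (cmod (M $ i $ j))\<^sup>2)" .
  qed
  finally have tT: "t\<^sup>2 \<le> T * real CARD('n)" by simp
  have "T \<ge> 0" unfolding T_def by (intro sum_nonneg) auto
  \<comment> \<open>For a < 0 the worst case t^2 = r T leaves the factor 1 + a r, positive by the
    bound on a; for a >= 0 the trace term only helps, which accounts for the 1.\<close>
  define c where "c = min 1 (1 + a * real CARD('n))"
  have "c > 0" using a by (simp add: c_def field_simps)
  have le: "c * T \<le> T + a * t\<^sup>2"
  proof (cases "a \<ge> 0")
    case True
    then have "c = 1" by (simp add: c_def)
    then show ?thesis using True by simp
  next
    case False
    then have "a * t\<^sup>2 \<ge> a * (T * real CARD('n))"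
      using tT by (intro mult_left_mono_neg) auto
    moreover have "c * T \<le> (1 + a * real CARD('n)) * T"
      using \<open>T \<ge> 0\<close> by (intro mult_right_mono) (auto simp: c_def)
    ultimately show ?thesis by (simp add: algebra_simps)
  qed
  have eq: "trace (D ** D) + of_real a * trace D * trace D = of_real (T + a * t\<^sup>2)"
    by (simp add: tD tDD tMM tM power2_eq_square)
  have nn: "T + a * t\<^sup>2 \<ge> 0"
    using le mult_nonneg_nonneg[of c T] \<open>c > 0\<close> \<open>T \<ge> 0\<close> by linarith
  have "S = 0" if "T + a * t\<^sup>2 = 0"
  proof -
    have "c * T \<le> 0" using le that by simp
    then have "T = 0" using \<open>c > 0\<close> \<open>T \<ge> 0\<close> by (simp add: mult_le_0_iff)
    then have "\<forall>i j. (cmod (M $ i $ j))\<^sup>2 = 0"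
      unfolding T_def by (simp add: sum_nonneg sum_nonneg_eq_0_iff)
    then have "M = 0" by (simp add: vec_eq_iff)
    \<comment> \<open>The factors around S in M are invertible, so S is recovered from M and
      vanishes with it.\<close>
    have 1: "(H ** adjoint_matrix B) ** B = mat 1"
      using B(1) matrix_left_right_inverse[of B "H ** adjoint_matrix B"] by (simp add: matrix_mul_assoc)
    have 2: "adjoint_matrix B ** (B ** H) = mat 1"
      using B(1) matrix_left_right_inverse[of "B ** H" "adjoint_matrix B"] by simp
    have "S = (H ** adjoint_matrix B) ** M ** (B ** H)"
    proof -
      have "(H ** adjoint_matrix B) ** M ** (B ** H) =
          ((H ** adjoint_matrix B) ** B) ** S ** (adjoint_matrix B ** (B ** H))"
        by (simp add: M_def matrix_mul_assoc)
      then show ?thesis by (simp only: 1 2 matrix_mul_lid matrix_mul_rid)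
    qed
    then show "S = 0" using \<open>M = 0\<close> by simp
  qed
  moreover have "T + a * t\<^sup>2 = 0" if "S = 0"
    using that by (simp add: T_def t_def M_def)
  ultimately show ?thesis using that[of "T + a * t\<^sup>2"] eq nn by blast
qed

section \<open>Convergence of matrix-valued functions\<close>

definition mat_lim where
  "mat_lim k n W F f g \<longleftrightarrow> (\<forall>i j. ck_lim k n W F (\<lambda>q y. f q y $ i $ j) (\<lambda>y. g y $ i $ j))"

lemma mat_lim_mult:
  fixes f f' :: "'q \<Rightarrow> (nat \<Rightarrow> real) \<Rightarrow> complex^'n^'n"
  assumes "openin (top_of_set (coords n)) W" "mat_lim k n W F f g" "mat_lim k n W F f' g'"
  shows "mat_lim k n W F (\<lambda>q y. f q y ** f' q y) (\<lambda>y. g y ** g' y)"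
  using assms unfolding mat_lim_def matrix_matrix_mult_def
  by (auto intro!: ck_lim_sum ck_lim_mult)

lemma ck_lim_trace:
  fixes f :: "'q \<Rightarrow> (nat \<Rightarrow> real) \<Rightarrow> complex^'n^'n"
  assumes "openin (top_of_set (coords n)) W" "mat_lim k n W F f g"
  shows "ck_lim k n W F (\<lambda>q y. trace (f q y)) (\<lambda>y. trace (g y))"
  using assms unfolding mat_lim_def trace_def by (auto intro!: ck_lim_sum)

lemma ck_lim_det:
  fixes f :: "'q \<Rightarrow> (nat \<Rightarrow> real) \<Rightarrow> complex^'n^'n"
  assumes W: "openin (top_of_set (coords n)) W" and f: "mat_lim k n W F f g"
  shows "ck_lim k n W F (\<lambda>q y. det (f q y)) (\<lambda>y. det (g y))"
  unfolding det_def
  using f by (intro ck_lim_sum[OF W] ck_lim_mult[OF W] ck_lim_const ck_lim_prod[OF W])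
    (simp add: mat_lim_def)

lemma mat_lim_inv:
  fixes f :: "'q \<Rightarrow> (nat \<Rightarrow> real) \<Rightarrow> complex^'n^'n"
  assumes W: "openin (top_of_set (coords n)) W" and f: "mat_lim k n W F f g"
    and nz: "\<forall>\<^sub>F q in F. \<forall>y\<in>W. det (f q y) \<noteq> 0" "\<And>y. y \<in> W \<Longrightarrow> det (g y) \<noteq> 0"
  shows "mat_lim k n W F (\<lambda>q y. matrix_inv (f q y)) (\<lambda>y. matrix_inv (g y))"
  unfolding mat_lim_def
proof (intro allI)
  fix i j :: 'n
  \<comment> \<open>The Cramer expression converges by the closure rules; it is identified with the
    entry of the inverse only where the determinant is nonzero.\<close>
  define c :: "complex^'n^'n \<Rightarrow> complex" where
    "c A = det (\<chi> a l. if l = i then (if a = j then 1 else 0) else A $ a $ l) * inverse (det A)" for A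
  have c: "matrix_inv A $ i $ j = c A" if "det A \<noteq> 0" for A
    unfolding c_def using that by (rule matrix_inv_cramer)
  have "mat_lim k n W F (\<lambda>q y. \<chi> a l. if l = i then (if a = j then 1 else 0) else f q y $ a $ l)
      (\<lambda>y. \<chi> a l. if l = i then (if a = j then 1 else 0) else g y $ a $ l)"
    unfolding mat_lim_def
  proof (intro allI)
    fix a l
    show "ck_lim k n W F
        (\<lambda>q y. (\<chi> a l. if l = i then (if a = j then 1 else 0) else f q y $ a $ l) $ a $ l)
        (\<lambda>y. (\<chi> a l. if l = i then (if a = j then 1 else 0) else g y $ a $ l) $ a $ l)"
      using f by (cases "l = i"; cases "a = j") (simp_all add: mat_lim_def ck_lim_const)
  qed
  then have "ck_lim k n W F (\<lambda>q y. c (f q y)) (\<lambda>y. c (g y))"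
    unfolding c_def by (intro ck_lim_mult[OF W] ck_lim_det[OF W] ck_lim_inverse[OF W] nz f)
  then show "ck_lim k n W F (\<lambda>q y. matrix_inv (f q y) $ i $ j) (\<lambda>y. matrix_inv (g y) $ i $ j)"
  proof (rule ck_lim_cong[OF W])
    show "\<forall>\<^sub>F q in F. \<forall>y\<in>W. c (f q y) = matrix_inv (f q y) $ i $ j"
      using nz(1) by eventually_elim (simp add: c)
    show "c (g y) = matrix_inv (g y) $ i $ j" if "y \<in> W" for y
      using nz(2)[OF that] by (simp add: c)
  qed
qed

section \<open>Forms and endomorphisms of a fibre in a frame\<close>

definition form_matrix ::
    "('m, 'v::ab_group_add, 'r::finite) vector_bundle \<Rightarrow> 'm \<Rightarrow> ('v \<Rightarrow> complex ^ 'r) \<Rightarrow>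
      ('v \<Rightarrow> 'v \<Rightarrow> complex) \<Rightarrow> complex ^ 'r ^ 'r" where
  "form_matrix E x f s =
     (\<chi> i j. s (inv_into (fibre E x) f (axis i 1)) (inv_into (fibre E x) f (axis j 1)))"

definition matrix_form ::
    "('m, 'v::ab_group_add, 'r::finite) vector_bundle \<Rightarrow> 'm \<Rightarrow> ('v \<Rightarrow> complex ^ 'r) \<Rightarrow>
      complex ^ 'r ^ 'r \<Rightarrow> 'v \<Rightarrow> 'v \<Rightarrow> complex" where
  "matrix_form E x f M a b =
     (if a \<in> fibre E x \<and> b \<in> fibre E x then herm_form M (f a) (f b) else 0)"

definition cnj_vec :: "complex^'n \<Rightarrow> complex^'n" where
  "cnj_vec y = (\<chi> i. cnj (y $ i))"

definition cnj_matrix :: "complex^'n^'m \<Rightarrow> complex^'n^'m" where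
  "cnj_matrix A = (\<chi> i j. cnj (A $ i $ j))"

lemma cnj_cnj_vec [simp]: "cnj_vec (cnj_vec y) = y"
  by (simp add: cnj_vec_def vec_eq_iff)

lemma cnj_vec_matrix: "cnj_vec (A *v cnj_vec y) = cnj_matrix A *v y"
  by (simp add: cnj_vec_def cnj_matrix_def vec_eq_iff matrix_vector_mult_def)

lemma cnj_matrix_mult: "cnj_matrix (A ** B) = cnj_matrix A ** cnj_matrix B"
  by (simp add: cnj_matrix_def vec_eq_iff matrix_matrix_mult_def)

lemma trace_cnj_matrix: "trace (cnj_matrix A) = cnj (trace A)"
  by (simp add: cnj_matrix_def trace_def)

lemma herm_form_eq: "herm_form M y z = (\<Sum>i\<in>UNIV. y $ i * (M *v cnj_vec z) $ i)"
  by (simp add: herm_form_def cnj_vec_def matrix_vector_mult_def sum_distrib_left mult_ac)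

lemma herm_form_add:
  "herm_form M (y + y') z = herm_form M y z + herm_form M y' z"
  "herm_form M y (z + z') = herm_form M y z + herm_form M y z'"
  by (simp_all add: herm_form_def sum.distrib algebra_simps)

lemma herm_form_axis: "herm_form M (axis i 1) (axis j 1) = M $ i $ j"
proof -
  have "(\<Sum>b\<in>UNIV. axis i 1 $ a * M $ a $ b * cnj (axis j 1 $ b)) = (if a = i then M $ a $ j else 0)" for a
  proof -
    have "(\<Sum>b\<in>UNIV. axis i 1 $ a * M $ a $ b * cnj (axis j 1 $ b)) =
        (\<Sum>b\<in>UNIV. if b = j then axis i 1 $ a * M $ a $ b else 0)"
      by (rule sum.cong) (auto simp: axis_def)
    then show ?thesis by (simp add: axis_def)
  qed
  then show ?thesis by (simp add: herm_form_def)
qed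

lemma sum_axis: "(\<Sum>k\<in>UNIV. axis i 1 $ k * c k) = (c i :: complex)"
proof -
  have "(\<Sum>k\<in>UNIV. axis i 1 $ k * c k) = (\<Sum>k\<in>UNIV. if k = i then c k else 0)"
    by (rule sum.cong) (auto simp: axis_def)
  then show ?thesis by simp
qed

text \<open>The frame f is any linear isomorphism of the fibre, not just one from a trivialization,
  because \<open>fibre_trace\<close> picks its own frame by choice.\<close>

locale framed_fibre =
  fixes E :: "('m, 'v::ab_group_add, 'r::finite) vector_bundle" and x :: 'm and f :: "'v \<Rightarrow> complex ^ 'r"
  assumes vs: "vector_space (cscale E)" and sub: "module.subspace (cscale E) (fibre E x)"
    and iso: "fibre_iso E x f"
begin

abbreviation "Fx \<equiv> fibre E x"
abbreviation "fr \<equiv> inv_into (fibre E x) f"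
abbreviation "fm \<equiv> form_matrix E x f"

lemma fr_in [simp]: "fr y \<in> Fx"
  and f_fr [simp]: "f (fr y) = y"
  and fr_f [simp]: "a \<in> Fx \<Longrightarrow> fr (f a) = a"
  using iso unfolding fibre_iso_def bij_betw_def
  by (auto intro: inv_into_into f_inv_into_f inv_into_f_f)

lemma f_add: "a \<in> Fx \<Longrightarrow> b \<in> Fx \<Longrightarrow> f (a + b) = f a + f b"
  and f_scale: "a \<in> Fx \<Longrightarrow> f (cscale E c a) = c *s f a"
  using iso unfolding fibre_iso_def by auto

lemma fibre_add: "a \<in> Fx \<Longrightarrow> b \<in> Fx \<Longrightarrow> a + b \<in> Fx"
  and fibre_scale: "a \<in> Fx \<Longrightarrow> cscale E c a \<in> Fx"
proof -
  interpret vector_space "cscale E" by (rule vs)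
  show "a \<in> Fx \<Longrightarrow> b \<in> Fx \<Longrightarrow> a + b \<in> Fx" "a \<in> Fx \<Longrightarrow> cscale E c a \<in> Fx"
    using sub subspace_add subspace_scale by blast+
qed

lemma fr_add: "fr (y + z) = fr y + fr z"
  using fr_f[OF fibre_add[OF fr_in[of y] fr_in[of z]]] by (simp add: f_add)

lemma fr_scale: "fr (c *s y) = cscale E c (fr y)"
  using fr_f[OF fibre_scale[OF fr_in[of y], of c]] by (simp add: f_scale)

lemma fr_0: "fr 0 = 0"
proof -
  interpret vector_space "cscale E" by (rule vs)
  show ?thesis using fr_scale[of 0 0] by simp
qed

lemma f_eq_0_iff: "a \<in> Fx \<Longrightarrow> f a = 0 \<longleftrightarrow> a = 0"
  using fr_f[of a] fr_0 f_fr[of 0] by metis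

lemma form_expand:
  assumes s: "sesquilinear_on_fibre E x s"
  shows "s (fr y) (fr z) = herm_form (fm s) y z"
proof -
  have 1: "s (fr (\<Sum>i\<in>I. c i *s axis i 1)) (fr b) = (\<Sum>i\<in>I. c i * s (fr (axis i 1)) (fr b))"
    if "finite I" for I :: "'r set" and c b
    using that
  proof (induction I rule: finite_induct)
    case empty
    \<comment> \<open>Zero is written as 0 times 0 so that homogeneity produces the value 0.\<close>
    have "s (fr (0 *s 0)) (fr b) = 0 * s (fr 0) (fr b)"
      using s unfolding fr_scale sesquilinear_on_fibre_def by (metis fr_in)
    then show ?case by simp
  next
    case (insert i I)
    then show ?case
      using s unfolding sesquilinear_on_fibre_def by (simp add: fr_add fr_scale fibre_scale)
  qed
  have 2: "s (fr b) (fr (\<Sum>i\<in>I. c i *s axis i 1)) = (\<Sum>i\<in>I. cnj (c i) * s (fr b) (fr (axis i 1)))"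
    if "finite I" for I :: "'r set" and c b
    using that
  proof (induction I rule: finite_induct)
    case empty
    have "s (fr b) (fr (0 *s 0)) = cnj 0 * s (fr b) (fr 0)"
      using s unfolding fr_scale sesquilinear_on_fibre_def by (metis fr_in)
    then show ?case by simp
  next
    case (insert i I)
    then show ?case
      using s unfolding sesquilinear_on_fibre_def by (simp add: fr_add fr_scale fibre_scale)
  qed
  have "s (fr y) (fr z) = s (fr (\<Sum>i\<in>UNIV. y $ i *s axis i 1)) (fr (\<Sum>j\<in>UNIV. z $ j *s axis j 1))"
    by (simp only: basis_expansion)
  also have "\<dots> = (\<Sum>i\<in>UNIV. \<Sum>j\<in>UNIV. y $ i * (cnj (z $ j) * s (fr (axis i 1)) (fr (axis j 1))))"
    by (subst 1, simp, subst 2, simp, simp add: sum_distrib_left)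
  finally show ?thesis
    by (simp add: herm_form_def form_matrix_def mult_ac)
qed

lemma form_expand':
  assumes "sesquilinear_on_fibre E x s" "a \<in> Fx" "b \<in> Fx"
  shows "s a b = herm_form (fm s) (f a) (f b)"
  using form_expand[OF assms(1), of "f a" "f b"] assms by simp

lemma form_outside:
  assumes "sesquilinear_on_fibre E x s" "a \<notin> Fx \<or> b \<notin> Fx"
  shows "s a b = 0"
  using assms unfolding sesquilinear_on_fibre_def by blast

text \<open>The matrix fixes the form on the fibre only; equality as functions on the whole
  container type rests on the value 0 outside.\<close>

lemma matrix_form_form_matrix:
  assumes "sesquilinear_on_fibre E x s"
  shows "matrix_form E x f (fm s) = s"
  using form_expand'[OF assms] form_outside[OF assms]
  by (intro ext) (auto simp: matrix_form_def)

lemma form_eqI: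
  assumes "sesquilinear_on_fibre E x s" "sesquilinear_on_fibre E x t" "fm s = fm t"
  shows "s = t"
  using assms by (metis matrix_form_form_matrix)

lemma form_matrix_matrix_form: "fm (matrix_form E x f M) = M"
  by (simp add: form_matrix_def matrix_form_def vec_eq_iff herm_form_axis)

lemma sesquilinear_matrix_form: "sesquilinear_on_fibre E x (matrix_form E x f M)"
  unfolding sesquilinear_on_fibre_def matrix_form_def
  by (auto simp: fibre_add fibre_scale f_add f_scale herm_form_add herm_form_scale)

lemma form_matrix_hermitian:
  assumes "sesquilinear_on_fibre E x s"
  shows "hermitian_matrix (fm s) \<longleftrightarrow> (\<forall>a\<in>Fx. \<forall>b\<in>Fx. s b a = cnj (s a b))"
proof
  assume "hermitian_matrix (fm s)"
  then show "\<forall>a\<in>Fx. \<forall>b\<in>Fx. s b a = cnj (s a b)"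
    using form_expand'[OF assms] herm_form_swap by metis
next
  assume *: "\<forall>a\<in>Fx. \<forall>b\<in>Fx. s b a = cnj (s a b)"
  have "cnj (s (fr (axis j 1)) (fr (axis i 1))) = s (fr (axis i 1)) (fr (axis j 1))" for i j
    using * by (metis fr_in)
  then show "hermitian_matrix (fm s)"
    by (simp add: hermitian_matrix_def adjoint_matrix_def form_matrix_def vec_eq_iff)
qed

lemma form_matrix_posdef:
  assumes "sesquilinear_on_fibre E x s"
  shows "posdef_matrix (fm s) \<longleftrightarrow>
    (\<forall>a\<in>Fx. \<forall>b\<in>Fx. s b a = cnj (s a b)) \<and> (\<forall>a\<in>Fx. a \<noteq> 0 \<longrightarrow> Re (s a a) > 0)"
proof -
  have "(\<forall>y. y \<noteq> 0 \<longrightarrow> Re (herm_form (fm s) y y) > 0) \<longleftrightarrow> (\<forall>a\<in>Fx. a \<noteq> 0 \<longrightarrow> Re (s a a) > 0)"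
  proof (intro iffI allI ballI impI)
    fix a assume *: "\<forall>y. y \<noteq> 0 \<longrightarrow> Re (herm_form (fm s) y y) > 0" "a \<in> Fx" "a \<noteq> 0"
    then show "Re (s a a) > 0"
      using form_expand'[OF assms, of a a] f_eq_0_iff by auto
  next
    fix y :: "complex^'r"
    assume *: "\<forall>a\<in>Fx. a \<noteq> 0 \<longrightarrow> Re (s a a) > 0" "y \<noteq> 0"
    then show "Re (herm_form (fm s) y y) > 0"
      using form_expand[OF assms, of y y, symmetric] f_eq_0_iff[of "fr y"] by simp
  qed
  then show ?thesis
    by (simp add: posdef_matrix_def form_matrix_hermitian[OF assms])
qed

text \<open>Forms are conjugate-linear in the second argument, so the matrix of \<open>h\<^sup>-\<^sup>1v\<close> is the complex
  conjugate of the product of the matrices.\<close>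

lemma endo_of_frame:
  assumes h: "sesquilinear_on_fibre E x (h x)" and v: "sesquilinear_on_fibre E x (v x)"
    and det: "det (fm (h x)) \<noteq> 0" and b: "b \<in> Fx"
  shows "endo_of E h v x b = fr (cnj_matrix (matrix_inv (fm (h x)) ** fm (v x)) *v f b)"
proof -
  \<comment> \<open>The equation v(a, b) = h(a, b') for all a says, in matrices, that H applied to
    the conjugate of f b' equals V applied to the conjugate of f b. So c is the conjugate coordinate
    vector of the solution b'.\<close>
  define c where "c = matrix_inv (fm (h x)) *v (fm (v x) *v cnj_vec (f b))"
  have c: "cnj_vec c = cnj_matrix (matrix_inv (fm (h x)) ** fm (v x)) *v f b"
    by (simp add: c_def matrix_vector_mul_assoc flip: cnj_vec_matrix)
  have Hc: "fm (h x) *v c = fm (v x) *v cnj_vec (f b)"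
    by (simp add: c_def matrix_vector_mul_assoc matrix_inv_mult[OF det] flip: matrix_mul_assoc)
      (simp add: matrix_mul_assoc matrix_inv_mult[OF det])
  have "(THE b'. b' \<in> Fx \<and> (\<forall>a\<in>Fx. v x a b = h x a b')) = fr (cnj_vec c)"
  proof (rule the_equality, intro conjI ballI)
    fix a assume "a \<in> Fx"
    then show "v x a b = h x a (fr (cnj_vec c))"
      using b Hc by (simp add: form_expand'[OF h] form_expand'[OF v] herm_form_eq)
  next
    fix b' assume *: "b' \<in> Fx \<and> (\<forall>a\<in>Fx. v x a b = h x a b')"
    have "(fm (v x) *v cnj_vec (f b)) $ i = (fm (h x) *v cnj_vec (f b')) $ i" for i
    proof -
      have "v x (fr (axis i 1)) b = h x (fr (axis i 1)) b'" using * by simp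
      then show ?thesis
        using b * by (simp add: form_expand'[OF h] form_expand'[OF v] herm_form_eq sum_axis)
    qed
    then have "fm (v x) *v cnj_vec (f b) = fm (h x) *v cnj_vec (f b')"
      by (simp add: vec_eq_iff)
    then have "c = cnj_vec (f b')"
      by (simp add: c_def matrix_vector_mul_assoc matrix_inv_mult[OF det])
    then show "b' = fr (cnj_vec c)" using * by simp
  qed simp
  then show ?thesis using b c by (simp add: endo_of_def)
qed

text \<open>Both endomorphisms have conjugated matrices, and inserting their composition into the
  conjugate-linear slot of h conjugates once more. What remains is H H^-1 V H^-1 W.\<close>

lemma form_mult_frame:
  assumes h: "sesquilinear_on_fibre E x (h x)" and v: "sesquilinear_on_fibre E x (v x)"
    and w: "sesquilinear_on_fibre E x (w x)" and det: "det (fm (h x)) \<noteq> 0"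
  shows "form_mult E h v w x = matrix_form E x f (fm (v x) ** matrix_inv (fm (h x)) ** fm (w x))"
proof (intro ext)
  fix a b
  show "form_mult E h v w x a b =
      matrix_form E x f (fm (v x) ** matrix_inv (fm (h x)) ** fm (w x)) a b"
  proof (cases "a \<in> Fx \<and> b \<in> Fx")
    case True
    have H: "fm (h x) *v (matrix_inv (fm (h x)) *v y) = y" for y
      by (simp add: matrix_vector_mul_assoc matrix_inv_mult[OF det])
    have "h x a (endo_of E h v x (endo_of E h w x b)) = herm_form (fm (v x) ** matrix_inv (fm (h x)) ** fm (w x)) (f a) (f b)"
      using True
      by (simp add: endo_of_frame[of h v, OF h v det] endo_of_frame[of h w, OF h w det] form_expand'[OF h] herm_form_eq
         flip: cnj_vec_matrix)
        (simp add: H flip: matrix_vector_mul_assoc)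
    then show ?thesis
      using True by (simp add: form_mult_def form_of_def matrix_form_def)
  qed (auto simp: form_mult_def form_of_def matrix_form_def)
qed

text \<open>Passing from f to the frame chosen in \<open>fibre_trace\<close> conjugates N by an
  invertible matrix P with inverse Q, which cyclicity of the trace removes.\<close>

lemma fibre_trace_frame:
  assumes T: "\<And>b. b \<in> Fx \<Longrightarrow> T b = fr (N *v f b)"
  shows "fibre_trace E x T = trace N"
proof -
  define f' where "f' = (SOME f. fibre_iso E x f)"
  have iso': "fibre_iso E x f'"
    unfolding f'_def by (rule someI[of "fibre_iso E x", OF iso])
  interpret f': framed_fibre E x f'
    by (rule framed_fibre.intro[OF vs sub iso'])
  have 1: "Vector_Spaces.linear (*s) (*s) (\<lambda>y. f' (fr y))" "Vector_Spaces.linear (*s) (*s) (\<lambda>y. f (f'.fr y))"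
    by (unfold_locales; simp add: fr_add fr_scale f'.fr_add f'.fr_scale f_add f_scale f'.f_add f'.f_scale)+
  define P where "P = matrix (\<lambda>y. f' (fr y))"
  define Q where "Q = matrix (\<lambda>y. f (f'.fr y))"
  have P: "f' (fr y) = P *v y" and Q: "f (f'.fr y) = Q *v y" for y
    unfolding P_def Q_def using matrix_works[OF 1(1)] matrix_works[OF 1(2)] by auto
  have "(Q ** P) *v y = y" for y
    by (simp flip: P Q matrix_vector_mul_assoc)
  then have "Q ** P = mat 1"
    by (metis matrix_eq matrix_vector_mul_lid)
  have "matrix (f' \<circ> T \<circ> f'.fr) = matrix (\<lambda>y. (P ** N ** Q) *v y)"
    by (rule arg_cong[of _ _ matrix]) (simp add: fun_eq_iff T P Q flip: matrix_vector_mul_assoc)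
  then have "matrix (f' \<circ> T \<circ> f'.fr) = P ** N ** Q"
    by (simp add: matrix_of_matrix_vector_mul)
  moreover have "trace (P ** N ** Q) = trace N"
    using trace_mul_sym[of P "N ** Q"] \<open>Q ** P = mat 1\<close>
    by (simp add: matrix_mul_assoc[symmetric])
  ultimately show ?thesis
    unfolding fibre_trace_def f'_def by (simp add: Let_def)
qed

lemma fibre_trace_endo_of:
  assumes h: "sesquilinear_on_fibre E x (h x)" and v: "sesquilinear_on_fibre E x (v x)"
    and det: "det (fm (h x)) \<noteq> 0"
  shows "fibre_trace E x (endo_of E h v x) = cnj (trace (matrix_inv (fm (h x)) ** fm (v x)))"
  using fibre_trace_frame[OF endo_of_frame[of h v, OF h v det]] by (simp add: trace_cnj_matrix)

lemma fibre_trace_endo_of_comp: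
  assumes h: "sesquilinear_on_fibre E x (h x)" and v: "sesquilinear_on_fibre E x (v x)"
    and w: "sesquilinear_on_fibre E x (w x)" and det: "det (fm (h x)) \<noteq> 0"
  shows "fibre_trace E x (endo_of E h v x \<circ> endo_of E h w x) =
    cnj (trace (matrix_inv (fm (h x)) ** fm (v x) ** (matrix_inv (fm (h x)) ** fm (w x))))"
proof -
  have "fibre_trace E x (endo_of E h v x \<circ> endo_of E h w x) =
      trace (cnj_matrix (matrix_inv (fm (h x)) ** fm (v x)) ** cnj_matrix (matrix_inv (fm (h x)) ** fm (w x)))"
    by (rule fibre_trace_frame)
      (simp add: endo_of_frame[of h v, OF h v det] endo_of_frame[of h w, OF h w det] matrix_vector_mul_assoc)
  then show ?thesis
    by (simp only: cnj_matrix_mult[symmetric] trace_cnj_matrix)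
qed

end

section \<open>Convergence of sections\<close>

locale manifold_bundle =
  fixes n :: nat
    and A :: "'m::{t2_space, second_countable_topology} chart set"
    and E :: "('m, 'v::ab_group_add, 'r::finite) vector_bundle"
  assumes manifold: "closed_oriented_manifold n A"
    and vbundle: "smooth_complex_vector_bundle n A E"
begin

abbreviation "cdom c V \<equiv> snd c ` (fst c \<inter> V)"
abbreviation "sections \<equiv> sesqui_sections n A E"
abbreviation "herms \<equiv> herm_sections n A E"
abbreviation "pos_herms \<equiv> pos_herm_sections n A E"

definition local_matrix :: "'m chart \<Rightarrow> ('m \<Rightarrow> 'v \<Rightarrow> complex ^ 'r) \<Rightarrow> ('m, 'v) form_field \<Rightarrow>
    (nat \<Rightarrow> real) \<Rightarrow> complex ^ 'r ^ 'r" where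
  "local_matrix c \<tau> s y = form_matrix E (chart_inv c y) (\<tau> (chart_inv c y)) (s (chart_inv c y))"

lemma local_entry_eq: "local_entry E c \<tau> i j s = (\<lambda>y. local_matrix c \<tau> s y $ i $ j)"
  by (simp add: local_entry_def local_matrix_def form_matrix_def Let_def fun_eq_iff)

lemma chart: "c \<in> A \<Longrightarrow> is_chart n c"
  using manifold by (auto simp: closed_oriented_manifold_def oriented_atlas_def)

lemma chart_inv_in: "y \<in> cdom c V \<Longrightarrow> c \<in> A \<Longrightarrow> chart_inv c y \<in> fst c \<inter> V"
  using chart[of c] unfolding is_chart_def homeomorphism_def by force

lemma triv_open: "(V, \<tau>) \<in> trivs E \<Longrightarrow> open V"
  using vbundle by (auto simp: smooth_complex_vector_bundle_def)

lemma framed: "(V, \<tau>) \<in> trivs E \<Longrightarrow> x \<in> V \<Longrightarrow> framed_fibre E x (\<tau> x)"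
  using vbundle by (auto simp: smooth_complex_vector_bundle_def intro!: framed_fibre.intro)

lemma cover:
  obtains c V \<tau> where "c \<in> A" "(V, \<tau>) \<in> trivs E" "x \<in> fst c" "x \<in> V"
proof -
  have "x \<in> (\<Union>c\<in>A. fst c)" "x \<in> (\<Union>(V, \<tau>)\<in>trivs E. V)"
    using manifold vbundle
    by (simp_all add: closed_oriented_manifold_def oriented_atlas_def smooth_complex_vector_bundle_def)
  then show ?thesis using that by blast
qed

lemma dom_open:
  assumes "c \<in> A" "open V"
  shows "openin (top_of_set (coords n)) (cdom c V)"
proof -
  have hom: "homeomorphism (fst c) (snd c ` fst c) (snd c) (chart_inv c)"
    and "openin (top_of_set (coords n)) (snd c ` fst c)"
    using chart[OF assms(1)] by (auto simp: is_chart_def)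
  moreover have "openin (top_of_set (snd c ` fst c)) (cdom c V)"
    by (rule homeomorphism_imp_open_map[OF hom]) (use assms(2) in auto)
  ultimately show ?thesis using openin_trans by blast
qed

text \<open>Convergence in the smooth topology, freed from the restriction to Hermitian fields: the
  products v h^-1 w met on the way are not Hermitian in general.\<close>

definition sec_lim :: "'q filter \<Rightarrow> ('q \<Rightarrow> ('m, 'v) form_field) \<Rightarrow> ('m, 'v) form_field \<Rightarrow> bool" where
  "sec_lim F s l \<longleftrightarrow> (\<forall>c\<in>A. \<forall>(V, \<tau>)\<in>trivs E. \<forall>k.
     mat_lim k n (cdom c V) F (\<lambda>q. local_matrix c \<tau> (s q)) (local_matrix c \<tau> l))"

text \<open>Pointwise identities are proved on this larger set, so that the algebra does not have to
  carry smoothness along.\<close>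

definition sesquis :: "('m, 'v) form_field set" where
  "sesquis = {s. \<forall>x. sesquilinear_on_fibre E x (s x)}"

lemma sesquisD: "s \<in> sesquis \<Longrightarrow> sesquilinear_on_fibre E x (s x)"
  by (simp add: sesquis_def)

text \<open>For a constant family convergence says only that the limit is smooth, whatever F is.
  Closure rules for \<open>sec_lim\<close> thereby become closure rules for
  \<open>sections\<close>.\<close>

lemma sections_iff: "s \<in> sections \<longleftrightarrow> s \<in> sesquis \<and> sec_lim F (\<lambda>_. s) s"
proof -
  have "smooth_fun_on n W f \<longleftrightarrow> (\<forall>k. ck_lim k n W F (\<lambda>_. f) f)" for W and f :: "(nat \<Rightarrow> real) \<Rightarrow> complex"
    using smooth_imp_ck_lim ck_lim_imp_smooth by blast
  then show ?thesis
    unfolding sesqui_sections_def sec_lim_def mat_lim_def local_entry_eq sesquis_def by blast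
qed

lemma sec_lim_const: "s \<in> sections \<Longrightarrow> sec_lim F (\<lambda>_. s) s"
  using sections_iff by blast

lemma sections_sesquis: "s \<in> sections \<Longrightarrow> s \<in> sesquis"
  using sections_iff by blast

lemma sec_limI:
  assumes "\<And>c V \<tau> k. c \<in> A \<Longrightarrow> (V, \<tau>) \<in> trivs E \<Longrightarrow> openin (top_of_set (coords n)) (cdom c V) \<Longrightarrow>
     mat_lim k n (cdom c V) F (\<lambda>q. local_matrix c \<tau> (s q)) (local_matrix c \<tau> l)"
  shows "sec_lim F s l"
  unfolding sec_lim_def using assms dom_open triv_open by blast

lemma sec_limD:
  "sec_lim F s l \<Longrightarrow> c \<in> A \<Longrightarrow> (V, \<tau>) \<in> trivs E \<Longrightarrow>
     mat_lim k n (cdom c V) F (\<lambda>q. local_matrix c \<tau> (s q)) (local_matrix c \<tau> l)"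
  unfolding sec_lim_def by blast

lemma sec_lim_cong_ev:
  assumes "sec_lim F s l" "\<forall>\<^sub>F q in F. s q = s' q"
  shows "sec_lim F s' l"
proof (rule sec_limI)
  fix c V \<tau> k
  assume *: "c \<in> A" "(V, \<tau>) \<in> trivs E" "openin (top_of_set (coords n)) (cdom c V)"
  show "mat_lim k n (cdom c V) F (\<lambda>q. local_matrix c \<tau> (s' q)) (local_matrix c \<tau> l)"
    unfolding mat_lim_def
  proof (intro allI)
    fix i j
    show "ck_lim k n (cdom c V) F (\<lambda>q y. local_matrix c \<tau> (s' q) y $ i $ j) (\<lambda>y. local_matrix c \<tau> l y $ i $ j)"
      using sec_limD[OF assms(1) *(1,2), of k, unfolded mat_lim_def, rule_format, of i j]
    proof (rule ck_lim_cong[OF *(3)])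
      show "\<forall>\<^sub>F q in F. \<forall>y\<in>cdom c V. local_matrix c \<tau> (s q) y $ i $ j = local_matrix c \<tau> (s' q) y $ i $ j"
        using assms(2) by (rule eventually_mono) simp
    qed simp
  qed
qed

lemma local_matrix_add:
  "local_matrix c \<tau> (s + t) y = local_matrix c \<tau> s y + local_matrix c \<tau> t y"
  by (simp add: local_matrix_def form_matrix_def vec_eq_iff)

lemma local_matrix_scaleR:
  "local_matrix c \<tau> (a *\<^sub>R s) y = a *\<^sub>R local_matrix c \<tau> s y"
  by (simp add: local_matrix_def form_matrix_def vec_eq_iff scaleR_fun_def)

lemma local_matrix_0: "local_matrix c \<tau> 0 y = 0"
  by (simp add: local_matrix_def form_matrix_def vec_eq_iff)

lemma local_matrix_diff:
  "local_matrix c \<tau> (s - t) y = local_matrix c \<tau> s y - local_matrix c \<tau> t y"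
  by (simp add: local_matrix_def form_matrix_def vec_eq_iff)

lemma sec_lim_add:
  assumes "sec_lim F s l" "sec_lim F s' l'"
  shows "sec_lim F (\<lambda>q. s q + s' q) (l + l')"
proof (rule sec_limI)
  fix c V \<tau> k
  assume *: "c \<in> A" "(V, \<tau>) \<in> trivs E" "openin (top_of_set (coords n)) (cdom c V)"
  show "mat_lim k n (cdom c V) F (\<lambda>q. local_matrix c \<tau> (s q + s' q)) (local_matrix c \<tau> (l + l'))"
    using sec_limD[OF assms(1) *(1,2), of k] sec_limD[OF assms(2) *(1,2), of k]
    by (auto simp: mat_lim_def local_matrix_add intro!: ck_lim_add[OF *(3)])
qed

lemma sec_lim_scaleR:
  assumes "sec_lim F s l" "(a \<longlongrightarrow> b) F"
  shows "sec_lim F (\<lambda>q. a q *\<^sub>R s q) (b *\<^sub>R l)"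
proof (rule sec_limI)
  fix c V \<tau> k
  assume *: "c \<in> A" "(V, \<tau>) \<in> trivs E" "openin (top_of_set (coords n)) (cdom c V)"
  have "((\<lambda>q. complex_of_real (a q)) \<longlongrightarrow> of_real b) F"
    using assms(2) by (rule tendsto_of_real)
  then show "mat_lim k n (cdom c V) F (\<lambda>q. local_matrix c \<tau> (a q *\<^sub>R s q)) (local_matrix c \<tau> (b *\<^sub>R l))"
    using sec_limD[OF assms(1) *(1,2), of k]
    by (auto simp: mat_lim_def local_matrix_scaleR scaleR_conv_of_real[where 'a = complex]
        intro!: ck_lim_mult[OF *(3)] ck_lim_const_tendsto)
qed

lemma sec_lim_uminus:
  assumes "sec_lim F s l"
  shows "sec_lim F (\<lambda>q. - s q) (- l)"
  using sec_lim_scaleR[OF assms, of "\<lambda>_. - 1" "- 1"] by simp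

text \<open>The Hermitian fields are its fixed points, which turns the symmetry condition into an
  equation between fields.\<close>

definition form_star :: "('m, 'v) form_field \<Rightarrow> ('m, 'v) form_field" where
  "form_star s = (\<lambda>x a b. cnj (s x b a))"

lemma local_matrix_star: "local_matrix c \<tau> (form_star s) y = adjoint_matrix (local_matrix c \<tau> s y)"
  by (simp add: local_matrix_def form_matrix_def vec_eq_iff adjoint_matrix_def form_star_def)

lemma sec_lim_star:
  assumes "sec_lim F s l"
  shows "sec_lim F (\<lambda>q. form_star (s q)) (form_star l)"
proof (rule sec_limI)
  fix c V \<tau> k
  assume *: "c \<in> A" "(V, \<tau>) \<in> trivs E" "openin (top_of_set (coords n)) (cdom c V)"
  show "mat_lim k n (cdom c V) F (\<lambda>q. local_matrix c \<tau> (form_star (s q))) (local_matrix c \<tau> (form_star l))"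
    using sec_limD[OF assms *(1,2), of k]
    by (auto simp: mat_lim_def local_matrix_star adjoint_matrix_def
        intro!: ck_lim_bounded_linear[OF *(3) bounded_linear_cnj])
qed

lemma sesquis_closed:
  "s \<in> sesquis \<Longrightarrow> t \<in> sesquis \<Longrightarrow> s + t \<in> sesquis"
  "s \<in> sesquis \<Longrightarrow> r *\<^sub>R s \<in> sesquis"
  "s \<in> sesquis \<Longrightarrow> form_star s \<in> sesquis"
  "0 \<in> sesquis"
  unfolding sesquis_def sesquilinear_on_fibre_def form_star_def
  by (auto simp: algebra_simps scaleR_fun_def)

lemma sections_closed:
  "s \<in> sections \<Longrightarrow> t \<in> sections \<Longrightarrow> s + t \<in> sections"
  "s \<in> sections \<Longrightarrow> r *\<^sub>R s \<in> sections"
  "s \<in> sections \<Longrightarrow> form_star s \<in> sections"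
  unfolding sections_iff[where F=sequentially]
  by (auto intro!: sesquis_closed sec_lim_add sec_lim_scaleR sec_lim_star)

lemma zero_section: "0 \<in> sections"
proof -
  have "sec_lim F (\<lambda>_. 0) 0" for F :: "nat filter"
    by (rule sec_limI) (auto simp: mat_lim_def local_matrix_0 intro!: ck_lim_const)
  then show ?thesis using sesquis_closed(4) sections_iff by blast
qed

lemma herms_iff: "s \<in> herms \<longleftrightarrow> s \<in> sections \<and> form_star s = s"
proof (cases "s \<in> sections")
  case True
  then have out: "s x a b = 0" if "a \<notin> fibre E x \<or> b \<notin> fibre E x" for x a b
    using that sections_sesquis[OF True] unfolding sesquis_def sesquilinear_on_fibre_def by blast
  show ?thesis
  proof
    assume s: "s \<in> herms"
    have "cnj (s x b a) = s x a b" for x a b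
    proof (cases "a \<in> fibre E x \<and> b \<in> fibre E x")
      case True
      then have "s x b a = cnj (s x a b)" using s unfolding herm_sections_def by blast
      then show ?thesis by simp
    next
      case False
      then show ?thesis using out[of a x b] out[of b x a] by auto
    qed
    then show "s \<in> sections \<and> form_star s = s"
      using True by (simp add: form_star_def fun_eq_iff)
  next
    assume "s \<in> sections \<and> form_star s = s"
    then have eq: "form_star s x b a = s x b a" for x a b by simp
    show "s \<in> herms"
      unfolding herm_sections_def using True eq[symmetric, unfolded form_star_def] by blast
  qed
qed (use herm_sections_def in blast)

lemma form_star_add: "form_star (s + t) = form_star s + form_star t"
  and form_star_scaleR: "form_star (r *\<^sub>R s) = r *\<^sub>R form_star s"
  and form_star_star: "form_star (form_star s) = s"
  by (simp_all add: form_star_def fun_eq_iff scaleR_fun_def)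

lemma herms_closed:
  "s \<in> herms \<Longrightarrow> t \<in> herms \<Longrightarrow> s + t \<in> herms"
  "s \<in> herms \<Longrightarrow> r *\<^sub>R s \<in> herms"
  by (auto simp: herms_iff form_star_add form_star_scaleR intro: sections_closed)

lemma herms_cnj: "s \<in> herms \<Longrightarrow> \<forall>a\<in>fibre E x. \<forall>b\<in>fibre E x. s x b a = cnj (s x a b)"
  unfolding herm_sections_def by (drule CollectD) (erule conjE, erule spec)

lemma herms_diff: "s \<in> herms \<Longrightarrow> t \<in> herms \<Longrightarrow> s - t \<in> herms"
  using herms_closed(1)[of s "(- 1) *\<^sub>R t"] herms_closed(2)[of t "- 1"] by simp

lemma herms_sections: "s \<in> herms \<Longrightarrow> s \<in> sections"
  by (simp add: herms_iff)

lemma pos_herms_herms: "h \<in> pos_herms \<Longrightarrow> h \<in> herms"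
  by (simp add: pos_herm_sections_def)

text \<open>The projection onto Hermitian fields. It is real-linear and respects limits, so
  difference quotients may be taken before projecting.\<close>

definition herm_part :: "('m, 'v) form_field \<Rightarrow> ('m, 'v) form_field" where
  "herm_part s = (1 / 2) *\<^sub>R (s + form_star s)"

lemma herm_part_herms: "s \<in> sections \<Longrightarrow> herm_part s \<in> herms"
  unfolding herm_part_def herms_iff
  by (intro conjI sections_closed)
    (simp_all add: form_star_add form_star_scaleR form_star_star add.commute)

lemma sec_lim_herm_part:
  "sec_lim F s l \<Longrightarrow> sec_lim F (\<lambda>q. herm_part (s q)) (herm_part l)"
  unfolding herm_part_def by (intro sec_lim_scaleR sec_lim_add sec_lim_star tendsto_const)

lemma form_matrix_hermitian_section:
  assumes "s \<in> herms" "(V, \<tau>) \<in> trivs E" "x \<in> V"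
  shows "hermitian_matrix (form_matrix E x (\<tau> x) (s x))"
proof -
  interpret framed_fibre E x "\<tau> x" by (rule framed[OF assms(2,3)])
  show ?thesis
    by (rule form_matrix_hermitian[THEN iffD2]) (rule sesquisD sections_sesquis herms_sections assms(1) herms_cnj)+
qed

text \<open>Invertibility is all that the algebra of h^-1 uses. Positivity enters where it is an
  open condition, where adjoints of h^-1 are taken, and in the definiteness of the metric.\<close>

definition nondeg :: "('m, 'v) form_field set" where
  "nondeg = {h \<in> sesquis. \<forall>(V, \<tau>)\<in>trivs E. \<forall>x\<in>V. det (form_matrix E x (\<tau> x) (h x)) \<noteq> 0}"

lemma pos_herms_posdef:
  assumes "h \<in> pos_herms" "(V, \<tau>) \<in> trivs E" "x \<in> V"
  shows "posdef_matrix (form_matrix E x (\<tau> x) (h x))"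
proof -
  interpret framed_fibre E x "\<tau> x" by (rule framed[OF assms(2,3)])
  have "\<forall>a\<in>fibre E x. a \<noteq> 0 \<longrightarrow> Re (h x a a) > 0"
    using assms(1) unfolding pos_herm_sections_def by blast
  from conjI[OF herms_cnj[OF pos_herms_herms[OF assms(1)]] this] show ?thesis
    by (rule form_matrix_posdef[THEN iffD2, rotated])
      (rule sesquisD sections_sesquis herms_sections pos_herms_herms assms(1))+
qed

lemma pos_hermsI:
  assumes "h \<in> herms" "\<And>x. \<exists>(V, \<tau>)\<in>trivs E. x \<in> V \<and> posdef_matrix (form_matrix E x (\<tau> x) (h x))"
  shows "h \<in> pos_herms"
  unfolding pos_herm_sections_def
proof (intro CollectI conjI allI ballI impI assms(1))
  fix x a assume a: "a \<in> fibre E x" "a \<noteq> 0"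
  obtain V \<tau> where V: "(V, \<tau>) \<in> trivs E" "x \<in> V" "posdef_matrix (form_matrix E x (\<tau> x) (h x))"
    using assms(2)[of x] by blast
  interpret framed_fibre E x "\<tau> x" by (rule framed[OF V(1,2)])
  show "Re (h x a a) > 0"
    using form_matrix_posdef[OF sesquisD[OF sections_sesquis[OF herms_sections[OF assms(1)]]], THEN iffD1,
      OF V(3), THEN conjunct2, rule_format, OF a] .
qed

lemma pos_herms_nondeg:
  assumes h: "h \<in> pos_herms"
  shows "h \<in> nondeg"
proof -
  have "h \<in> sesquis" by (intro sections_sesquis herms_sections pos_herms_herms h)
  moreover have "det (form_matrix E x (\<tau> x) (h x)) \<noteq> 0" if "(V, \<tau>) \<in> trivs E" "x \<in> V" for V \<tau> x
    by (rule posdef_det_nz[OF pos_herms_posdef[OF h that]])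
  ultimately show ?thesis unfolding nondeg_def by blast
qed

lemma nondeg_sesquis: "h \<in> nondeg \<Longrightarrow> h \<in> sesquis"
  by (simp add: nondeg_def)

lemma nondeg_det: "h \<in> nondeg \<Longrightarrow> (V, \<tau>) \<in> trivs E \<Longrightarrow> x \<in> V \<Longrightarrow> det (form_matrix E x (\<tau> x) (h x)) \<noteq> 0"
  unfolding nondeg_def by blast

section \<open>The product v h^-1 w of fields\<close>

lemma form_matrix_form_mult:
  assumes "h \<in> nondeg" "v \<in> sesquis" "w \<in> sesquis" "(V, \<tau>) \<in> trivs E" "x \<in> V"
  shows "form_matrix E x (\<tau> x) (form_mult E h v w x) = form_matrix E x (\<tau> x) (v x) **
    matrix_inv (form_matrix E x (\<tau> x) (h x)) ** form_matrix E x (\<tau> x) (w x)"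
proof -
  interpret framed_fibre E x "\<tau> x" by (rule framed[OF assms(4,5)])
  show ?thesis
    by (subst form_mult_frame[of h v w])
      (simp_all add: assms sesquisD nondeg_sesquis nondeg_det[OF assms(1,4,5)] form_matrix_matrix_form)
qed

lemma form_mult_sesquis:
  assumes "h \<in> nondeg" "v \<in> sesquis" "w \<in> sesquis"
  shows "form_mult E h v w \<in> sesquis"
  unfolding sesquis_def
proof (intro CollectI allI)
  fix x
  obtain c V \<tau> where V: "c \<in> A" "(V, \<tau>) \<in> trivs E" "x \<in> fst c" "x \<in> V" by (rule cover)
  interpret framed_fibre E x "\<tau> x" by (rule framed[OF V(2,4)])
  show "sesquilinear_on_fibre E x (form_mult E h v w x)"
    by (subst form_mult_frame[of h v w])
      (simp_all add: assms sesquisD nondeg_sesquis nondeg_det[OF assms(1) V(2,4)] sesquilinear_matrix_form)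
qed

text \<open>Reduces identities between fields to matrix identities, since every point lies in the
  domain of a trivialization.\<close>

lemma sesquis_eqI:
  assumes "s \<in> sesquis" "t \<in> sesquis"
    and "\<And>V \<tau> x. (V, \<tau>) \<in> trivs E \<Longrightarrow> x \<in> V \<Longrightarrow>
      form_matrix E x (\<tau> x) (s x) = form_matrix E x (\<tau> x) (t x)"
  shows "s = t"
proof
  fix x
  obtain c V \<tau> where V: "c \<in> A" "(V, \<tau>) \<in> trivs E" "x \<in> fst c" "x \<in> V" by (rule cover)
  interpret framed_fibre E x "\<tau> x" by (rule framed[OF V(2,4)])
  show "s x = t x"
    using assms V sesquisD by (intro form_eqI) auto
qed

text \<open>Joint convergence in all three arguments is essential: in a difference quotient the base
  point and the factors move together.\<close>

lemma sec_lim_form_mult: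
  assumes "sec_lim F h h0" "sec_lim F v v0" "sec_lim F w w0"
    and ev: "\<forall>\<^sub>F q in F. h q \<in> nondeg" "\<forall>\<^sub>F q in F. v q \<in> sesquis" "\<forall>\<^sub>F q in F. w q \<in> sesquis"
    and "h0 \<in> nondeg" "v0 \<in> sesquis" "w0 \<in> sesquis"
  shows "sec_lim F (\<lambda>q. form_mult E (h q) (v q) (w q)) (form_mult E h0 v0 w0)"
proof (rule sec_limI)
  fix c V \<tau> k
  assume *: "c \<in> A" "(V, \<tau>) \<in> trivs E" "openin (top_of_set (coords n)) (cdom c V)"
  let ?M = "local_matrix c \<tau>"
  have eq: "?M (form_mult E h v w) y = ?M v y ** matrix_inv (?M h y) ** ?M w y"
    if "h \<in> nondeg" "v \<in> sesquis" "w \<in> sesquis" "y \<in> cdom c V" for h v w y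
    unfolding local_matrix_def
    by (rule form_matrix_form_mult[OF that(1-3) *(2)]) (use chart_inv_in[OF that(4) *(1)] in simp)
  have nz: "det (?M h y) \<noteq> 0" if "h \<in> nondeg" "y \<in> cdom c V" for h y
    unfolding local_matrix_def
    by (rule nondeg_det[OF that(1) *(2)]) (use chart_inv_in[OF that(2) *(1)] in simp)
  have L: "mat_lim k n (cdom c V) F (\<lambda>q y. ?M (v q) y ** matrix_inv (?M (h q) y) ** ?M (w q) y)
      (\<lambda>y. ?M v0 y ** matrix_inv (?M h0 y) ** ?M w0 y)"
  proof (intro mat_lim_mult mat_lim_inv *(3))
    show "\<forall>\<^sub>F q in F. \<forall>y\<in>cdom c V. det (?M (h q) y) \<noteq> 0"
      using ev(1) by eventually_elim (simp add: nz)
  qed (rule sec_limD[OF assms(1) *(1,2)] sec_limD[OF assms(2) *(1,2)] sec_limD[OF assms(3) *(1,2)]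
      nz[OF assms(7)] | assumption)+
  show "mat_lim k n (cdom c V) F (\<lambda>q. ?M (form_mult E (h q) (v q) (w q))) (?M (form_mult E h0 v0 w0))"
    unfolding mat_lim_def
  proof (intro allI)
    fix i j
    show "ck_lim k n (cdom c V) F (\<lambda>q y. ?M (form_mult E (h q) (v q) (w q)) y $ i $ j)
        (\<lambda>y. ?M (form_mult E h0 v0 w0) y $ i $ j)"
      using L[unfolded mat_lim_def, rule_format, of i j]
    proof (rule ck_lim_cong[OF *(3)])
      show "\<forall>\<^sub>F q in F. \<forall>y\<in>cdom c V. (?M (v q) y ** matrix_inv (?M (h q) y) ** ?M (w q) y) $ i $ j =
          ?M (form_mult E (h q) (v q) (w q)) y $ i $ j"
        using ev by eventually_elim (simp add: eq)
    qed (use assms(7-9) in \<open>simp add: eq\<close>)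
  qed
qed

text \<open>Smoothness of the product is the preceding convergence for constant families.\<close>

lemma form_mult_sections:
  assumes hp: "h \<in> pos_herms" and v: "v \<in> sections" and w: "w \<in> sections"
  shows "form_mult E h v w \<in> sections"
proof -
  have h: "h \<in> nondeg" using hp by (rule pos_herms_nondeg)
  have v': "v \<in> sesquis" using v by (rule sections_sesquis)
  have w': "w \<in> sesquis" using w by (rule sections_sesquis)
  have hs: "h \<in> sections" using hp by (intro herms_sections pos_herms_herms)
  have "sec_lim sequentially (\<lambda>_. form_mult E h v w) (form_mult E h v w)"
  proof (rule sec_lim_form_mult)
    show "sec_lim sequentially (\<lambda>_. h) h" using hs by (rule sec_lim_const)
    show "sec_lim sequentially (\<lambda>_. v) v" using v by (rule sec_lim_const)
    show "sec_lim sequentially (\<lambda>_. w) w" using w by (rule sec_lim_const)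
  qed (rule always_eventually allI h v' w')+
  with form_mult_sesquis[OF h v' w'] show ?thesis
    unfolding sections_iff[where F = "sequentially"] by (rule conjI)
qed

end

context manifold_bundle
begin

section \<open>The smooth topology\<close>

abbreviation "X \<equiv> smooth_topology n A E"

lemma local_entry_smooth:
  assumes "s \<in> sections" "c \<in> A" "(V, \<tau>) \<in> trivs E"
  shows "smooth_fun_on n (cdom c V) (local_entry E c \<tau> i j s)"
  using assms unfolding sesqui_sections_def by blast

lemma local_entry_diff:
  "local_entry E c \<tau> i j (s - t) = (\<lambda>y. local_entry E c \<tau> i j s y - local_entry E c \<tau> i j t y)"
  by (simp add: local_entry_eq local_matrix_diff fun_eq_iff)

lemma partials_local_entry_diff:
  assumes "s \<in> sections" "t \<in> sections" "c \<in> A" "(V, \<tau>) \<in> trivs E" "is \<in> lists {..<n}" "y \<in> cdom c V"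
  shows "partials is (local_entry E c \<tau> i j (s - t)) y =
    partials is (local_entry E c \<tau> i j s) y - partials is (local_entry E c \<tau> i j t) y"
  unfolding local_entry_diff
  by (rule partials_diff[OF dom_open[OF assms(3) triv_open[OF assms(4)]]
        local_entry_smooth[OF assms(1,3,4)] local_entry_smooth[OF assms(2,3,4)] assms(5,6)])

definition seminorm_ball ::
    "('m, 'v) form_field \<Rightarrow> 'm chart \<Rightarrow> ('m \<Rightarrow> 'v \<Rightarrow> complex ^ 'r) \<Rightarrow> (nat \<Rightarrow> real) set \<Rightarrow> nat list \<Rightarrow>
      'r \<Rightarrow> 'r \<Rightarrow> real \<Rightarrow> ('m, 'v) form_field set" where
  "seminorm_ball v c \<tau> K is i j \<epsilon> =
     {w \<in> herms. \<forall>y\<in>K. cmod (partials is (local_entry E c \<tau> i j (w - v)) y) < \<epsilon>}"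

lemma smooth_topology_eq:
  "X = topology_generated_by {seminorm_ball v c \<tau> K is i j \<epsilon> | v c V \<tau> K is i j \<epsilon>.
       v \<in> herms \<and> c \<in> A \<and> (V, \<tau>) \<in> trivs E \<and> compact K \<and>
       K \<subseteq> cdom c V \<and> is \<in> lists {..<n} \<and> \<epsilon> > 0}"
  unfolding smooth_topology_def seminorm_ball_def ..

lemma openin_seminorm_ball:
  assumes "v \<in> herms" "c \<in> A" "(V, \<tau>) \<in> trivs E" "compact K" "K \<subseteq> cdom c V" "is \<in> lists {..<n}" "\<epsilon> > 0"
  shows "openin X (seminorm_ball v c \<tau> K is i j \<epsilon>)"
  unfolding smooth_topology_eq by (rule topology_generated_by_Basis) (use assms in blast)

lemma zero_herms: "0 \<in> herms"
  using zero_section by (simp add: herms_iff form_star_def fun_eq_iff)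

lemma topspace_X: "topspace X = herms"
proof
  show "topspace X \<subseteq> herms"
    unfolding smooth_topology_eq topology_generated_by_topspace by (auto simp: seminorm_ball_def)
  obtain c V \<tau> where V: "c \<in> A" "(V, \<tau>) \<in> trivs E" using cover[of undefined] by metis
  \<comment> \<open>Over the empty compact set the seminorm condition is void, so this single
    generator is all of \<open>herms\<close>.\<close>
  have "openin X (seminorm_ball 0 c \<tau> {} [] undefined undefined 1)"
    by (rule openin_seminorm_ball[OF zero_herms V]) auto
  moreover have "seminorm_ball 0 c \<tau> {} [] undefined undefined 1 = herms"
    by (simp add: seminorm_ball_def)
  ultimately show "herms \<subseteq> topspace X"
    using openin_subset by metis
qed

text \<open>The ball is centred at v, not at the limit l. Its strict inequality for l - v holds with
  a uniform slack, because the maximum over the compact set K is attained; convergence eventually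
  costs less than this slack.\<close>

lemma eventually_seminorm_ball:
  assumes l: "l \<in> seminorm_ball v c \<tau> K is i j \<epsilon>" and s: "\<forall>\<^sub>F q in F. s q \<in> herms" "sec_lim F s l"
    and v: "v \<in> herms" and c: "c \<in> A" "(V, \<tau>) \<in> trivs E" and K: "compact K" "K \<subseteq> cdom c V"
    and isl: "is \<in> lists {..<n}" and "\<epsilon> > 0"
  shows "\<forall>\<^sub>F q in F. s q \<in> seminorm_ball v c \<tau> K is i j \<epsilon>"
proof (cases "K = {}")
  case True
  then show ?thesis using s(1) by (simp add: seminorm_ball_def)
next
  case False
  have lH: "l \<in> herms" using l by (simp add: seminorm_ball_def)
  let ?P = "\<lambda>s. partials is (local_entry E c \<tau> i j s)"
  have d: "?P (a - b) y = ?P a y - ?P b y" if "a \<in> herms" "b \<in> herms" "y \<in> K" for a b y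
    by (rule partials_local_entry_diff[OF that(1,2)[THEN herms_sections] c isl]) (use K that in blast)
  have "continuous_on (cdom c V) (?P a)" if "a \<in> herms" for a
    using local_entry_smooth[OF herms_sections[OF that] c] isl by (simp add: smooth_fun_on_def)
  then have "continuous_on K (\<lambda>y. cmod (?P l y - ?P v y))"
    using lH v K(2) by (intro continuous_on_norm continuous_on_diff) (blast intro: continuous_on_subset)+
  from continuous_attains_sup[OF K(1) False this]
  obtain z where z: "z \<in> K" "\<And>y. y \<in> K \<Longrightarrow> cmod (?P l y - ?P v y) \<le> cmod (?P l z - ?P v z)" by blast
  have "cmod (?P (l - v) z) < \<epsilon>"
    using l z(1) by (simp add: seminorm_ball_def)
  then have "cmod (?P l z - ?P v z) < \<epsilon>"
    by (simp add: d[OF lH v z(1)])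
  then have pos: "\<epsilon> - cmod (?P l z - ?P v z) > 0" by simp
  have ck: "ck_lim k n (cdom c V) F (\<lambda>q. local_entry E c \<tau> i j (s q)) (local_entry E c \<tau> i j l)" for k
    using sec_limD[OF s(2) c, of k] by (simp add: mat_lim_def local_entry_eq)
  have "uniform_limit K (\<lambda>q. ?P (s q)) (?P l) F"
    using ck_lim_partials[OF ck isl, of 0] K by simp
  from uniform_limitD[OF this pos] s(1) show ?thesis
  proof eventually_elim
    case (elim q)
    have "cmod (?P (s q - v) y) < \<epsilon>" if y: "y \<in> K" for y
    proof -
      have "cmod (?P (s q - v) y) = cmod ((?P (s q) y - ?P l y) + (?P l y - ?P v y))"
        using d[OF elim(2) v y] by simp
      also have "\<dots> \<le> cmod (?P (s q) y - ?P l y) + cmod (?P l y - ?P v y)"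
        by (rule norm_triangle_ineq)
      also have "\<dots> < \<epsilon>"
        using elim(1) y z(2)[OF y] by (fastforce simp: dist_norm)
      finally show ?thesis .
    qed
    then show ?case using elim(2) by (simp add: seminorm_ball_def)
  qed
qed

text \<open>One direction tests the limit on balls centred at l. For the other the balls are only a
  subbasis, hence the induction over generated open sets.\<close>

lemma limitin_smooth_topology:
  "limitin X s l F \<longleftrightarrow> l \<in> herms \<and> (\<forall>\<^sub>F q in F. s q \<in> herms) \<and> sec_lim F s l"
proof
  assume lim: "limitin X s l F"
  have lH: "l \<in> herms" using limitin_topspace[OF lim] by (simp add: topspace_X)
  have sH: "\<forall>\<^sub>F q in F. s q \<in> herms"
    using limitinD[OF lim openin_topspace] lH by (simp add: topspace_X)
  have "sec_lim F s l"
  proof (rule sec_limI)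
    fix c V \<tau> k
    assume c: "c \<in> A" "(V, \<tau>) \<in> trivs E"
    show "mat_lim k n (cdom c V) F (\<lambda>q. local_matrix c \<tau> (s q)) (local_matrix c \<tau> l)"
      unfolding mat_lim_def local_entry_eq[symmetric]
    proof (intro allI ck_limI)
      fix i j
      show "\<forall>\<^sub>F q in F. smooth_fun_on n (cdom c V) (local_entry E c \<tau> i j (s q))"
        using sH by (rule eventually_mono) (rule local_entry_smooth[OF herms_sections c])
      show "smooth_fun_on n (cdom c V) (local_entry E c \<tau> i j l)"
        by (rule local_entry_smooth[OF herms_sections[OF lH] c])
      fix "is" K
      assume K: "is \<in> lists {..<n}" "compact K" "K \<subseteq> cdom c V"
      show "uniform_limit K (\<lambda>q. partials is (local_entry E c \<tau> i j (s q))) (partials is (local_entry E c \<tau> i j l)) F"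
      proof (rule uniform_limitI)
        fix e :: real assume e: "e > 0"
        have d: "partials is (local_entry E c \<tau> i j (a - l)) y =
            partials is (local_entry E c \<tau> i j a) y - partials is (local_entry E c \<tau> i j l) y"
          if "a \<in> herms" "y \<in> K" for a y
          by (rule partials_local_entry_diff[OF herms_sections[OF that(1)] herms_sections[OF lH] c K(1)])
            (use K that in blast)
        have "l \<in> seminorm_ball l c \<tau> K is i j e"
          using lH e d[OF lH] by (simp add: seminorm_ball_def)
        from limitinD[OF lim openin_seminorm_ball[OF lH c K(2,3,1) e] this]
        show "\<forall>\<^sub>F q in F. \<forall>y\<in>K. dist (partials is (local_entry E c \<tau> i j (s q)) y)
            (partials is (local_entry E c \<tau> i j l) y) < e"
        proof (rule eventually_mono, intro ballI)
          fix q y assume q: "s q \<in> seminorm_ball l c \<tau> K is i j e" and y: "y \<in> K"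
          then have "s q \<in> herms" "cmod (partials is (local_entry E c \<tau> i j (s q - l)) y) < e"
            by (simp_all add: seminorm_ball_def)
          then show "dist (partials is (local_entry E c \<tau> i j (s q)) y)
              (partials is (local_entry E c \<tau> i j l) y) < e"
            using d[OF _ y] by (simp add: dist_norm)
        qed
      qed
    qed
  qed
  with lH sH show "l \<in> herms \<and> (\<forall>\<^sub>F q in F. s q \<in> herms) \<and> sec_lim F s l" by blast
next
  assume *: "l \<in> herms \<and> (\<forall>\<^sub>F q in F. s q \<in> herms) \<and> sec_lim F s l"
  have "\<forall>\<^sub>F q in F. s q \<in> U" if "openin X U" "l \<in> U" for U
    using that(1)[unfolded smooth_topology_eq openin_topology_generated_by_iff] that(2)
  proof (induction rule: generate_topology_on.induct)
    case Empty
    then show ?case by simp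
  next
    case (Int a b)
    then show ?case by (simp add: eventually_conj_iff)
  next
    case (UN K)
    then obtain k where "k \<in> K" "l \<in> k" by blast
    with UN.IH have "\<forall>\<^sub>F q in F. s q \<in> k" by blast
    then show ?case by (rule eventually_mono) (use \<open>k \<in> K\<close> in blast)
  next
    case (Basis b)
    from Basis(1) obtain v c V \<tau> K "is" i j \<epsilon> where b: "b = seminorm_ball v c \<tau> K is i j \<epsilon>"
       "v \<in> herms" "c \<in> A" "(V, \<tau>) \<in> trivs E" "compact K" "K \<subseteq> cdom c V" "is \<in> lists {..<n}" "\<epsilon> > 0"
      by blast
    show ?case
      using Basis(2) * unfolding b(1) by (intro eventually_seminorm_ball[OF _ _ _ b(2-8)]) auto
  qed
  then show "limitin X s l F"
    using * by (simp add: limitin_def topspace_X)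
qed

lemma sec_lim_line:
  assumes "h \<in> sections" "l \<in> sections"
  shows "sec_lim (at 0) (\<lambda>t::real. h + t *\<^sub>R l) h"
proof -
  have "sec_lim (at 0) (\<lambda>t::real. h + t *\<^sub>R l) (h + 0 *\<^sub>R l)"
    by (intro sec_lim_add sec_lim_scaleR sec_lim_const assms tendsto_ident_at)
  then show ?thesis by simp
qed

section \<open>Positivity is an open condition\<close>

text \<open>Uniform limits are available on compact subsets of coordinate domains; this places an
  open set of the manifold inside one. The complement of the domain is compact, so the Hausdorff
  property separates it from x by disjoint open sets, and the complement of its neighbourhood is the
  compact set wanted.\<close>

lemma compact_nbhd:
  obtains c V \<tau> N K where "c \<in> A" "(V, \<tau>) \<in> trivs E" "open N" "x \<in> N" "N \<subseteq> fst c \<inter> V"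
    "compact K" "K \<subseteq> cdom c V" "snd c ` N \<subseteq> K"
proof -
  obtain c V \<tau> where V: "c \<in> A" "(V, \<tau>) \<in> trivs E" "x \<in> fst c" "x \<in> V" by (rule cover)
  have hom: "homeomorphism (fst c) (snd c ` fst c) (snd c) (chart_inv c)" and "open (fst c)"
    using chart[OF V(1)] by (auto simp: is_chart_def)
  have comp: "compact (UNIV :: 'm set)"
    using manifold by (simp add: closed_oriented_manifold_def)
  have O: "open (fst c \<inter> V)" using \<open>open (fst c)\<close> triv_open[OF V(2)] by blast
  then have "compact (- (fst c \<inter> V))"
    using compact_Int_closed[OF comp closed_Compl[OF O]] by (simp only: Int_UNIV_left)
  have "\<exists>N N'. open N \<and> open N' \<and> x \<in> N \<and> - (fst c \<inter> V) \<subseteq> N' \<and> N \<inter> N' = {}"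
  proof -
    have "Hausdorff_space (euclidean :: 'm topology)"
      unfolding Hausdorff_space_def disjnt_def using hausdorff[where 'a = 'm] by simp
    moreover have "compactin euclidean {x}" "compactin euclidean (- (fst c \<inter> V))"
      using \<open>compact (- (fst c \<inter> V))\<close> by simp_all
    moreover have "disjnt {x} (- (fst c \<inter> V))" using V by simp
    ultimately obtain N N' where "openin euclidean N" "openin euclidean N'" "{x} \<subseteq> N"
       "- (fst c \<inter> V) \<subseteq> N'" "disjnt N N'"
      unfolding Hausdorff_space_compact_sets by meson
    then show ?thesis by (auto simp: disjnt_def)
  qed
  then obtain N N' where N: "open N" "open N'" "x \<in> N" "- (fst c \<inter> V) \<subseteq> N'" "N \<inter> N' = {}" by blast
  have sub: "- N' \<subseteq> fst c \<inter> V" "N \<subseteq> - N'" using N by auto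
  have "compact (- N')"
    using compact_Int_closed[OF comp, of "- N'"] N(2) by (simp add: closed_Compl)
  moreover have "continuous_on (- N') (snd c)"
    using hom sub by (auto simp: homeomorphism_def intro: continuous_on_subset)
  ultimately have "compact (snd c ` (- N'))" by (rule compact_continuous_image[rotated])
  show ?thesis
    by (rule that[OF V(1,2) N(1,3) _ \<open>compact (snd c ` (- N'))\<close>]) (use sub in auto)
qed

lemma chart_inv_chart: "c \<in> A \<Longrightarrow> x \<in> fst c \<Longrightarrow> chart_inv c (snd c x) = x"
  using chart[of c] by (auto simp: is_chart_def homeomorphism_def)

text \<open>A finite subcover turns locally uniform eventual statements into a global one, as only
  finitely many have to hold at once.\<close>

lemma eventually_everywhere:
  assumes "\<And>x. \<exists>N. open N \<and> x \<in> N \<and> (\<forall>\<^sub>F q in F. \<forall>y\<in>N. P q y)"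
  shows "\<forall>\<^sub>F q in F. \<forall>y::'m. P q y"
proof -
  obtain N where N: "\<And>x::'m. open (N x) \<and> x \<in> N x \<and> (\<forall>\<^sub>F q in F. \<forall>y\<in>N x. P q y)"
    using assms by metis
  have comp: "compact (UNIV :: 'm set)"
    using manifold by (simp add: closed_oriented_manifold_def)
  obtain D where D: "finite D" "(UNIV :: 'm set) \<subseteq> (\<Union>x\<in>D. N x)"
    by (rule compactE_image[OF comp, of UNIV N]) (use N in auto)
  have "\<forall>\<^sub>F q in F. \<forall>x\<in>D. \<forall>y\<in>N x. P q y"
    using D(1) N by (simp add: eventually_ball_finite)
  then show ?thesis by (rule eventually_mono) (use D(2) in blast)
qed

lemma continuous_on_local_matrix:
  assumes "s \<in> sections" "c \<in> A" "(V, \<tau>) \<in> trivs E"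
  shows "continuous_on (cdom c V) (\<lambda>y. local_matrix c \<tau> s y $ i $ j)"
  using smooth_fun_onD(1)[OF local_entry_smooth[OF assms]] by (simp add: local_entry_eq)

lemma herm_form_line: "herm_form (H + t *\<^sub>R L) z z = herm_form H z z + of_real t * herm_form L z z"
  by (simp add: herm_form_def algebra_simps sum.distrib sum_distrib_left scaleR_conv_of_real[where 'a = complex])

text \<open>By compactness the form of h on unit vectors is locally bounded below by a positive
  constant and that of l is bounded, so a small multiple of l cannot destroy positivity.\<close>

lemma pos_herms_line:
  assumes h: "h \<in> pos_herms" and l: "l \<in> herms"
  shows "\<forall>\<^sub>F t in at 0. h + t *\<^sub>R l \<in> pos_herms"
proof -
  have "\<forall>\<^sub>F t in at 0. \<forall>x. \<exists>(V, \<tau>)\<in>trivs E. x \<in> V \<and> posdef_matrix (form_matrix E x (\<tau> x) ((h + t *\<^sub>R l) x))"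
  proof (rule eventually_everywhere)
    fix x
    obtain c V \<tau> N K where V: "c \<in> A" "(V, \<tau>) \<in> trivs E" and N: "open N" "x \<in> N" "N \<subseteq> fst c \<inter> V"
      and K: "compact K" "K \<subseteq> cdom c V" "snd c ` N \<subseteq> K"
      by (rule compact_nbhd)
    let ?H = "local_matrix c \<tau> h" and ?L = "local_matrix c \<tau> l"
    \<comment> \<open>Definiteness is homogeneous, so unit vectors suffice, and with K they form a
      compact set.\<close>
    define S where "S = K \<times> sphere (0 :: complex^'r) 1"
    have "compact S" unfolding S_def by (intro compact_Times K compact_sphere)
    have cont: "continuous_on S (\<lambda>(y, z). Re (herm_form (local_matrix c \<tau> s y) z z))" if "s \<in> sections" for s
      unfolding herm_form_def case_prod_unfold
    proof (intro continuous_on_Re continuous_on_sum continuous_on_mult continuous_on_cnj)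
      fix i j
      show "continuous_on S (\<lambda>p. local_matrix c \<tau> s (fst p) $ i $ j)"
        by (rule continuous_on_compose2[OF continuous_on_local_matrix[OF that V] continuous_on_fst[OF continuous_on_id]])
          (use K(2) in \<open>auto simp: S_def\<close>)
    qed (auto intro!: continuous_intros)
    have S: "S \<noteq> {}"
    proof -
      have "norm (axis undefined 1 :: complex^'r) = 1" by simp
      moreover have "snd c x \<in> K" using N K by blast
      ultimately show ?thesis unfolding S_def by (metis SigmaI dist_0_norm empty_iff mem_sphere)
    qed
    have hs: "h \<in> sections" and ls: "l \<in> sections"
      using h l pos_herms_herms herms_sections by blast+
    obtain p where p: "p \<in> S" "\<And>q. q \<in> S \<Longrightarrow>
        Re (herm_form (?H (fst p)) (snd p) (snd p)) \<le> Re (herm_form (?H (fst q)) (snd q) (snd q))"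
      using continuous_attains_inf[OF \<open>compact S\<close> S cont[OF hs]] by (auto simp: case_prod_unfold)
    \<comment> \<open>The least value of the form of h on S. With a bound M for the form of l there,
      every t with |t| < m / M leaves h + t l positive on S.\<close>
    define m where "m = Re (herm_form (?H (fst p)) (snd p) (snd p))"
    have Hpos: "posdef_matrix (?H y)" if "y \<in> K" for y
      unfolding local_matrix_def
      by (rule pos_herms_posdef[OF h V(2)]) (use that K chart_inv_in[OF _ V(1)] in blast)
    have "m > 0"
    proof -
      have "fst p \<in> K" "snd p \<noteq> 0" using p(1) by (auto simp: S_def)
      then show ?thesis using Hpos[of "fst p"] by (simp add: posdef_matrix_def m_def)
    qed
    have "bounded ((\<lambda>(y, z). Re (herm_form (?L y) z z)) ` S)"
      by (rule compact_imp_bounded[OF compact_continuous_image[OF cont[OF ls] \<open>compact S\<close>]])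
    then obtain M where M: "M > 0" "\<And>y z. (y, z) \<in> S \<Longrightarrow> \<bar>Re (herm_form (?L y) z z)\<bar> \<le> M"
      unfolding bounded_pos by (auto simp: S_def)
    have "\<forall>\<^sub>F t in at (0::real). \<bar>t\<bar> < m / M"
      using \<open>m > 0\<close> \<open>M > 0\<close> unfolding eventually_at by (intro exI[of _ "m / M"]) (auto simp: dist_real_def)
    then have "\<forall>\<^sub>F t in at 0. \<forall>y\<in>N. \<exists>(V, \<tau>)\<in>trivs E. y \<in> V \<and> posdef_matrix (form_matrix E y (\<tau> y) ((h + t *\<^sub>R l) y))"
    proof (rule eventually_mono, intro ballI)
      fix t :: real and w assume t: "\<bar>t\<bar> < m / M" and w: "w \<in> N"
      define y where "y = snd c w"
      have y: "y \<in> K" "chart_inv c y = w"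
        using w N K chart_inv_chart[OF V(1)] by (auto simp: y_def)
      have pd: "Re (herm_form (?H y + t *\<^sub>R ?L y) z z) > 0" if "z \<noteq> 0" for z
      proof -
        \<comment> \<open>Normalizes z; the value of the form changes by the positive factor 1 /
          |z|^2.\<close>
        define z' where "z' = of_real (1 / norm z) *s z"
        have "z' = (1 / norm z) *\<^sub>R z"
          by (simp add: z'_def vec_eq_iff scaleR_conv_of_real[where 'a = complex])
        then have "norm z' = 1" using that by simp
        then have S': "(y, z') \<in> S" using y by (simp add: S_def)
        have "Re (herm_form (?H y) z' z') \<ge> m"
          using p(2)[OF S'] by (simp add: m_def)
        moreover have "\<bar>t * Re (herm_form (?L y) z' z')\<bar> < m"
        proof -
          have "\<bar>t * Re (herm_form (?L y) z' z')\<bar> \<le> \<bar>t\<bar> * M"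
            unfolding abs_mult by (rule mult_left_mono[OF M(2)[OF S']]) simp
          also have "\<dots> < m" using t \<open>M > 0\<close> by (simp add: pos_less_divide_eq)
          finally show ?thesis .
        qed
        ultimately have "Re (herm_form (?H y + t *\<^sub>R ?L y) z' z') > 0"
          unfolding herm_form_line by simp
        moreover have "herm_form (?H y + t *\<^sub>R ?L y) z' z' =
            of_real ((1 / norm z)\<^sup>2) * herm_form (?H y + t *\<^sub>R ?L y) z z"
          unfolding z'_def herm_form_scale by (simp add: power2_eq_square)
        ultimately have "(1 / norm z)\<^sup>2 * Re (herm_form (?H y + t *\<^sub>R ?L y) z z) > 0" by simp
        then show ?thesis by (simp add: zero_less_mult_iff)
      qed
      have "hermitian_matrix (local_matrix c \<tau> (h + t *\<^sub>R l) y)"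
        unfolding local_matrix_def
        by (rule form_matrix_hermitian_section[OF
              herms_closed(1)[OF pos_herms_herms[OF h] herms_closed(2)[OF l]] V(2)])
          (use y w N in blast)
      then have "posdef_matrix (local_matrix c \<tau> (h + t *\<^sub>R l) y)"
        using pd by (simp add: posdef_matrix_def local_matrix_add local_matrix_scaleR)
      then show "\<exists>(V, \<tau>)\<in>trivs E. w \<in> V \<and> posdef_matrix (form_matrix E w (\<tau> w) ((h + t *\<^sub>R l) w))"
        using V(2) w N(3) y(2) unfolding local_matrix_def by blast
    qed
    with N show "\<exists>N. open N \<and> x \<in> N \<and> (\<forall>\<^sub>F t in at 0. \<forall>y\<in>N.
        \<exists>(V, \<tau>)\<in>trivs E. y \<in> V \<and> posdef_matrix (form_matrix E y (\<tau> y) ((h + t *\<^sub>R l) y)))"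
      by blast
  qed
  then show ?thesis
    by (rule eventually_mono) (rule pos_hermsI[OF herms_closed(1)[OF pos_herms_herms[OF h] herms_closed(2)[OF l]]], blast)
qed

end

section \<open>The spray is a smooth map\<close>

lemma matrix_sub_distrib:
  fixes A B C :: "complex^'n^'n"
  shows "A ** (B - C) = A ** B - A ** C" "(B - C) ** A = B ** A - C ** A"
  by (simp_all add: vec_eq_iff matrix_matrix_mult_def sum_subtractf algebra_simps)

lemma matrix_scaleR_mult:
  fixes A B :: "complex^'n^'n"
  shows "A ** (r *\<^sub>R B) = r *\<^sub>R (A ** B)" "(r *\<^sub>R A) ** B = r *\<^sub>R (A ** B)"
  by (simp_all add: vec_eq_iff matrix_matrix_mult_def scaleR_sum_right)

lemma matrix_inv_resolvent:
  fixes H H' :: "complex^'n^'n"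
  assumes "det H \<noteq> 0" "det H' \<noteq> 0"
  shows "matrix_inv H' ** ((H' - H) ** matrix_inv H) = matrix_inv H - matrix_inv H'"
  by (simp add: matrix_sub_distrib matrix_inv_mult assms)
    (simp add: matrix_mul_assoc matrix_inv_mult assms)

text \<open>Telescoping changes the left factor, the right factor and the inverse one at a time; the
  resolvent identity rewrites the last change. The result is exact in t and consists only of
  products with an inverse in the middle, so its limit needs continuity alone.\<close>

lemma matrix_triple_diff_quotient:
  fixes A A' B B' H L :: "complex^'n^'n"
  assumes "det H \<noteq> 0" "det (H + t *\<^sub>R L) \<noteq> 0" "t \<noteq> 0"
  defines "K \<equiv> matrix_inv H" and "K' \<equiv> matrix_inv (H + t *\<^sub>R L)"
  shows "(1 / t) *\<^sub>R (A' ** K' ** B' - A ** K ** B) =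
    ((1 / t) *\<^sub>R (A' - A)) ** K' ** B' + A ** K' ** ((1 / t) *\<^sub>R (B' - B)) + - (A ** K' ** (L ** K ** B))"
proof -
  have "t *\<^sub>R (K' ** (L ** K)) = K - K'"
    using matrix_inv_resolvent[OF assms(1,2)] by (simp add: K_def K'_def matrix_scaleR_mult)
  then have KLK: "K' ** (L ** K) = (1 / t) *\<^sub>R (K - K')"
    using \<open>t \<noteq> 0\<close> by (simp add: divide_simps flip: \<open>t *\<^sub>R (K' ** (L ** K)) = K - K'\<close>)
  have "A ** K' ** (L ** K ** B) = A ** (K' ** (L ** K)) ** B"
    by (simp add: matrix_mul_assoc)
  then have "A ** K' ** (L ** K ** B) = A ** ((1 / t) *\<^sub>R (K - K')) ** B"
    unfolding KLK .
  then show ?thesis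
    by (simp add: matrix_scaleR_mult matrix_sub_distrib scaleR_diff_right matrix_mul_assoc)
qed

text \<open>All iterated directional derivatives of \<open>(h, v, w) \<mapsto> v h\<^sup>-\<^sup>1 w\<close> are noncommutative polynomials, for
  the product \<open>a h\<^sup>-\<^sup>1 b\<close>, in \<open>v\<close>, \<open>w\<close> and the components of the directions; \<open>DirH j\<close>, \<open>DirV j\<close>, \<open>DirW j\<close> stand
  for the components of the \<open>j\<close>-th direction.\<close>

datatype spray_term = VarV | VarW | DirH nat | DirV nat | DirW nat | Zero
  | Plus spray_term spray_term | Minus spray_term | Mult spray_term spray_term

primrec dirs :: "spray_term \<Rightarrow> nat set" where
  "dirs VarV = {}" | "dirs VarW = {}" | "dirs (DirH j) = {j}" | "dirs (DirV j) = {j}"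
| "dirs (DirW j) = {j}" | "dirs Zero = {}" | "dirs (Plus a b) = dirs a \<union> dirs b"
| "dirs (Minus a) = dirs a" | "dirs (Mult a b) = dirs a \<union> dirs b"

text \<open>The directional derivative in the \<open>k\<close>-th direction; \<open>Mult a b\<close> stands for \<open>a h\<^sup>-\<^sup>1 b\<close>, whence
  the third summand.\<close>

primrec deriv_term :: "nat \<Rightarrow> spray_term \<Rightarrow> spray_term" where
  "deriv_term k VarV = DirV k" | "deriv_term k VarW = DirW k"
| "deriv_term k (DirH j) = Zero" | "deriv_term k (DirV j) = Zero" | "deriv_term k (DirW j) = Zero"
| "deriv_term k Zero = Zero"
| "deriv_term k (Plus a b) = Plus (deriv_term k a) (deriv_term k b)"
| "deriv_term k (Minus a) = Minus (deriv_term k a)"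
| "deriv_term k (Mult a b) = Plus (Plus (Mult (deriv_term k a) b) (Mult a (deriv_term k b)))
     (Minus (Mult a (Mult (DirH k) b)))"

text \<open>Starts from v h^-1 w itself rather than its symmetrization, which keeps the terms small;
  \<open>herm_part\<close> is applied after evaluation.\<close>

primrec spray_deriv :: "nat \<Rightarrow> spray_term" where
  "spray_deriv 0 = Mult VarV VarW"
| "spray_deriv (Suc k) = deriv_term k (spray_deriv k)"

lemma finite_dirs: "finite (dirs e)"
  by (induction e) auto

lemma dirs_deriv_term: "dirs (deriv_term k e) \<subseteq> insert k (dirs e)"
  by (induction e) auto

text \<open>The derivative of order k sees only the directions below k, so restricting u to
  \<open>{..<k}\<close>, as in \<open>frechet_smooth_on\<close>, does not change its value.\<close>

lemma dirs_spray_deriv: "dirs (spray_deriv k) \<subseteq> {..<k}"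
proof (induction k)
  case (Suc k)
  then show ?case using dirs_deriv_term[of k "spray_deriv k"] by (auto simp: less_Suc_eq)
qed simp

context manifold_bundle
begin

lemma form_mult_diff_quotient:
  assumes h: "h \<in> nondeg" "h + t *\<^sub>R l \<in> nondeg" and "t \<noteq> 0"
    and s: "l \<in> sesquis" "a \<in> sesquis" "a' \<in> sesquis" "b \<in> sesquis" "b' \<in> sesquis"
  shows "(1 / t) *\<^sub>R (form_mult E (h + t *\<^sub>R l) a' b' - form_mult E h a b) =
    form_mult E (h + t *\<^sub>R l) ((1 / t) *\<^sub>R (a' - a)) b' + form_mult E (h + t *\<^sub>R l) a ((1 / t) *\<^sub>R (b' - b))
    + - form_mult E (h + t *\<^sub>R l) a (form_mult E h l b)"
    (is "?l = ?r")
proof -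
  have d: "x - y \<in> sesquis" if "x \<in> sesquis" "y \<in> sesquis" for x y
    using sesquis_closed(1)[OF that(1) sesquis_closed(2)[OF that(2), of "- 1"]] by simp
  have m: "- x \<in> sesquis" if "x \<in> sesquis" for x
    using sesquis_closed(2)[OF that, of "- 1"] by simp
  note cl = d m sesquis_closed form_mult_sesquis h s
  show ?thesis
  proof (rule sesquis_eqI)
    show "?l \<in> sesquis" "?r \<in> sesquis" by (intro cl)+
    fix V \<tau> x assume V: "(V, \<tau>) \<in> trivs E" "x \<in> V"
    let ?F = "form_matrix E x (\<tau> x)"
    have add: "?F ((p + q) x) = ?F (p x) + ?F (q x)" and sub: "?F ((p - q) x) = ?F (p x) - ?F (q x)"
      and neg: "?F ((- p) x) = - ?F (p x)" and sc: "?F ((r *\<^sub>R p) x) = r *\<^sub>R ?F (p x)" for p q r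
      by (simp_all add: form_matrix_def vec_eq_iff scaleR_fun_def)
    have mu: "?F (form_mult E k v w x) = ?F (v x) ** matrix_inv (?F (k x)) ** ?F (w x)"
      if "k \<in> nondeg" "v \<in> sesquis" "w \<in> sesquis" for k v w
      by (rule form_matrix_form_mult[OF that V])
    have F: "det (?F (h x)) \<noteq> 0" "det (?F (h x) + t *\<^sub>R ?F (l x)) \<noteq> 0"
      by (rule nondeg_det[OF h(1) V], rule nondeg_det[OF h(2) V, unfolded add sc])
    have L: "?F (?l x) = (1 / t) *\<^sub>R (?F (a' x) ** matrix_inv (?F (h x) + t *\<^sub>R ?F (l x)) ** ?F (b' x)
        - ?F (a x) ** matrix_inv (?F (h x)) ** ?F (b x))"
      by (simp only: sc sub add mu[OF h(2) s(3,5)] mu[OF h(1) s(2,4)])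
    have c: "(1 / t) *\<^sub>R (a' - a) \<in> sesquis" "(1 / t) *\<^sub>R (b' - b) \<in> sesquis" "form_mult E h l b \<in> sesquis"
      by (intro cl)+
    have R: "?F (?r x) = ((1 / t) *\<^sub>R (?F (a' x) - ?F (a x))) ** matrix_inv (?F (h x) + t *\<^sub>R ?F (l x)) ** ?F (b' x)
      + ?F (a x) ** matrix_inv (?F (h x) + t *\<^sub>R ?F (l x)) ** ((1 / t) *\<^sub>R (?F (b' x) - ?F (b x)))
      + - (?F (a x) ** matrix_inv (?F (h x) + t *\<^sub>R ?F (l x)) ** (?F (l x) ** matrix_inv (?F (h x)) ** ?F (b x)))"
      by (simp only: sc sub add neg mu[OF h(2) c(1) s(5)] mu[OF h(2) s(2) c(2)] mu[OF h(2) s(2) c(3)]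
        mu[OF h(1) s(1,4)])
    show "?F (?l x) = ?F (?r x)"
      unfolding L R by (rule matrix_triple_diff_quotient[OF F \<open>t \<noteq> 0\<close>])
  qed
qed

section \<open>Evaluation, continuity and differentiation of formal terms\<close>

type_synonym ('a, 'b) triple = "('a, 'b) form_field \<times> ('a, 'b) form_field \<times> ('a, 'b) form_field"

primrec ev_term :: "('m, 'v) triple \<Rightarrow> (nat \<Rightarrow> ('m, 'v) triple) \<Rightarrow> spray_term \<Rightarrow> ('m, 'v) form_field" where
  "ev_term x u VarV = fst (snd x)"
| "ev_term x u VarW = snd (snd x)"
| "ev_term x u (DirH j) = fst (u j)"
| "ev_term x u (DirV j) = fst (snd (u j))"
| "ev_term x u (DirW j) = snd (snd (u j))"
| "ev_term x u Zero = 0"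
| "ev_term x u (Plus a b) = ev_term x u a + ev_term x u b"
| "ev_term x u (Minus a) = - ev_term x u a"
| "ev_term x u (Mult a b) = form_mult E (fst x) (ev_term x u a) (ev_term x u b)"

abbreviation "PHH \<equiv> pos_herms \<times> herms \<times> herms"
abbreviation "HHH \<equiv> herms \<times> herms \<times> herms"

lemma ev_term_cong:
  "(\<And>j. j \<in> dirs e \<Longrightarrow> u j = u' j) \<Longrightarrow> ev_term x u e = ev_term x u' e"
  by (induction e) auto

lemma sections_uminus: "s \<in> sections \<Longrightarrow> - s \<in> sections"
  using sections_closed(2)[of s "- 1"] by simp

lemma ev_term_sections:
  assumes "x \<in> PHH"
  shows "(\<And>j. j \<in> dirs e \<Longrightarrow> u j \<in> HHH) \<Longrightarrow> ev_term x u e \<in> sections"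
proof (induction e)
  case (Mult a b)
  then show ?case using assms by (auto intro!: form_mult_sections)
next
  case (Plus a b)
  show ?case
    unfolding ev_term.simps by (intro sections_closed Plus.IH) (use Plus.prems in auto)
next
  case (Minus a)
  show ?case
    unfolding ev_term.simps by (intro sections_uminus Minus.IH) (use Minus.prems in auto)
next
  case Zero
  show ?case unfolding ev_term.simps by (rule zero_section)
next
  case (DirH j)
  then have "u j \<in> HHH" by simp
  then show ?case by (auto intro!: herms_sections)
next
  case (DirV j)
  then have "u j \<in> HHH" by simp
  then show ?case by (auto intro!: herms_sections)
next
  case (DirW j)
  then have "u j \<in> HHH" by simp
  then show ?case by (auto intro!: herms_sections)
qed (use assms in \<open>auto intro!: herms_sections\<close>)

definition triple_lim :: "'q filter \<Rightarrow> ('q \<Rightarrow> ('m, 'v) triple) \<Rightarrow> ('m, 'v) triple \<Rightarrow> bool" where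
  "triple_lim F f l \<longleftrightarrow> sec_lim F (\<lambda>q. fst (f q)) (fst l) \<and>
     sec_lim F (\<lambda>q. fst (snd (f q))) (fst (snd l)) \<and> sec_lim F (\<lambda>q. snd (snd (f q))) (snd (snd l))"

lemma triple_lim_const: "x \<in> HHH \<Longrightarrow> triple_lim F (\<lambda>_. x) x"
  by (auto simp: triple_lim_def intro!: sec_lim_const herms_sections)

lemma sec_lim_ev_term:
  assumes x: "triple_lim F x x0" "\<forall>\<^sub>F q in F. x q \<in> PHH" "x0 \<in> PHH"
  shows "(\<And>j. j \<in> dirs e \<Longrightarrow> triple_lim F (\<lambda>q. u q j) (u0 j)) \<Longrightarrow>
    (\<And>j. j \<in> dirs e \<Longrightarrow> \<forall>\<^sub>F q in F. u q j \<in> HHH) \<Longrightarrow> (\<And>j. j \<in> dirs e \<Longrightarrow> u0 j \<in> HHH) \<Longrightarrow>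
    sec_lim F (\<lambda>q. ev_term (x q) (u q) e) (ev_term x0 u0 e)"
proof (induction e)
  case (Mult a b)
  \<comment> \<open>A term mentions finitely many directions, so their eventual memberships hold
    simultaneously.\<close>
  have ev: "\<forall>\<^sub>F q in F. ev_term (x q) (u q) e \<in> sesquis" if "dirs e \<subseteq> dirs (Mult a b)" for e
  proof -
    have "\<forall>\<^sub>F q in F. \<forall>j\<in>dirs e. u q j \<in> HHH"
      using that Mult.prems(2) by (intro eventually_ball_finite finite_dirs) blast
    with x(2) show ?thesis
      by eventually_elim (intro sections_sesquis ev_term_sections, auto)
  qed
  have l: "ev_term x0 u0 e \<in> sesquis" if "dirs e \<subseteq> dirs (Mult a b)" for e
    by (intro sections_sesquis ev_term_sections x(3)) (use that Mult.prems(3) in blast)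
  have IH: "sec_lim F (\<lambda>q. ev_term (x q) (u q) a) (ev_term x0 u0 a)"
      "sec_lim F (\<lambda>q. ev_term (x q) (u q) b) (ev_term x0 u0 b)"
    by (rule Mult.IH; rule Mult.prems; simp)+
  have h: "sec_lim F (\<lambda>q. fst (x q)) (fst x0)" using x(1) by (simp add: triple_lim_def)
  have hn: "\<forall>\<^sub>F q in F. fst (x q) \<in> nondeg"
    using x(2) by (rule eventually_mono) (auto intro: pos_herms_nondeg)
  have hn0: "fst x0 \<in> nondeg" using x(3) by (auto intro: pos_herms_nondeg)
  have "sec_lim F (\<lambda>q. form_mult E (fst (x q)) (ev_term (x q) (u q) a) (ev_term (x q) (u q) b))
      (form_mult E (fst x0) (ev_term x0 u0 a) (ev_term x0 u0 b))"
    by (rule sec_lim_form_mult[OF h IH hn ev ev hn0 l l]) auto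
  then show ?case by simp
next
  case (Minus a)
  show ?case
    unfolding ev_term.simps
    by (rule sec_lim_uminus[OF Minus.IH]) (rule Minus.prems; simp)+
next
  case (Plus a b)
  show ?case
    unfolding ev_term.simps
    by (rule sec_lim_add[OF Plus.IH]) (rule Plus.prems; simp)+
next
  case Zero
  show ?case unfolding ev_term.simps by (rule sec_lim_const[OF zero_section])
qed (use x in \<open>auto simp: triple_lim_def\<close>)

lemma eventually_PHH_line:
  assumes "x \<in> PHH" "y \<in> HHH"
  shows "\<forall>\<^sub>F t in at 0. x + t *\<^sub>R y \<in> PHH"
proof -
  have "\<forall>\<^sub>F t in at 0. fst x + t *\<^sub>R fst y \<in> pos_herms"
    by (rule pos_herms_line) (use assms in auto)
  then show ?thesis
    by (rule eventually_mono) (use assms in \<open>auto simp: mem_Times_iff herms_closed\<close>)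
qed

lemma triple_lim_line:
  assumes "x \<in> HHH" "y \<in> HHH"
  shows "triple_lim (at 0) (\<lambda>t::real. x + t *\<^sub>R y) x"
  using assms by (auto simp: triple_lim_def intro!: sec_lim_line herms_sections)

text \<open>Structural induction over the term. The quotient is constant for t different from 0 at
  the variables v and w, and zero at directions, which do not depend on the point; only products
  involve the moving inverse.\<close>

lemma ev_term_deriv:
  assumes x: "x \<in> PHH" and uk: "u k \<in> HHH"
  shows "(\<And>j. j \<in> dirs e \<Longrightarrow> u j \<in> HHH) \<Longrightarrow>
    sec_lim (at 0) (\<lambda>t::real. (1 / t) *\<^sub>R (ev_term (x + t *\<^sub>R u k) u e - ev_term x u e)) (ev_term x u (deriv_term k e))"
proof (induction e)
  case VarV
  have s: "fst (snd (u k)) \<in> sections"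
    by (rule herms_sections) (use uk in \<open>simp add: mem_Times_iff\<close>)
  have "fst (snd (u k)) = (1 / t) *\<^sub>R (fst (snd (x + t *\<^sub>R u k)) - fst (snd (x)))" if "t \<noteq> 0" for t :: real
    using that by (simp add: fst_add snd_add del: plus_fun_apply)
  then have "\<forall>\<^sub>F t in at 0. fst (snd (u k)) = (1 / t) *\<^sub>R (fst (snd (x + t *\<^sub>R u k)) - fst (snd (x)))"
    by (rule eventually_mono[OF eventually_neq_at_within[of "0::real" 0 UNIV]])
  from sec_lim_cong_ev[OF sec_lim_const[OF s] this] show ?case
    unfolding ev_term.simps deriv_term.simps .
next
  case VarW
  have s: "snd (snd (u k)) \<in> sections"
    by (rule herms_sections) (use uk in \<open>simp add: mem_Times_iff\<close>)
  have "snd (snd (u k)) = (1 / t) *\<^sub>R (snd (snd (x + t *\<^sub>R u k)) - snd (snd (x)))" if "t \<noteq> 0" for t :: real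
    using that by (simp add: fst_add snd_add del: plus_fun_apply)
  then have "\<forall>\<^sub>F t in at 0. snd (snd (u k)) = (1 / t) *\<^sub>R (snd (snd (x + t *\<^sub>R u k)) - snd (snd (x)))"
    by (rule eventually_mono[OF eventually_neq_at_within[of "0::real" 0 UNIV]])
  from sec_lim_cong_ev[OF sec_lim_const[OF s] this] show ?case
    unfolding ev_term.simps deriv_term.simps .
next
  case (Plus a b)
  have "sec_lim (at 0) (\<lambda>t::real. (1 / t) *\<^sub>R (ev_term (x + t *\<^sub>R u k) u a - ev_term x u a)
     + (1 / t) *\<^sub>R (ev_term (x + t *\<^sub>R u k) u b - ev_term x u b))
     (ev_term x u (deriv_term k a) + ev_term x u (deriv_term k b))"
    by (rule sec_lim_add[OF Plus.IH]) (rule Plus.prems; simp)+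
  then show ?case
    unfolding ev_term.simps deriv_term.simps scaleR_add_right[symmetric] add_diff_add .
next
  case (Minus a)
  have "sec_lim (at 0) (\<lambda>t::real. - ((1 / t) *\<^sub>R (ev_term (x + t *\<^sub>R u k) u a - ev_term x u a)))
     (- ev_term x u (deriv_term k a))"
    by (rule sec_lim_uminus[OF Minus.IH]) (rule Minus.prems; simp)+
  then show ?case
    unfolding ev_term.simps deriv_term.simps scaleR_minus_right[symmetric] minus_diff_minus[symmetric] .
next
  case (Mult a b)
  have xH: "x \<in> HHH" using x pos_herms_herms by auto
  have da: "\<And>j. j \<in> dirs a \<Longrightarrow> u j \<in> HHH" and db: "\<And>j. j \<in> dirs b \<Longrightarrow> u j \<in> HHH"
    using Mult.prems by auto
  then have da': "\<forall>j\<in>dirs a. u j \<in> HHH" and db': "\<forall>j\<in>dirs b. u j \<in> HHH"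
    by blast+
  let ?x = "\<lambda>t::real. x + t *\<^sub>R u k"
  let ?q = "\<lambda>e t. (1 / t) *\<^sub>R (ev_term (?x t) u e - ev_term x u e)"
  have evP: "\<forall>\<^sub>F t in at 0. ?x t \<in> PHH" by (rule eventually_PHH_line[OF x uk])
  have lim: "sec_lim (at 0) (\<lambda>t. ev_term (?x t) u e) (ev_term x u e)"
    if "\<forall>j\<in>dirs e. u j \<in> HHH" for e
    by (rule sec_lim_ev_term[OF triple_lim_line[OF xH uk] evP x])
      (use that in \<open>auto intro: triple_lim_const\<close>)
  have sec: "ev_term x u e \<in> sesquis" if "\<forall>j\<in>dirs e. u j \<in> HHH" for e
    by (intro sections_sesquis ev_term_sections x bspec[OF that])
  have evs: "\<forall>\<^sub>F t in at 0. ev_term (?x t) u e \<in> sesquis" if "\<forall>j\<in>dirs e. u j \<in> HHH" for e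
    using evP by eventually_elim (intro sections_sesquis ev_term_sections bspec[OF that])
  have evq: "\<forall>\<^sub>F t in at 0. ?q e t \<in> sesquis" if "\<forall>j\<in>dirs e. u j \<in> HHH" for e
    using evs[OF that]
  proof eventually_elim
    case (elim t)
    have "(1 / t) *\<^sub>R (ev_term (?x t) u e + (- 1) *\<^sub>R ev_term x u e) \<in> sesquis"
      by (intro sesquis_closed elim sec that)
    then show ?case by (simp only: scaleR_minus1_left add_uminus_conv_diff)
  qed
  have l: "fst (u k) \<in> sections" using uk by (auto intro: herms_sections)
  have h: "fst x \<in> pos_herms" using x by auto
  have hl: "sec_lim (at 0) (\<lambda>t. fst (?x t)) (fst x)"
    using triple_lim_line[OF xH uk] by (simp add: triple_lim_def)
  have hn: "\<forall>\<^sub>F t in at 0. fst (?x t) \<in> nondeg"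
    using evP by (rule eventually_mono) (rule pos_herms_nondeg, simp add: mem_Times_iff)
  have hn0: "fst x \<in> nondeg" by (rule pos_herms_nondeg[OF h])
  let ?m = "form_mult E (fst x) (fst (u k)) (ev_term x u b)"
  have m: "?m \<in> sections"
    by (intro form_mult_sections h l ev_term_sections x db)
  have sa: "ev_term x u a \<in> sections" by (intro ev_term_sections x da)
  have dua: "\<forall>j\<in>dirs (deriv_term k a). u j \<in> HHH"
    and dub: "\<forall>j\<in>dirs (deriv_term k b). u j \<in> HHH"
    using subsetD[OF dirs_deriv_term[of k a]] subsetD[OF dirs_deriv_term[of k b]] da' db' uk
    by (metis insert_iff)+
  have a: "\<forall>\<^sub>F t in at (0::real). ev_term x u a \<in> sesquis" and m': "\<forall>\<^sub>F t in at (0::real). ?m \<in> sesquis"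
    by (simp_all add: sec[OF da'] sections_sesquis[OF m])
  have IH: "sec_lim (at 0) (?q a) (ev_term x u (deriv_term k a))"
      "sec_lim (at 0) (?q b) (ev_term x u (deriv_term k b))"
    by (rule Mult.IH(1), rule da, assumption) (rule Mult.IH(2), rule db, assumption)
  \<comment> \<open>The limits of the three summands of \<open>form_mult_diff_quotient\<close>. The
    base point moves in all of them, but the undifferentiated left factor in the last two is frozen
    at x.\<close>
  note T1 = sec_lim_form_mult[OF hl IH(1) lim[OF db'] hn evq[OF da'] evs[OF db'] hn0 sec[OF dua] sec[OF db']]
  note T2 = sec_lim_form_mult[OF hl sec_lim_const[OF sa] IH(2) hn a evq[OF db'] hn0 sec[OF da'] sec[OF dub]]
  note T3 = sec_lim_form_mult[OF hl sec_lim_const[OF sa] sec_lim_const[OF m] hn a m' hn0 sec[OF da'] sections_sesquis[OF m]]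
  have "sec_lim (at 0) (\<lambda>t. form_mult E (fst (?x t)) (?q a t) (ev_term (?x t) u b) +
      form_mult E (fst (?x t)) (ev_term x u a) (?q b t) +
      - form_mult E (fst (?x t)) (ev_term x u a) ?m)
     (form_mult E (fst x) (ev_term x u (deriv_term k a)) (ev_term x u b) +
      form_mult E (fst x) (ev_term x u a) (ev_term x u (deriv_term k b)) +
      - form_mult E (fst x) (ev_term x u a) ?m)"
    by (rule sec_lim_add[OF sec_lim_add[OF T1 T2] sec_lim_uminus[OF T3]])
  then have "sec_lim (at 0) (\<lambda>t. (1 / t) *\<^sub>R (form_mult E (fst (?x t)) (ev_term (?x t) u a) (ev_term (?x t) u b)
      - form_mult E (fst x) (ev_term x u a) (ev_term x u b)))
     (form_mult E (fst x) (ev_term x u (deriv_term k a)) (ev_term x u b) +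
      form_mult E (fst x) (ev_term x u a) (ev_term x u (deriv_term k b)) +
      - form_mult E (fst x) (ev_term x u a) ?m)"
  proof (rule sec_lim_cong_ev)
    have "\<forall>\<^sub>F t in at (0::real). t \<noteq> 0" by (auto simp: eventually_at intro: exI[of _ 1])
    with hn evs[OF da'] evs[OF db']
    show "\<forall>\<^sub>F t in at 0. form_mult E (fst (?x t)) (?q a t) (ev_term (?x t) u b) +
      form_mult E (fst (?x t)) (ev_term x u a) (?q b t) +
      - form_mult E (fst (?x t)) (ev_term x u a) ?m =
      (1 / t) *\<^sub>R (form_mult E (fst (?x t)) (ev_term (?x t) u a) (ev_term (?x t) u b)
      - form_mult E (fst x) (ev_term x u a) (ev_term x u b))"
    proof eventually_elim
      case (elim t)
      have f: "fst (?x t) = fst x + t *\<^sub>R fst (u k)" by simp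
      show ?case
        using form_mult_diff_quotient[OF hn0 elim(1)[unfolded f] elim(4) sections_sesquis[OF l]
          sec[OF da'] elim(2) sec[OF db'] elim(3), symmetric]
        unfolding f .
    qed
  qed
  then show ?case unfolding ev_term.simps deriv_term.simps .
next
  case Zero
  show ?case
    unfolding ev_term.simps deriv_term.simps diff_self scaleR_zero_right
    by (rule sec_lim_const[OF zero_section])
next
  case (DirH j)
  show ?case
    unfolding ev_term.simps deriv_term.simps diff_self scaleR_zero_right
    by (rule sec_lim_const[OF zero_section])
next
  case (DirV j)
  show ?case
    unfolding ev_term.simps deriv_term.simps diff_self scaleR_zero_right
    by (rule sec_lim_const[OF zero_section])
next
  case (DirW j)
  show ?case
    unfolding ev_term.simps deriv_term.simps diff_self scaleR_zero_right
    by (rule sec_lim_const[OF zero_section])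
qed

end

section \<open>The candidate spray and its smoothness\<close>

lemma matrix_add_distrib:
  fixes A B C :: "complex^'n^'n"
  shows "A ** (B + C) = A ** B + A ** C" "(B + C) ** A = B ** A + C ** A"
  by (simp_all add: vec_eq_iff matrix_matrix_mult_def sum.distrib algebra_simps)

lemma adjoint_matrix_inv:
  assumes "posdef_matrix H"
  shows "adjoint_matrix (matrix_inv H) = matrix_inv H"
proof -
  have "adjoint_matrix (matrix_inv H ** H) = adjoint_matrix (mat 1)"
    by (simp only: matrix_inv_mult[OF posdef_det_nz[OF assms]])
  moreover have "adjoint_matrix (mat 1 :: complex^'a^'a) = mat 1"
    by (simp add: adjoint_matrix_def mat_def vec_eq_iff)
  moreover have "adjoint_matrix H = H"
    using assms by (simp add: posdef_matrix_def hermitian_matrix_def)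
  ultimately have "H ** adjoint_matrix (matrix_inv H) = mat 1"
    by (simp add: adjoint_matrix_mult)
  from matrix_inv_unique[OF posdef_det_nz[OF assms] this] show ?thesis by simp
qed

context manifold_bundle
begin

definition spray :: "('m, 'v) form_field \<Rightarrow> ('m, 'v) form_field \<Rightarrow> ('m, 'v) form_field \<Rightarrow> ('m, 'v) form_field" where
  "spray h v w = (1 / 2) *\<^sub>R form_mult E h v w + (1 / 2) *\<^sub>R form_mult E h w v"

text \<open>The adjoint reverses V H^-1 W. Symmetrizing in v and w is thus the same as taking the
  Hermitian part, which is how the spray takes values in Hermitian forms.\<close>

lemma form_star_form_mult:
  assumes h: "h \<in> pos_herms" and v: "v \<in> herms" and w: "w \<in> herms"
  shows "form_star (form_mult E h v w) = form_mult E h w v"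
proof (rule sesquis_eqI)
  have s: "h \<in> nondeg" "v \<in> sesquis" "w \<in> sesquis"
    using h v w by (blast intro: pos_herms_nondeg sections_sesquis herms_sections)+
  show "form_star (form_mult E h v w) \<in> sesquis"
    by (intro sesquis_closed form_mult_sesquis s)
  show "form_mult E h w v \<in> sesquis"
    by (intro form_mult_sesquis s)
  fix V \<tau> x assume V: "(V, \<tau>) \<in> trivs E" "x \<in> V"
  have star: "form_matrix E x (\<tau> x) (form_star p x) = adjoint_matrix (form_matrix E x (\<tau> x) (p x))" for p
    by (simp add: form_matrix_def vec_eq_iff adjoint_matrix_def form_star_def)
  have "adjoint_matrix (form_matrix E x (\<tau> x) (v x)) = form_matrix E x (\<tau> x) (v x)"
    "adjoint_matrix (form_matrix E x (\<tau> x) (w x)) = form_matrix E x (\<tau> x) (w x)"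
    using form_matrix_hermitian_section[OF v V] form_matrix_hermitian_section[OF w V]
    by (simp_all add: hermitian_matrix_def)
  then show "form_matrix E x (\<tau> x) (form_star (form_mult E h v w) x) =
      form_matrix E x (\<tau> x) (form_mult E h w v x)"
    by (simp only: star form_matrix_form_mult[OF s V] form_matrix_form_mult[OF s(1,3,2) V]
      adjoint_matrix_mult adjoint_matrix_inv[OF pos_herms_posdef[OF h V]] matrix_mul_assoc)
qed

lemma spray_eq_herm_part:
  assumes "h \<in> pos_herms" "v \<in> herms" "w \<in> herms"
  shows "spray h v w = herm_part (form_mult E h v w)"
  unfolding spray_def herm_part_def form_star_form_mult[OF assms] by (rule scaleR_add_right[symmetric])

lemma spray_herms: "h \<in> pos_herms \<Longrightarrow> v \<in> herms \<Longrightarrow> w \<in> herms \<Longrightarrow> spray h v w \<in> herms"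
  using spray_eq_herm_part herm_part_herms form_mult_sections herms_sections by metis

lemma spray_sym: "spray h v w = spray h w v"
  unfolding spray_def by (rule add.commute)

lemma herm_part_diff: "herm_part (s - t) = herm_part s - herm_part t"
  and herm_part_scaleR: "herm_part (r *\<^sub>R s) = r *\<^sub>R herm_part s"
  by (simp_all add: herm_part_def form_star_def fun_eq_iff scaleR_fun_def algebra_simps)

lemma limitin_atin_prod:
  assumes "continuous_map Z X f" "p \<in> topspace Z"
  shows "sec_lim (atin Z p) f (f p)"
  using assms limitin_smooth_topology unfolding continuous_map_atin by blast

lemma eventually_atin_topspace: "(\<And>q. q \<in> topspace Z \<Longrightarrow> P q) \<Longrightarrow> eventually P (atin Z p)"
  unfolding eventually_atin by blast

text \<open>Continuity is convergence along \<open>atin Z p\<close> at every point p, to which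
  \<open>sec_lim_ev_term\<close> applies; the projections of the product space, being continuous,
  supply the convergence of its arguments.\<close>

lemma continuous_ev_term:
  fixes k :: nat
  defines "XX \<equiv> prod_topology X (prod_topology X X)"
  defines "Z \<equiv> prod_topology (subtopology XX PHH) (product_topology (\<lambda>_. XX) {..<k})"
  assumes e: "dirs e \<subseteq> {..<k}"
  shows "continuous_map Z X (\<lambda>(x, u). herm_part (ev_term x u e))"
proof -
  have tXX: "topspace XX = HHH" by (simp add: XX_def topspace_X)
  have sub: "PHH \<subseteq> HHH" using pos_herms_herms by auto
  have tZ: "topspace Z = PHH \<times> ({..<k} \<rightarrow>\<^sub>E HHH)"
    using sub by (simp add: Z_def tXX Int_absorb1)
  have cx: "continuous_map Z XX fst"
    using continuous_map_fst[of "subtopology XX PHH" "product_topology (\<lambda>_. XX) {..<k}"]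
    unfolding Z_def by (rule continuous_map_into_fulltopology)
  have cu: "continuous_map Z XX (\<lambda>p. snd p j)" if "j < k" for j
  proof -
    have "continuous_map (product_topology (\<lambda>_. XX) {..<k}) XX (\<lambda>u. u j)"
      by (rule continuous_map_product_projection) (use that in simp)
    from continuous_map_compose[OF continuous_map_snd this, of "subtopology XX PHH"]
    show ?thesis by (simp add: Z_def o_def)
  qed
  have trip: "triple_lim (atin Z p) f (f p)" if f: "continuous_map Z XX f" and p: "p \<in> topspace Z" for f p
  proof -
    have c: "continuous_map Z X (\<lambda>p. fst (f p))" "continuous_map Z (prod_topology X X) (\<lambda>p. snd (f p))"
      using continuous_map_compose[OF f[unfolded XX_def] continuous_map_fst]
        continuous_map_compose[OF f[unfolded XX_def] continuous_map_snd] by (simp_all add: o_def)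
    have "continuous_map Z X (\<lambda>p. fst (snd (f p)))" "continuous_map Z X (\<lambda>p. snd (snd (f p)))"
      using continuous_map_compose[OF c(2) continuous_map_fst]
        continuous_map_compose[OF c(2) continuous_map_snd] by (simp_all add: o_def)
    with c(1) show ?thesis
      unfolding triple_lim_def using limitin_atin_prod[OF _ p] by blast
  qed
  have mem: "fst q \<in> PHH" "j < k \<Longrightarrow> snd q j \<in> HHH" if "q \<in> topspace Z" for q j
    using that unfolding tZ by (auto simp: mem_Times_iff PiE_iff)
  have "limitin X (\<lambda>q. herm_part (ev_term (fst q) (snd q) e)) (herm_part (ev_term (fst p) (snd p) e)) (atin Z p)"
    if p: "p \<in> topspace Z" for p
  proof -
    have H: "herm_part (ev_term (fst q) (snd q) e) \<in> herms" if q: "q \<in> topspace Z" for q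
      by (intro herm_part_herms ev_term_sections mem[OF q]) (use e in blast)
    have "sec_lim (atin Z p) (\<lambda>q. ev_term (fst q) (snd q) e) (ev_term (fst p) (snd p) e)"
    proof (rule sec_lim_ev_term)
      show "triple_lim (atin Z p) fst (fst p)" by (rule trip[OF cx p])
      show "\<forall>\<^sub>F q in atin Z p. fst q \<in> PHH" by (rule eventually_atin_topspace) (rule mem)
      show "fst p \<in> PHH" by (rule mem[OF p])
      fix j assume "j \<in> dirs e"
      then have j: "j < k" using e by blast
      show "triple_lim (atin Z p) (\<lambda>q. snd q j) (snd p j)" by (rule trip[OF cu[OF j] p])
      show "\<forall>\<^sub>F q in atin Z p. snd q j \<in> HHH" by (rule eventually_atin_topspace) (rule mem(2)[OF _ j])
      show "snd p j \<in> HHH" by (rule mem(2)[OF p j])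
    qed
    moreover have "\<forall>\<^sub>F q in atin Z p. herm_part (ev_term (fst q) (snd q) e) \<in> herms"
      by (rule eventually_atin_topspace) (rule H)
    ultimately show ?thesis
      using sec_lim_herm_part H[OF p] unfolding limitin_smooth_topology by blast
  qed
  then show ?thesis
    unfolding continuous_map_atin case_prod_unfold by blast
qed

text \<open>The witness for the derivative of order k is the Hermitian part of an explicit term.
  Each order is obtained from the previous one by formal differentiation, so the continuity and
  limit conditions are instances of two lemmas on arbitrary terms.\<close>

lemma spray_smooth:
  "frechet_smooth_on (prod_topology X (prod_topology X X)) X PHH (\<lambda>(h, v, w). spray h v w)"
  unfolding frechet_smooth_on_def
proof (intro exI[of _ "\<lambda>k x u. herm_part (ev_term x u (spray_deriv k))"] conjI allI ballI)
  fix x u assume "x \<in> PHH"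
  then show "herm_part (ev_term x u (spray_deriv 0)) = (case x of (h, v, w) \<Rightarrow> spray h v w)"
    by (auto simp: spray_eq_herm_part)
next
  fix k
  show "continuous_map (prod_topology (subtopology (prod_topology X (prod_topology X X)) PHH)
      (product_topology (\<lambda>_. prod_topology X (prod_topology X X)) {..<k})) X
      (\<lambda>(x, u). herm_part (ev_term x u (spray_deriv k)))"
    by (rule continuous_ev_term[OF dirs_spray_deriv])
next
  fix k x and u :: "nat \<Rightarrow> ('m, 'v) triple"
  assume x: "x \<in> PHH" and "u \<in> {..<Suc k} \<rightarrow>\<^sub>E topspace (prod_topology X (prod_topology X X))"
  then have u: "u j \<in> HHH" if "j < Suc k" for j
    using that by (simp add: topspace_X PiE_iff)
  let ?e = "spray_deriv k"
  have res: "ev_term y (restrict u {..<k}) ?e = ev_term y u ?e" for y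
    by (rule ev_term_cong) (use dirs_spray_deriv[of k] in auto)
  have d: "u j \<in> HHH" if "j \<in> dirs ?e" for j
    by (rule u) (use that dirs_spray_deriv[of k] in auto)
  have d': "u j \<in> HHH" if "j \<in> dirs (spray_deriv (Suc k))" for j
    by (rule u) (use that dirs_spray_deriv[of "Suc k"] in auto)
  let ?q = "\<lambda>t::real. (1 / t) *\<^sub>R (ev_term (x + t *\<^sub>R u k) u ?e - ev_term x u ?e)"
  have "sec_lim (at 0) ?q (ev_term x u (spray_deriv (Suc k)))"
    unfolding spray_deriv.simps by (rule ev_term_deriv[OF x u d]) auto
  from sec_lim_herm_part[OF this]
  have lim: "sec_lim (at 0) (\<lambda>t. herm_part (?q t)) (herm_part (ev_term x u (spray_deriv (Suc k))))" .
  have "\<forall>\<^sub>F t in at 0. x + t *\<^sub>R u k \<in> PHH"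
    by (rule eventually_PHH_line[OF x u]) simp
  then have ev: "\<forall>\<^sub>F t in at 0. herm_part (?q t) \<in> herms"
  proof eventually_elim
    case (elim t)
    then show ?case
      unfolding herm_part_diff herm_part_scaleR
      by (intro herms_closed herms_diff herm_part_herms ev_term_sections x d)
  qed
  have H: "herm_part (ev_term x u (spray_deriv (Suc k))) \<in> herms"
    by (intro herm_part_herms ev_term_sections x d')
  show "limitin X (\<lambda>t::real. (1 / t) *\<^sub>R (herm_part (ev_term (x + t *\<^sub>R u k) (restrict u {..<k}) ?e)
      - herm_part (ev_term x (restrict u {..<k}) ?e))) (herm_part (ev_term x u (spray_deriv (Suc k)))) (at 0)"
    using lim ev H unfolding limitin_smooth_topology res herm_part_diff herm_part_scaleR by blast
qed

lemma spray_bilinear: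
  assumes h: "h \<in> pos_herms" and v: "v \<in> herms" "v' \<in> herms" and w: "w \<in> herms"
  shows "spray h (s *\<^sub>R v + s' *\<^sub>R v') w = s *\<^sub>R spray h v w + s' *\<^sub>R spray h v' w"
proof (rule sesquis_eqI)
  have vv: "s *\<^sub>R v + s' *\<^sub>R v' \<in> herms" by (intro herms_closed v)
  note hs = sections_sesquis[OF herms_sections]
  have S: "h \<in> nondeg" "v \<in> sesquis" "v' \<in> sesquis" "w \<in> sesquis" "s *\<^sub>R v + s' *\<^sub>R v' \<in> sesquis"
    by (rule pos_herms_nondeg[OF h] hs[OF v(1)] hs[OF v(2)] hs[OF w] hs[OF vv])+
  show "spray h (s *\<^sub>R v + s' *\<^sub>R v') w \<in> sesquis"
    by (rule hs[OF spray_herms[OF h vv w]])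
  show "s *\<^sub>R spray h v w + s' *\<^sub>R spray h v' w \<in> sesquis"
    by (intro sesquis_closed hs spray_herms h v w)
  fix V \<tau> x assume V: "(V, \<tau>) \<in> trivs E" "x \<in> V"
  let ?F = "form_matrix E x (\<tau> x)"
  have add: "?F ((p + q) x) = ?F (p x) + ?F (q x)" and sc: "?F ((r *\<^sub>R p) x) = r *\<^sub>R ?F (p x)" for p q r
    by (simp_all add: form_matrix_def vec_eq_iff scaleR_fun_def)
  have mu: "?F (form_mult E h a b x) = ?F (a x) ** matrix_inv (?F (h x)) ** ?F (b x)"
    if "a \<in> sesquis" "b \<in> sesquis" for a b
    by (rule form_matrix_form_mult[OF S(1) that V])
  have "?F (spray h a w x) = (1 / 2) *\<^sub>R (?F (a x) ** matrix_inv (?F (h x)) ** ?F (w x)) +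
      (1 / 2) *\<^sub>R (?F (w x) ** matrix_inv (?F (h x)) ** ?F (a x))" if "a \<in> sesquis" for a
    unfolding spray_def by (simp only: add sc mu[OF that S(4)] mu[OF S(4) that])
  from this[OF S(2)] this[OF S(3)] this[OF S(5)]
  show "?F (spray h (s *\<^sub>R v + s' *\<^sub>R v') w x) = ?F ((s *\<^sub>R spray h v w + s' *\<^sub>R spray h v' w) x)"
    unfolding add sc
    by (simp add: matrix_scaleR_mult matrix_add_distrib scaleR_add_right mult.commute add_ac)
qed

end

section \<open>The volume measure\<close>

text \<open>The dimension n is a number and not a type; this gives access to kernel vectors of
  singular n by n matrices.\<close>

lemma det_upto_eq_det:
  "det_upto n a = Determinant.det (Matrix.mat n n (\<lambda>(i, j). a i j))"
proof -
  have "(\<Prod>i = 0..<n. Matrix.mat n n (\<lambda>(i, j). a i j) $$ (i, p i)) = (\<Prod>i<n. a i (p i))"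
    if "p permutes {0..<n}" for p
    unfolding atLeast0LessThan
  proof (rule prod.cong)
    fix i assume i: "i \<in> {..<n}"
    then have "p i < n"
      using permutes_in_image[OF that, of i] by simp
    then show "Matrix.mat n n (\<lambda>(i, j). a i j) $$ (i, p i) = a i (p i)"
      using i by simp
  qed simp
  then show ?thesis
    by (subst Determinant.det_def'[of _ n]) (auto simp: det_upto_def atLeast0LessThan intro!: sum.cong)
qed

text \<open>A nonzero kernel vector would be a nonzero zero of the quadratic form.\<close>

lemma det_upto_nonzero:
  fixes a :: "nat \<Rightarrow> nat \<Rightarrow> real"
  assumes "\<And>\<xi>. \<exists>i<n. \<xi> i \<noteq> 0 \<Longrightarrow> (\<Sum>i<n. \<Sum>j<n. a i j * \<xi> i * \<xi> j) > 0"
  shows "det_upto n a \<noteq> 0"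
proof
  let ?M = "Matrix.mat n n (\<lambda>(i, j). a i j)"
  assume "det_upto n a = 0"
  then have "Determinant.det ?M = 0" by (simp add: det_upto_eq_det)
  then obtain v where v: "v \<in> carrier_vec n" "v \<noteq> 0\<^sub>v n" "?M *\<^sub>v v = 0\<^sub>v n"
    using det_0_iff_vec_prod_zero[of ?M n] by auto
  define \<xi> where "\<xi> i = vec_index v i" for i
  have "\<exists>i<n. \<xi> i \<noteq> 0"
  proof (rule ccontr)
    assume "\<not> (\<exists>i<n. \<xi> i \<noteq> 0)"
    then have "v = 0\<^sub>v n" using v(1) by (intro eq_vecI) (auto simp: \<xi>_def)
    with v(2) show False ..
  qed
  moreover have "(\<Sum>j<n. a i j * \<xi> j) = 0" if "i < n" for i
  proof -
    have "vec_index (?M *\<^sub>v v) i = 0" using v(3) that by simp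
    then show ?thesis
      using that v(1) by (simp add: scalar_prod_def \<xi>_def atLeast0LessThan)
  qed
  then have "(\<Sum>i<n. \<xi> i * (\<Sum>j<n. a i j * \<xi> j)) = 0" by simp
  then have "(\<Sum>i<n. \<Sum>j<n. a i j * \<xi> i * \<xi> j) = 0"
    by (simp add: sum_distrib_left mult_ac)
  ultimately show False using assms[of \<xi>] by simp
qed

text \<open>The determinant cannot change sign along the segment from the identity matrix.\<close>

lemma det_upto_pos:
  fixes a :: "nat \<Rightarrow> nat \<Rightarrow> real"
  assumes a: "\<And>\<xi>. \<exists>i<n. \<xi> i \<noteq> 0 \<Longrightarrow> (\<Sum>i<n. \<Sum>j<n. a i j * \<xi> i * \<xi> j) > 0"
  shows "det_upto n a > 0"
proof (rule ccontr)
  define b where "b t i j = (1 - t) * (if i = j then 1 else 0) + t * a i j" for t :: real and i j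
  assume "\<not> det_upto n a > 0"
  moreover have "b 1 = a" by (auto simp: b_def fun_eq_iff)
  ultimately have 1: "det_upto n (b 1) \<le> 0" by simp
  have "Matrix.mat n n (\<lambda>(i, j). b 0 i j) = 1\<^sub>m n"
    by (rule eq_matI) (auto simp: b_def)
  then have 0: "det_upto n (b 0) = 1" by (simp add: det_upto_eq_det)
  have "continuous_on {0..1} (\<lambda>t. det_upto n (b t))"
    unfolding det_upto_def b_def by (intro continuous_intros)
  from IVT2'[of "\<lambda>t. det_upto n (b t)" 1 0 0, OF _ _ _ this] 0 1
  obtain t where t: "0 \<le> t" "t \<le> 1" "det_upto n (b t) = 0" by auto
  have "det_upto n (b t) \<noteq> 0"
  proof (rule det_upto_nonzero)
    fix \<xi> :: "nat \<Rightarrow> real" assume \<xi>: "\<exists>i<n. \<xi> i \<noteq> 0"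
    then obtain i where i: "i < n" "\<xi> i \<noteq> 0" by blast
    have "(\<Sum>i<n. \<Sum>j<n. (if i = j then 1 else 0) * \<xi> i * \<xi> j) = (\<Sum>i<n. (\<xi> i)\<^sup>2)"
      by (rule sum.cong) (auto simp: if_distribR power2_eq_square if_distrib cong: if_cong)
    moreover have "(\<Sum>i<n. (\<xi> i)\<^sup>2) > 0"
      by (rule sum_pos2[of _ i]) (use i in auto)
    ultimately have I: "(\<Sum>i<n. \<Sum>j<n. (if i = j then 1 else 0) * \<xi> i * \<xi> j) > 0" by simp
    have "(\<Sum>i<n. \<Sum>j<n. b t i j * \<xi> i * \<xi> j) =
        (1 - t) * (\<Sum>i<n. \<Sum>j<n. (if i = j then 1 else 0) * \<xi> i * \<xi> j) + t * (\<Sum>i<n. \<Sum>j<n. a i j * \<xi> i * \<xi> j)"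
      unfolding b_def sum_distrib_left sum.distrib[symmetric] by (simp only: distrib_right mult.assoc)
    moreover have "(1 - t) * (\<Sum>i<n. \<Sum>j<n. (if i = j then 1 else 0) * \<xi> i * \<xi> j) +
        t * (\<Sum>i<n. \<Sum>j<n. a i j * \<xi> i * \<xi> j) > 0"
    \<comment> \<open>For t > 0 the strict inequality must come from a, because the first summand
      vanishes at t = 1; at t = 0 it comes from the identity.\<close>
    proof (cases "t = 0")
      case True
      then show ?thesis using I by simp
    next
      case False
      then show ?thesis using I a[OF \<xi>] t by (intro add_nonneg_pos mult_nonneg_nonneg mult_pos_pos) auto
    qed
    ultimately show "(\<Sum>i<n. \<Sum>j<n. b t i j * \<xi> i * \<xi> j) > 0" by simp
  qed
  with t show False by simp
qed

lemma emeasure_coord_box: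
  fixes a b :: "nat \<Rightarrow> real"
  assumes "\<And>i. i < n \<Longrightarrow> a i \<le> b i"
  shows "emeasure (Pi\<^sub>M {..<n} (\<lambda>_. lborel)) (Pi\<^sub>E {..<n} (\<lambda>i. {a i..b i})) = ennreal (\<Prod>i<n. b i - a i)"
    and "Pi\<^sub>E {..<n} (\<lambda>i. {a i..b i}) \<in> sets (Pi\<^sub>M {..<n} (\<lambda>_. lborel))"
proof -
  interpret product_sigma_finite "\<lambda>_::nat. lborel :: real measure" by unfold_locales
  have "emeasure (Pi\<^sub>M {..<n} (\<lambda>_. lborel)) (Pi\<^sub>E {..<n} (\<lambda>i. {a i..b i})) = (\<Prod>i<n. emeasure lborel {a i..b i})"
    by (rule emeasure_PiM) auto
  also have "\<dots> = (\<Prod>i<n. ennreal (b i - a i))"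
    using assms by (intro prod.cong) auto
  also have "\<dots> = ennreal (\<Prod>i<n. b i - a i)"
    using assms by (intro prod_ennreal) auto
  finally show "emeasure (Pi\<^sub>M {..<n} (\<lambda>_. lborel)) (Pi\<^sub>E {..<n} (\<lambda>i. {a i..b i})) = ennreal (\<Prod>i<n. b i - a i)" .
  show "Pi\<^sub>E {..<n} (\<lambda>i. {a i..b i}) \<in> sets (Pi\<^sub>M {..<n} (\<lambda>_. lborel))"
    by (rule sets_PiM_I_finite) auto
qed

text \<open>Points of \<open>coords n\<close> agree outside \<open>{..<n}\<close>, so only the
  finitely many radii with index below n have to be minimized.\<close>

lemma coords_open_contains_box:
  assumes "openin (top_of_set (coords n)) W" "y \<in> W"
  obtains e where "e > 0" "Pi\<^sub>E {..<n} (\<lambda>i. {y i - e..y i + e}) \<subseteq> W"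
proof -
  obtain T where T: "open T" "W = coords n \<inter> T"
    using assms(1) by (auto simp: openin_open)
  have oT: "openin (product_topology (\<lambda>_. euclidean) UNIV) T"
    using T(1) by (simp add: euclidean_product_topology)
  have yT: "y \<in> T" using assms(2) T(2) by blast
  obtain Y where Y: "y \<in> (\<Pi>\<^sub>E i\<in>UNIV. Y i)" "\<And>i. openin euclidean (Y i)" "(\<Pi>\<^sub>E i\<in>UNIV. Y i) \<subseteq> T"
    using product_topology_open_contains_basis[OF oT yT] by auto
  have "\<exists>e>0. cball (y i) e \<subseteq> Y i" for i
    using Y(1) Y(2)[of i] by (simp add: open_contains_cball PiE_iff)
  then obtain e where e: "\<And>i. e i > 0" "\<And>i. cball (y i) (e i) \<subseteq> Y i" by metis
  \<comment> \<open>The inserted 1 keeps the set nonempty when n = 0.\<close>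
  define d where "d = Min (insert 1 (e ` {..<n}))"
  have d: "d > 0" "\<And>i. i < n \<Longrightarrow> d \<le> e i"
    using e(1) by (auto simp: d_def)
  have "Pi\<^sub>E {..<n} (\<lambda>i. {y i - d..y i + d}) \<subseteq> W"
  proof
    fix z assume z: "z \<in> Pi\<^sub>E {..<n} (\<lambda>i. {y i - d..y i + d})"
    have yc: "y \<in> coords n" using assms T by auto
    have "z i \<in> Y i" for i
    proof (cases "i < n")
      case True
      then have "y i - d \<le> z i" "z i \<le> y i + d"
        using z by (auto simp: PiE_iff)
      then have "z i \<in> cball (y i) (e i)"
        using d(2)[OF True] by (simp add: dist_real_def abs_le_iff)
      then show ?thesis using e(2) by blast
    next
      case False
      then have "z i = y i" using z yc by (simp add: coords_def PiE_iff extensional_def)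
      then show ?thesis using Y(1) by (simp add: PiE_iff)
    qed
    then have "z \<in> T" using Y(3) by (auto simp: PiE_iff)
    moreover have "z \<in> coords n" using z by (auto simp: coords_def PiE_iff)
    ultimately show "z \<in> W" using T by blast
  qed
  with d(1) that show ?thesis by blast
qed

section \<open>Finiteness and strict positivity of the Riemannian volume\<close>

locale riemannian_bundle = manifold_bundle n A E
  for n :: nat
    and A :: "'m::{t2_space, second_countable_topology} chart set"
    and E :: "('m, 'v::ab_group_add, 'r::finite) vector_bundle" +
  fixes g :: "'m metric_components"
    and \<mu> :: "'m measure"
    and \<alpha> :: "'m \<Rightarrow> real"
  assumes metric: "riemannian_metric n A g"
    and volume: "is_volume_measure n A g \<mu>"
    and smooth_alpha: "smooth_scalar n A \<alpha>"
    and alpha_gt: "\<alpha> x > - 1 / real CARD('r)"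
begin

abbreviation "vol_dens c y \<equiv> sqrt (det_upto n (g c (chart_inv c y)))"

lemma metric_pos:
  "c \<in> A \<Longrightarrow> x \<in> fst c \<Longrightarrow> \<exists>i<n. \<xi> i \<noteq> 0 \<Longrightarrow> (\<Sum>i<n. \<Sum>j<n. g c x i j * \<xi> i * \<xi> j) > 0"
  using metric[unfolded riemannian_metric_def, THEN conjunct2, THEN conjunct2, THEN conjunct1] by blast

lemma vol_dens_pos: "c \<in> A \<Longrightarrow> y \<in> snd c ` fst c \<Longrightarrow> vol_dens c y > 0"
  using chart_inv_in[of y c UNIV] metric_pos[of c "chart_inv c y"]
  by (auto intro!: det_upto_pos)

lemma vol_dens_continuous:
  assumes c: "c \<in> A"
  shows "continuous_on (snd c ` fst c) (vol_dens c)"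
proof -
  have "continuous_on (snd c ` fst c) (\<lambda>y. g c (chart_inv c y) i j)" if "i < n" "j < n" for i j
    by (rule smooth_fun_onD(1)[where n = n]) (use metric[unfolded riemannian_metric_def, THEN conjunct1] c that in blast)
  moreover have "p i < n" if "p permutes {..<n}" "i < n" for p i
    using permutes_in_image[OF that(1), of i] that(2) by simp
  ultimately show ?thesis
    unfolding det_upto_def
    by (intro continuous_on_real_sqrt continuous_on_sum continuous_on_mult continuous_on_const continuous_on_prod)
      auto
qed

lemma sets_vol: "sets \<mu> = sets borel"
  using volume by (simp add: is_volume_measure_def)

lemma space_vol: "space \<mu> = UNIV"
  using sets_eq_imp_space_eq[OF sets_vol] by simp

lemma emeasure_vol:
  assumes "c \<in> A" "open S" "S \<subseteq> fst c"
  shows "emeasure \<mu> S = (\<integral>\<^sup>+ y. ennreal (vol_dens c y) * indicator (snd c ` S) y \<partial>(Pi\<^sub>M {..<n} (\<lambda>_. lborel)))"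
  using volume assms by (auto simp: is_volume_measure_def)

text \<open>Near each point the density is bounded and the coordinates stay in a box of finite
  Lebesgue measure; finitely many such neighbourhoods cover the manifold.\<close>

lemma finite_vol: "finite_measure \<mu>"
proof
  have "\<exists>N. open N \<and> x \<in> N \<and> emeasure \<mu> N < \<infinity>" for x
  proof -
    obtain c V \<tau> N K where V: "c \<in> A" "(V, \<tau>) \<in> trivs E" and N: "open N" "x \<in> N" "N \<subseteq> fst c \<inter> V"
      and K: "compact K" "K \<subseteq> cdom c V" "snd c ` N \<subseteq> K"
      by (rule compact_nbhd)
    have "compact (vol_dens c ` K)"
      by (rule compact_continuous_image[OF continuous_on_subset[OF vol_dens_continuous[OF V(1)]] K(1)]) (use K(2) in blast)
    from compact_imp_bounded[OF this] obtain B where B: "\<And>y. y \<in> K \<Longrightarrow> vol_dens c y \<le> B"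
      unfolding bounded_iff by (metis abs_le_D1 imageI real_norm_def)
    have "\<exists>R. \<forall>y\<in>K. \<bar>y i\<bar> \<le> R" for i
    proof -
      have "compact ((\<lambda>y. y i) ` K)"
        by (rule compact_continuous_image[OF continuous_on_subset[OF continuous_on_product_coordinates] K(1)]) simp
      from compact_imp_bounded[OF this] show ?thesis
        unfolding bounded_iff by auto
    qed
    then obtain R where R: "\<And>i y. y \<in> K \<Longrightarrow> \<bar>y i\<bar> \<le> R i" by metis
    \<comment> \<open>The absolute values order the endpoints, as the volume formula for boxes
      demands.\<close>
    let ?box = "Pi\<^sub>E {..<n} (\<lambda>i. {- \<bar>R i\<bar>..\<bar>R i\<bar>})"
    have "openin (top_of_set (coords n)) (cdom c V)" by (rule dom_open[OF V(1) triv_open[OF V(2)]])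
    then have "K \<subseteq> coords n" using K(2) openin_imp_subset by blast
    moreover have "- \<bar>R i\<bar> \<le> y i \<and> y i \<le> \<bar>R i\<bar>" if "y \<in> K" for i y
      using R[OF that, of i] by linarith
    ultimately have KB: "K \<subseteq> ?box"
      by (auto simp: coords_def PiE_iff)
    have "emeasure \<mu> N = (\<integral>\<^sup>+ y. ennreal (vol_dens c y) * indicator (snd c ` N) y \<partial>(Pi\<^sub>M {..<n} (\<lambda>_. lborel)))"
      by (rule emeasure_vol[OF V(1) N(1)]) (use N(3) in blast)
    also have "\<dots> \<le> (\<integral>\<^sup>+ y. ennreal B * indicator ?box y \<partial>(Pi\<^sub>M {..<n} (\<lambda>_. lborel)))"
    proof (rule nn_integral_mono)
      fix y
      show "ennreal (vol_dens c y) * indicator (snd c ` N) y \<le> ennreal B * indicator ?box y"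
      proof (cases "y \<in> snd c ` N")
        case True
        then have "y \<in> K" "y \<in> ?box" using K(3) KB by blast+
        then show ?thesis using B by (simp add: indicator_def ennreal_leI)
      qed simp
    qed
    also have "\<dots> = ennreal B * emeasure (Pi\<^sub>M {..<n} (\<lambda>_. lborel)) ?box"
      by (rule nn_integral_cmult_indicator) (rule emeasure_coord_box(2), simp)
    also have "\<dots> < \<infinity>"
      by (subst emeasure_coord_box(1)) (simp_all add: ennreal_mult_less_top)
    finally show ?thesis using N by blast
  qed
  then obtain N where N: "\<And>x. open (N x) \<and> x \<in> N x \<and> emeasure \<mu> (N x) < \<infinity>" by metis
  have comp: "compact (UNIV :: 'm set)"
    using manifold by (simp add: closed_oriented_manifold_def)
  obtain D where D: "finite D" "(UNIV :: 'm set) \<subseteq> (\<Union>x\<in>D. N x)"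
    by (rule compactE_image[OF comp, of UNIV N]) (use N in auto)
  have "emeasure \<mu> (\<Union>x\<in>D. N x) \<le> (\<Sum>x\<in>D. emeasure \<mu> (N x))"
    by (rule emeasure_subadditive_finite[OF D(1)]) (use N sets_vol in auto)
  also have "\<dots> < \<infinity>" using D(1) N by (induction D rule: finite_induct) (auto simp: ennreal_add_less_top)
  finally have "emeasure \<mu> (\<Union>x\<in>D. N x) \<noteq> \<infinity>" by simp
  moreover have "(\<Union>x\<in>D. N x) = UNIV" using D(2) by blast
  ultimately show "emeasure \<mu> (space \<mu>) \<noteq> \<infinity>" by (simp add: space_vol)
qed

text \<open>The density is positive and continuous, so it stays above a positive constant on some
  coordinate box inside the set, and this box has positive volume.\<close>

lemma open_vol_pos:
  assumes "open U" "x \<in> U"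
  shows "emeasure \<mu> U > 0"
proof -
  obtain c V \<tau> where V: "c \<in> A" "(V, \<tau>) \<in> trivs E" "x \<in> fst c" "x \<in> V" by (rule cover)
  define S where "S = U \<inter> fst c"
  have S: "open S" "x \<in> S" "S \<subseteq> fst c"
    using chart[OF V(1)] assms V by (auto simp: S_def is_chart_def)
  define y where "y = snd c x"
  \<comment> \<open>Half the density at y, so that by continuity the density exceeds it near
    y.\<close>
  define \<delta> where "\<delta> = vol_dens c y / 2"
  have "y \<in> snd c ` fst c" using V(3) by (simp add: y_def)
  then have "\<delta> > 0" using vol_dens_pos[OF V(1)] by (simp add: \<delta>_def)
  have D: "snd c ` S = cdom c S" using S(3) by (simp add: Int_absorb1)
  have O1: "openin (top_of_set (coords n)) (snd c ` S)"
    unfolding D by (rule dom_open[OF V(1) S(1)])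
  have "continuous_on (snd c ` S) (vol_dens c)"
    by (rule continuous_on_subset[OF vol_dens_continuous[OF V(1)]]) (use S(3) in blast)
  from continuous_openin_preimage_gen[OF this open_greaterThan[of \<delta>]]
  have "openin (top_of_set (coords n)) (snd c ` S \<inter> vol_dens c -` {\<delta><..})"
    by (rule openin_trans[OF _ O1])
  moreover have "y \<in> snd c ` S \<inter> vol_dens c -` {\<delta><..}"
    using S(2) \<open>\<delta> > 0\<close> by (simp add: y_def \<delta>_def)
  ultimately obtain e where e: "e > 0"
    "Pi\<^sub>E {..<n} (\<lambda>i. {y i - e..y i + e}) \<subseteq> snd c ` S \<inter> vol_dens c -` {\<delta><..}"
    by (rule coords_open_contains_box)
  let ?box = "Pi\<^sub>E {..<n} (\<lambda>i. {y i - e..y i + e})"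
  have "0 < ennreal (\<delta> * (\<Prod>i<n. (y i + e) - (y i - e)))"
    using \<open>\<delta> > 0\<close> e(1) by (simp add: prod_pos)
  also have "\<dots> = ennreal \<delta> * emeasure (Pi\<^sub>M {..<n} (\<lambda>_. lborel)) ?box"
    using \<open>\<delta> > 0\<close> e(1) by (subst emeasure_coord_box(1)) (simp_all add: ennreal_mult')
  also have "\<dots> = (\<integral>\<^sup>+ z. ennreal \<delta> * indicator ?box z \<partial>(Pi\<^sub>M {..<n} (\<lambda>_. lborel)))"
    by (rule nn_integral_cmult_indicator[symmetric]) (rule emeasure_coord_box(2), use e(1) in simp)
  also have "\<dots> \<le> (\<integral>\<^sup>+ z. ennreal (vol_dens c z) * indicator (snd c ` S) z \<partial>(Pi\<^sub>M {..<n} (\<lambda>_. lborel)))"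
  proof (rule nn_integral_mono)
    fix z
    show "ennreal \<delta> * indicator ?box z \<le> ennreal (vol_dens c z) * indicator (snd c ` S) z"
    proof (cases "z \<in> ?box")
      case True
      then have "z \<in> snd c ` S" "\<delta> < vol_dens c z" using e(2) by auto
      then show ?thesis by (simp add: indicator_def ennreal_leI)
    qed simp
  qed
  also have "\<dots> = emeasure \<mu> S" by (rule emeasure_vol[OF V(1) S(1,3), symmetric])
  also have "\<dots> \<le> emeasure \<mu> U"
    by (rule emeasure_mono) (use assms sets_vol in \<open>auto simp: S_def\<close>)
  finally show ?thesis .
qed

lemma continuous_bounded:
  fixes f :: "'m \<Rightarrow> 'b::real_normed_vector"
  assumes "continuous_on UNIV f"
  shows "bounded (range f)"
  using manifold assms by (intro compact_imp_bounded compact_continuous_image) (auto simp: closed_oriented_manifold_def)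

lemma continuous_integrable:
  fixes f :: "'m \<Rightarrow> 'b::{banach, second_countable_topology}"
  assumes "continuous_on UNIV f"
  shows "integrable \<mu> f"
proof -
  interpret finite_measure \<mu> by (rule finite_vol)
  obtain B where "\<And>x. norm (f x) \<le> B"
    using continuous_bounded[OF assms] unfolding bounded_iff by auto
  moreover have "f \<in> borel_measurable \<mu>"
    using borel_measurable_continuous_onI[OF assms] by (simp cong: measurable_cong_sets add: sets_vol)
  ultimately show ?thesis by (intro integrable_const_bound[of _ B]) auto
qed

text \<open>The set where f is nonzero is open and null, and nonempty open sets have positive
  volume. This upgrades vanishing almost everywhere to vanishing at every point.\<close>

lemma continuous_integral_eq_0:
  fixes f :: "'m \<Rightarrow> real"
  assumes f: "continuous_on UNIV f" "\<And>x. f x \<ge> 0" and 0: "(\<integral>x. f x \<partial>\<mu>) = 0"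
  shows "f x = 0"
proof (rule ccontr)
  assume "f x \<noteq> 0"
  have "AE x in \<mu>. f x = 0"
    using 0 f(2) integral_nonneg_eq_0_iff_AE[OF continuous_integrable[OF f(1)]] by simp
  then have "emeasure \<mu> {x \<in> space \<mu>. f x \<noteq> 0} = 0"
    using AE_iff_measurable[of "{x \<in> space \<mu>. f x \<noteq> 0}" \<mu> "\<lambda>x. f x = 0"] f(1)
    by (auto simp: space_vol sets_vol open_Collect_neq intro!: borel_open)
  moreover have "emeasure \<mu> {x. f x \<noteq> 0} > 0"
    using \<open>f x \<noteq> 0\<close> f(1) by (intro open_vol_pos[of _ x] open_Collect_neq) (auto intro: continuous_on_const)
  ultimately show False by (simp add: space_vol)
qed

end

section \<open>Differentiating the \<open>L\<^sup>2\<close> metric\<close>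

text \<open>On a finite measure space a uniform bound on the integrands bounds the integrals, for
  any filter.\<close>

lemma tendsto_integral_uniform_limit:
  fixes f :: "'q \<Rightarrow> 'a \<Rightarrow> 'b::{banach, second_countable_topology}"
  assumes "finite_measure M" and lim: "uniform_limit UNIV f l F"
    and f: "\<forall>\<^sub>F q in F. integrable M (f q)" and l: "integrable M l"
  shows "((\<lambda>q. \<integral>x. f q x \<partial>M) \<longlongrightarrow> (\<integral>x. l x \<partial>M)) F"
proof (rule tendstoI)
  interpret finite_measure M by fact
  fix e :: real assume e: "e > 0"
  \<comment> \<open>The total mass may be 0, hence the division by m + 1 below.\<close>
  define m where "m = measure M (space M)"
  have m: "m \<ge> 0" by (simp add: m_def)
  have e': "e / (m + 1) > 0" using e m by simp
  from uniform_limitD[OF lim this] f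
  show "\<forall>\<^sub>F q in F. dist (\<integral>x. f q x \<partial>M) (\<integral>x. l x \<partial>M) < e"
  proof eventually_elim
    case (elim q)
    have "norm ((\<integral>x. f q x \<partial>M) - (\<integral>x. l x \<partial>M)) = norm (\<integral>x. f q x - l x \<partial>M)"
      using elim(2) l by simp
    also have "\<dots> \<le> (\<integral>x. norm (f q x - l x) \<partial>M)"
      by (rule integral_norm_bound)
    also have "\<dots> \<le> (\<integral>x. e / (m + 1) \<partial>M)"
      by (rule integral_mono) (use elim l in \<open>auto simp: dist_norm intro: less_imp_le\<close>)
    also have "\<dots> = m * (e / (m + 1))" by (simp add: m_def)
    also have "\<dots> < e" using e m by (simp add: field_simps)
    finally show ?case by (simp add: dist_norm)
  qed
qed

lemma has_vector_derivative_at_0I: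
  fixes f :: "real \<Rightarrow> 'b::real_normed_vector"
  assumes "((\<lambda>t. (1 / t) *\<^sub>R (f t - f 0)) \<longlongrightarrow> D) (at 0)"
  shows "(f has_vector_derivative D) (at 0)"
  unfolding has_vector_derivative_def has_derivative_at
proof (intro conjI bounded_linear_scaleR_left)
  have "((\<lambda>t. norm ((1 / t) *\<^sub>R (f t - f 0) - D)) \<longlongrightarrow> 0) (at 0)"
    using assms by (intro tendsto_norm_zero) (simp add: LIM_zero)
  moreover have "\<forall>\<^sub>F t in at 0. norm ((1 / t) *\<^sub>R (f t - f 0) - D) = norm (f (0 + t) - f 0 - t *\<^sub>R D) / norm t"
  proof (rule eventually_mono[OF eventually_neq_at_within[of "0::real" 0 UNIV]])
    fix t :: real assume t: "t \<noteq> 0"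
    have "norm (f t - f 0 - t *\<^sub>R D) = norm (t *\<^sub>R ((1 / t) *\<^sub>R (f t - f 0) - D))"
      using t by (simp add: scaleR_diff_right)
    then show "norm ((1 / t) *\<^sub>R (f t - f 0) - D) = norm (f (0 + t) - f 0 - t *\<^sub>R D) / norm t"
      using t by simp
  qed
  ultimately show "(\<lambda>t. norm (f (0 + t) - f 0 - t *\<^sub>R D) / norm t) \<midarrow>0\<rightarrow> 0"
    by (rule Lim_transform_eventually)
qed

section \<open>Traces of h^-1 s and their dependence on h\<close>

context manifold_bundle
begin

definition form_trace :: "('m, 'v) form_field \<Rightarrow> ('m, 'v) form_field \<Rightarrow> 'm \<Rightarrow> complex" where
  "form_trace h s x = fibre_trace E x (endo_of E h s x)"

lemma form_trace_frame:
  assumes h: "h \<in> nondeg" and s: "s \<in> sesquis" and V: "(V, \<tau>) \<in> trivs E" "x \<in> V"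
  shows "form_trace h s x = cnj (trace (matrix_inv (form_matrix E x (\<tau> x) (h x)) ** form_matrix E x (\<tau> x) (s x)))"
proof -
  interpret framed_fibre E x "\<tau> x" by (rule framed[OF V])
  show ?thesis
    unfolding form_trace_def
    by (rule fibre_trace_endo_of[of h s, OF sesquisD[OF nondeg_sesquis[OF h]] sesquisD[OF s] nondeg_det[OF h V]])
qed

text \<open>Both parts of the integrand of the metric are thereby expressed by
  \<open>form_trace\<close>, so one continuity and one difference formula cover them.\<close>

lemma fibre_trace_comp:
  assumes h: "h \<in> nondeg" and v: "v \<in> sesquis" and w: "w \<in> sesquis"
  shows "fibre_trace E x (endo_of E h v x \<circ> endo_of E h w x) = form_trace h (form_mult E h v w) x"
proof -
  obtain c V \<tau> where V: "c \<in> A" "(V, \<tau>) \<in> trivs E" "x \<in> fst c" "x \<in> V" by (rule cover)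
  interpret framed_fibre E x "\<tau> x" by (rule framed[OF V(2,4)])
  show ?thesis
    using fibre_trace_endo_of_comp[of h v w, OF sesquisD[OF nondeg_sesquis[OF h]] sesquisD[OF v] sesquisD[OF w]
        nondeg_det[OF h V(2,4)]]
      form_trace_frame[OF h form_mult_sesquis[OF h v w] V(2,4)] form_matrix_form_mult[OF h v w V(2,4)]
    by (simp add: matrix_mul_assoc)
qed

lemma mat_lim_trace_matrix:
  assumes "sec_lim F h h0" "sec_lim F s s0" "\<forall>\<^sub>F q in F. h q \<in> nondeg" "h0 \<in> nondeg"
    and c: "c \<in> A" "(V, \<tau>) \<in> trivs E"
  shows "ck_lim k n (cdom c V) F (\<lambda>q y. trace (matrix_inv (local_matrix c \<tau> (h q) y) ** local_matrix c \<tau> (s q) y))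
     (\<lambda>y. trace (matrix_inv (local_matrix c \<tau> h0 y) ** local_matrix c \<tau> s0 y))"
proof -
  have W: "openin (top_of_set (coords n)) (cdom c V)" by (rule dom_open[OF c(1) triv_open[OF c(2)]])
  have nz: "det (local_matrix c \<tau> h y) \<noteq> 0" if "h \<in> nondeg" "y \<in> cdom c V" for h y
    unfolding local_matrix_def
    by (rule nondeg_det[OF that(1) c(2)]) (use chart_inv_in[OF that(2) c(1)] in simp)
  have "\<forall>\<^sub>F q in F. \<forall>y\<in>cdom c V. det (local_matrix c \<tau> (h q) y) \<noteq> 0"
    using assms(3) by eventually_elim (simp add: nz)
  then show ?thesis
    by (intro ck_lim_trace[OF W] mat_lim_mult[OF W] mat_lim_inv[OF W] sec_limD[OF assms(1) c]
      sec_limD[OF assms(2) c] nz[OF assms(4)])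
qed

text \<open>Local uniform limits of the trace of H^-1 S are glued over the compact manifold. The
  conjugation that relates this trace to \<open>form_trace\<close> preserves distances.\<close>

lemma uniform_limit_form_trace:
  assumes lim: "sec_lim F h h0" "sec_lim F s s0"
    and ev: "\<forall>\<^sub>F q in F. h q \<in> nondeg" "\<forall>\<^sub>F q in F. s q \<in> sesquis" and "h0 \<in> nondeg" "s0 \<in> sesquis"
  shows "uniform_limit UNIV (\<lambda>q. form_trace (h q) (s q)) (form_trace h0 s0) F"
proof (rule uniform_limitI)
  fix e :: real assume e: "e > 0"
  have "\<forall>\<^sub>F q in F. \<forall>x. dist (form_trace (h q) (s q) x) (form_trace h0 s0 x) < e"
  proof (rule eventually_everywhere)
    fix x
    obtain c V \<tau> N K where V: "c \<in> A" "(V, \<tau>) \<in> trivs E" and N: "open N" "x \<in> N" "N \<subseteq> fst c \<inter> V"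
      and K: "compact K" "K \<subseteq> cdom c V" "snd c ` N \<subseteq> K"
      by (rule compact_nbhd)
    let ?T = "\<lambda>h s y. trace (matrix_inv (local_matrix c \<tau> h y) ** local_matrix c \<tau> s y)"
    have tr: "form_trace h s y = cnj (?T h s (snd c y))" if "h \<in> nondeg" "s \<in> sesquis" "y \<in> N" for h s y
    proof -
      have "y \<in> V" "chart_inv c (snd c y) = y"
        using that(3) N(3) chart_inv_chart[OF V(1)] by auto
      then show ?thesis using form_trace_frame[OF that(1,2) V(2)] by (simp add: local_matrix_def)
    qed
    have "uniform_limit K (\<lambda>q y. ?T (h q) (s q) y) (?T h0 s0) F"
      using mat_lim_trace_matrix[OF lim ev(1) assms(5) V, of 0] K by simp
    from uniform_limitD[OF this e] ev
    have "\<forall>\<^sub>F q in F. \<forall>y\<in>N. dist (form_trace (h q) (s q) y) (form_trace h0 s0 y) < e"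
    proof eventually_elim
      case (elim q)
      show ?case
      proof
        fix y assume y: "y \<in> N"
        then have "snd c y \<in> K" using K(3) by blast
        then have "dist (?T (h q) (s q) (snd c y)) (?T h0 s0 (snd c y)) < e" using elim(1) by blast
        then show "dist (form_trace (h q) (s q) y) (form_trace h0 s0 y) < e"
          unfolding tr[OF elim(2,3) y] tr[OF assms(5,6) y] dist_norm complex_cnj_diff[symmetric] complex_mod_cnj .
      qed
    qed
    with N show "\<exists>N. open N \<and> x \<in> N \<and> (\<forall>\<^sub>F q in F. \<forall>y\<in>N. dist (form_trace (h q) (s q) y) (form_trace h0 s0 y) < e)"
      by blast
  qed
  then show "\<forall>\<^sub>F q in F. \<forall>x\<in>UNIV. dist (form_trace (h q) (s q) x) (form_trace h0 s0 x) < e" by simp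
qed

lemma continuous_on_locally:
  fixes f :: "'m \<Rightarrow> 'b::topological_space"
  assumes "\<And>x. \<exists>N. open N \<and> x \<in> N \<and> continuous_on N f"
  shows "continuous_on UNIV f"
  using assms continuous_on_eq_continuous_at continuous_at_imp_continuous_on by blast

lemma continuous_chart:
  assumes "c \<in> A"
  shows "continuous_on (fst c) (snd c)"
  using chart[OF assms] by (simp add: is_chart_def homeomorphism_def)

lemma continuous_form_trace:
  assumes h: "h \<in> pos_herms" and s: "s \<in> sections"
  shows "continuous_on UNIV (form_trace h s)"
proof (rule continuous_on_locally)
  fix x
  obtain c V \<tau> where V: "c \<in> A" "(V, \<tau>) \<in> trivs E" "x \<in> fst c" "x \<in> V" by (rule cover)
  let ?N = "fst c \<inter> V"
  let ?T = "\<lambda>y. trace (matrix_inv (local_matrix c \<tau> h y) ** local_matrix c \<tau> s y)"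
  have "ck_lim 0 n (cdom c V) sequentially (\<lambda>_. ?T) ?T"
    by (rule mat_lim_trace_matrix[OF _ _ _ _ V(1,2)])
      (simp_all add: sec_lim_const s herms_sections[OF pos_herms_herms[OF h]] pos_herms_nondeg[OF h])
  then have "continuous_on (cdom c V) ?T" by simp
  moreover have "continuous_on ?N (snd c)"
    by (rule continuous_on_subset[OF continuous_chart[OF V(1)]]) simp
  ultimately have "continuous_on ?N (\<lambda>y. cnj (?T (snd c y)))"
    by (intro continuous_on_cnj) (rule continuous_on_compose2[of "cdom c V"], auto)
  moreover have "cnj (?T (snd c y)) = form_trace h s y" if "y \<in> ?N" for y
    using form_trace_frame[OF pos_herms_nondeg[OF h] sections_sesquis[OF s] V(2), of y] that
      chart_inv_chart[OF V(1), of y]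
    by (simp add: local_matrix_def)
  ultimately have "continuous_on ?N (form_trace h s)"
    by (rule continuous_on_eq)
  moreover have "open ?N"
    using chart[OF V(1)] triv_open[OF V(2)] by (auto simp: is_chart_def)
  ultimately show "\<exists>N. open N \<and> x \<in> N \<and> continuous_on N (form_trace h s)"
    using V(3,4) by blast
qed

lemma form_mult_assoc:
  assumes "h \<in> nondeg" "k \<in> nondeg" "a \<in> sesquis" "b \<in> sesquis" "c \<in> sesquis"
  shows "form_mult E h a (form_mult E k b c) = form_mult E k (form_mult E h a b) c"
proof (rule sesquis_eqI)
  show "form_mult E h a (form_mult E k b c) \<in> sesquis" "form_mult E k (form_mult E h a b) c \<in> sesquis"
    by (intro form_mult_sesquis assms)+
  fix V \<tau> x assume V: "(V, \<tau>) \<in> trivs E" "x \<in> V"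
  show "form_matrix E x (\<tau> x) (form_mult E h a (form_mult E k b c) x) =
      form_matrix E x (\<tau> x) (form_mult E k (form_mult E h a b) c x)"
    using form_matrix_form_mult[OF assms(1,3) form_mult_sesquis[OF assms(2,4,5)] V]
      form_matrix_form_mult[OF assms(2) form_mult_sesquis[OF assms(1,3,4)] assms(5) V]
      form_matrix_form_mult[OF assms(1,3,4) V] form_matrix_form_mult[OF assms(2,4,5) V]
    by (simp add: matrix_mul_assoc)
qed

text \<open>Cyclicity with two base points: both sides are the trace of h^-1 a k^-1 b. The outer and
  the inner inverse exchange roles, so a formula that moves the outer one can also be used for the
  inner one.\<close>

lemma form_trace_mult_comm:
  assumes "h \<in> nondeg" "k \<in> nondeg" "a \<in> sesquis" "b \<in> sesquis"
  shows "form_trace h (form_mult E k a b) x = form_trace k (form_mult E h b a) x"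
proof -
  obtain c V \<tau> where V: "c \<in> A" "(V, \<tau>) \<in> trivs E" "x \<in> fst c" "x \<in> V" by (rule cover)
  let ?F = "\<lambda>s. form_matrix E x (\<tau> x) (s x)"
  have "trace ((matrix_inv (?F h) ** ?F a) ** (matrix_inv (?F k) ** ?F b)) =
      trace ((matrix_inv (?F k) ** ?F b) ** (matrix_inv (?F h) ** ?F a))"
    by (rule trace_mul_sym)
  then show ?thesis
    using form_trace_frame[OF assms(1) form_mult_sesquis[OF assms(2,3,4)] V(2,4)]
      form_trace_frame[OF assms(2) form_mult_sesquis[OF assms(1,4,3)] V(2,4)]
      form_matrix_form_mult[OF assms(2,3,4) V(2,4)] form_matrix_form_mult[OF assms(1,4,3) V(2,4)]
    by (simp add: matrix_mul_assoc)
qed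

text \<open>The resolvent identity multiplied by s and traced. It is exact in t, so the derivative
  needs only continuity of the coefficient of t.\<close>

lemma form_trace_line:
  assumes h: "h \<in> nondeg" "h + t *\<^sub>R l \<in> nondeg" and s: "l \<in> sesquis" "s \<in> sesquis"
  shows "form_trace (h + t *\<^sub>R l) s x = form_trace h s x - of_real t * form_trace (h + t *\<^sub>R l) (form_mult E h l s) x"
proof -
  obtain c V \<tau> where V: "c \<in> A" "(V, \<tau>) \<in> trivs E" "x \<in> fst c" "x \<in> V" by (rule cover)
  let ?F = "\<lambda>s. form_matrix E x (\<tau> x) (s x)"
  let ?K = "matrix_inv (?F h)" and ?K' = "matrix_inv (?F (h + t *\<^sub>R l))"
  have F: "?F (h + t *\<^sub>R l) = ?F h + t *\<^sub>R ?F l"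
    by (simp add: form_matrix_def vec_eq_iff scaleR_fun_def)
  have "t *\<^sub>R (?K' ** (?F l ** ?K)) = ?K - ?K'"
    using matrix_inv_resolvent[OF nondeg_det[OF h(1) V(2,4)] nondeg_det[OF h(2) V(2,4), unfolded F]]
    unfolding F by (simp add: matrix_scaleR_mult)
  then have "t *\<^sub>R (?K' ** (?F l ** ?K)) ** ?F s = (?K - ?K') ** ?F s" by simp
  then have "t *\<^sub>R (?K' ** (?F l ** ?K ** ?F s)) = ?K ** ?F s - ?K' ** ?F s"
    by (simp add: matrix_scaleR_mult matrix_sub_distrib matrix_mul_assoc)
  then have "trace (t *\<^sub>R (?K' ** (?F l ** ?K ** ?F s))) = trace (?K ** ?F s) - trace (?K' ** ?F s)"
    by (simp add: trace_sub)
  moreover have "trace (t *\<^sub>R M) = of_real t * trace M" for M :: "complex^'r^'r"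
    by (simp add: trace_def scaleR_conv_of_real[where 'a = complex] sum_distrib_left)
  ultimately have "trace (?K' ** ?F s) = trace (?K ** ?F s) - of_real t * trace (?K' ** (?F l ** ?K ** ?F s))"
    by simp
  then show ?thesis
    using form_trace_frame[OF h(1) s(2) V(2,4)] form_trace_frame[OF h(2) s(2) V(2,4)]
      form_trace_frame[OF h(2) form_mult_sesquis[OF h(1) s] V(2,4)] form_matrix_form_mult[OF h(1) s V(2,4)]
    by simp
qed

lemma form_trace_diff:
  assumes "h \<in> nondeg" "s \<in> sesquis" "t \<in> sesquis" "s - t \<in> sesquis"
  shows "form_trace h (s - t) x = form_trace h s x - form_trace h t x"
proof -
  obtain c V \<tau> where V: "c \<in> A" "(V, \<tau>) \<in> trivs E" "x \<in> fst c" "x \<in> V" by (rule cover)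
  have "form_matrix E x (\<tau> x) ((s - t) x) = form_matrix E x (\<tau> x) (s x) - form_matrix E x (\<tau> x) (t x)"
    by (simp add: form_matrix_def vec_eq_iff)
  then show ?thesis
    using form_trace_frame[OF assms(1,2) V(2,4)] form_trace_frame[OF assms(1,3) V(2,4)]
      form_trace_frame[OF assms(1,4) V(2,4)]
    by (simp add: matrix_sub_distrib trace_sub)
qed

end

section \<open>The integrand of the metric and its derivative\<close>

context riemannian_bundle
begin

definition integrand ::
    "('m, 'v) form_field \<Rightarrow> ('m, 'v) form_field \<Rightarrow> ('m, 'v) form_field \<Rightarrow> 'm \<Rightarrow> complex" where
  "integrand h v w x =
     form_trace h (form_mult E h v w) x + of_real (\<alpha> x) * form_trace h v x * form_trace h w x"

text \<open>Each h^-1 in the integrand is replaced in turn by - h^-1 l h^-1. The second trace, with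
  w and v exchanged, comes from the inner inverse after a cyclic rotation.\<close>

definition integrand_deriv ::
    "('m, 'v) form_field \<Rightarrow> ('m, 'v) form_field \<Rightarrow> ('m, 'v) form_field \<Rightarrow> ('m, 'v) form_field \<Rightarrow> 'm \<Rightarrow> complex" where
  "integrand_deriv h l v w x =
     - (form_trace h (form_mult E h l (form_mult E h v w)) x + form_trace h (form_mult E h l (form_mult E h w v)) x)
     - of_real (\<alpha> x) * (form_trace h (form_mult E h l v) x * form_trace h w x
        + form_trace h v x * form_trace h (form_mult E h l w) x)"

lemma L2_metric_eq:
  assumes "h \<in> nondeg" "v \<in> sesquis" "w \<in> sesquis"
  shows "L2_metric E \<mu> \<alpha> h v w = (\<integral>x. integrand h v w x \<partial>\<mu>)"
  unfolding L2_metric_def integrand_def fibre_trace_comp[OF assms] form_trace_def ..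

lemma alpha_continuous: "continuous_on UNIV \<alpha>"
proof (rule continuous_on_locally)
  fix x
  obtain c V \<tau> where V: "c \<in> A" "(V, \<tau>) \<in> trivs E" "x \<in> fst c" "x \<in> V" by (rule cover)
  have "continuous_on (snd c ` fst c) (\<lambda>y. \<alpha> (chart_inv c y))"
    by (rule smooth_fun_onD(1)[where n = n]) (use smooth_alpha V(1) in \<open>simp add: smooth_scalar_def\<close>)
  then have "continuous_on (fst c) (\<lambda>y. \<alpha> (chart_inv c (snd c y)))"
    by (rule continuous_on_compose2[OF _ continuous_chart[OF V(1)]]) auto
  then have "continuous_on (fst c) \<alpha>"
    by (rule continuous_on_eq) (simp add: chart_inv_chart[OF V(1)])
  moreover have "open (fst c)" using chart[OF V(1)] by (simp add: is_chart_def)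
  ultimately show "\<exists>N. open N \<and> x \<in> N \<and> continuous_on N \<alpha>" using V(3) by blast
qed

lemma integrand_continuous:
  assumes "h \<in> pos_herms" "v \<in> sections" "w \<in> sections"
  shows "continuous_on UNIV (integrand h v w)"
  unfolding integrand_def
  by (intro continuous_on_add continuous_on_mult continuous_on_of_real alpha_continuous
      continuous_form_trace form_mult_sections assms)

lemma integrand_deriv_continuous:
  assumes "h \<in> pos_herms" "l \<in> sections" "v \<in> sections" "w \<in> sections"
  shows "continuous_on UNIV (integrand_deriv h l v w)"
  unfolding integrand_deriv_def
  by (intro continuous_on_add continuous_on_diff continuous_on_minus continuous_on_mult continuous_on_of_real
      alpha_continuous continuous_form_trace form_mult_sections assms)

text \<open>The base point is moved in one inverse at a time by \<open>form_trace_line\<close>. Both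
  sides agree exactly; they still contain h + t l, whose limit is taken later, uniformly on the
  manifold.\<close>

lemma integrand_diff_quotient:
  assumes h: "h \<in> nondeg" "h + t *\<^sub>R l \<in> nondeg" and "t \<noteq> 0"
    and s: "l \<in> sesquis" "v \<in> sesquis" "w \<in> sesquis"
  shows "(1 / t) *\<^sub>R (integrand (h + t *\<^sub>R l) v w x - integrand h v w x) =
    - (form_trace (h + t *\<^sub>R l) (form_mult E h l (form_mult E (h + t *\<^sub>R l) v w)) x
       + form_trace (h + t *\<^sub>R l) (form_mult E h l (form_mult E h w v)) x)
    - of_real (\<alpha> x) * (form_trace (h + t *\<^sub>R l) (form_mult E h l v) x * form_trace (h + t *\<^sub>R l) w x
       + form_trace h v x * form_trace (h + t *\<^sub>R l) (form_mult E h l w) x)"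
    (is "_ = - (?A + ?B) - _ * (?C * ?w' + ?v * ?D)")
proof -
  let ?h = "h + t *\<^sub>R l"
  \<comment> \<open>First the outer inverse moves from h + t l to h. Cyclicity then brings the inner
    one outside, it moves in the same way, and cyclicity restores the order of v and w.\<close>
  have 1: "form_trace ?h (form_mult E ?h v w) x = form_trace h (form_mult E ?h v w) x - of_real t * ?A"
    by (rule form_trace_line[OF h s(1) form_mult_sesquis[OF h(2) s(2,3)]])
  have "form_trace h (form_mult E ?h v w) x = form_trace ?h (form_mult E h w v) x"
    by (rule form_trace_mult_comm[OF h s(2,3)])
  also have "\<dots> = form_trace h (form_mult E h w v) x - of_real t * ?B"
    by (rule form_trace_line[OF h s(1) form_mult_sesquis[OF h(1) s(3,2)]])
  also have "form_trace h (form_mult E h w v) x = form_trace h (form_mult E h v w) x"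
    by (rule form_trace_mult_comm[OF h(1,1) s(3,2)])
  finally have 2: "form_trace h (form_mult E ?h v w) x = form_trace h (form_mult E h v w) x - of_real t * ?B" .
  have 3: "form_trace ?h v x = ?v - of_real t * ?C" "?w' = form_trace h w x - of_real t * ?D"
    by (rule form_trace_line[OF h s(1,2)], rule form_trace_line[OF h s(1,3)])
  have w: "form_trace h w x = ?w' + of_real t * ?D" using 3(2) by simp
  have "integrand ?h v w x - integrand h v w x =
      of_real t * (- (?A + ?B) - of_real (\<alpha> x) * (?C * ?w' + ?v * ?D))"
    unfolding integrand_def 1 2 3(1) w by (simp add: algebra_simps)
  then show ?thesis
    using \<open>t \<noteq> 0\<close> by (simp add: scaleR_conv_of_real)
qed

text \<open>The formula for the difference quotient is a polynomial in traces and \<alpha>. Products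
  of uniform limits require bounded limits, which continuity on the compact manifold
  provides.\<close>

lemma uniform_limit_integrand:
  assumes h: "h \<in> pos_herms" and l: "l \<in> herms" and v: "v \<in> sections" and w: "w \<in> sections"
  shows "uniform_limit UNIV (\<lambda>t x. (1 / t) *\<^sub>R (integrand (h + t *\<^sub>R l) v w x - integrand h v w x))
    (integrand_deriv h l v w) (at (0::real))"
proof -
  let ?h = "\<lambda>t::real. h + t *\<^sub>R l"
  have hs: "h \<in> sections" "l \<in> sections"
    using h l by (auto intro: herms_sections pos_herms_herms)
  note sq = sections_sesquis[OF hs(2)] sections_sesquis[OF v] sections_sesquis[OF w]
  note hn0 = pos_herms_nondeg[OF h]
  have hn: "\<forall>\<^sub>F t in at 0. ?h t \<in> nondeg"
    using pos_herms_line[OF h l] by (rule eventually_mono) (rule pos_herms_nondeg)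
  note hl = sec_lim_line[OF hs]
  have lim: "uniform_limit UNIV (\<lambda>t. form_trace (?h t) (s t)) (form_trace h s0) (at 0)"
    if "sec_lim (at 0) s s0" "\<forall>\<^sub>F t in at 0. s t \<in> sesquis" "s0 \<in> sesquis" for s s0
    by (rule uniform_limit_form_trace[OF hl that(1) hn that(2) hn0 that(3)])
  have limc: "uniform_limit UNIV (\<lambda>t. form_trace (?h t) s) (form_trace h s) (at 0)" if "s \<in> sections" for s
    by (rule lim) (simp_all add: sec_lim_const that sections_sesquis)
  have ev1: "\<forall>\<^sub>F t in at 0. form_mult E (?h t) v w \<in> sesquis"
    using hn by eventually_elim (intro form_mult_sesquis sq)
  then have ev2: "\<forall>\<^sub>F t in at 0. form_mult E h l (form_mult E (?h t) v w) \<in> sesquis"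
    by eventually_elim (rule form_mult_sesquis[OF hn0 sq(1)])
  have "sec_lim (at 0) (\<lambda>t. form_mult E (?h t) v w) (form_mult E h v w)"
    by (rule sec_lim_form_mult[OF hl sec_lim_const[OF v] sec_lim_const[OF w] hn _ _ hn0 sq(2,3)])
      (simp_all add: sq)
  from sec_lim_form_mult[OF sec_lim_const[OF hs(1)] sec_lim_const[OF hs(2)] this _ _ ev1 hn0 sq(1)
      form_mult_sesquis[OF hn0 sq(2,3)]]
  have L: "sec_lim (at 0) (\<lambda>t. form_mult E h l (form_mult E (?h t) v w)) (form_mult E h l (form_mult E h v w))"
    by (simp add: sq hn0)
  have b: "bounded (range (form_trace h s))" if "s \<in> sections" for s
    by (rule continuous_bounded[OF continuous_form_trace[OF h that]])
  have bp: "bounded (range (\<lambda>x. form_trace h s x * form_trace h s' x))" if "s \<in> sections" "s' \<in> sections" for s s'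
    by (rule continuous_bounded) (intro continuous_on_mult continuous_form_trace h that)
  have m: "form_mult E h l v \<in> sections" "form_mult E h l w \<in> sections" "form_mult E h l (form_mult E h w v) \<in> sections"
    by (intro form_mult_sections h hs v w)+
  have cont: "continuous_on UNIV (\<lambda>x. form_trace h (form_mult E h l v) x * form_trace h w x
        + form_trace h v x * form_trace h (form_mult E h l w) x)"
    by (intro continuous_on_add continuous_on_mult continuous_form_trace h v w m)
  have "uniform_limit UNIV (\<lambda>t x. - (form_trace (?h t) (form_mult E h l (form_mult E (?h t) v w)) x
       + form_trace (?h t) (form_mult E h l (form_mult E h w v)) x)
    - of_real (\<alpha> x) * (form_trace (?h t) (form_mult E h l v) x * form_trace (?h t) w x
       + form_trace h v x * form_trace (?h t) (form_mult E h l w) x)) (integrand_deriv h l v w) (at 0)"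
    unfolding integrand_deriv_def
  proof (intro uniform_limit_minus uniform_limit_uminus uniform_limit_add uniform_lim_mult uniform_limit_const)
    show "uniform_limit UNIV (\<lambda>t. form_trace (?h t) (form_mult E h l (form_mult E (?h t) v w)))
        (form_trace h (form_mult E h l (form_mult E h v w))) (at 0)"
      by (rule lim[OF L ev2]) (intro form_mult_sesquis hn0 sq)
  qed (intro limc b bp m v w continuous_bounded[OF cont]
    continuous_bounded[OF continuous_on_of_real[OF alpha_continuous]])+
  then show ?thesis
  proof (rule uniform_limit_cong[THEN iffD1, rotated 2])
    have "\<forall>\<^sub>F t in at (0::real). t \<noteq> 0" by (rule eventually_neq_at_within)
    with hn show "\<forall>\<^sub>F t in at 0. \<forall>x\<in>UNIV. - (form_trace (?h t) (form_mult E h l (form_mult E (?h t) v w)) x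
       + form_trace (?h t) (form_mult E h l (form_mult E h w v)) x)
    - of_real (\<alpha> x) * (form_trace (?h t) (form_mult E h l v) x * form_trace (?h t) w x
       + form_trace h v x * form_trace (?h t) (form_mult E h l w) x) =
      (1 / t) *\<^sub>R (integrand (h + t *\<^sub>R l) v w x - integrand h v w x)"
    proof eventually_elim
      case (elim t)
      show ?case
        by (intro ballI) (rule integrand_diff_quotient[OF hn0 elim(1,2) sq, symmetric])
    qed
  qed simp
qed

lemma L2_metric_derivative:
  assumes h: "h \<in> pos_herms" and l: "l \<in> herms" and v: "v \<in> sections" and w: "w \<in> sections"
  shows "((\<lambda>t. L2_metric E \<mu> \<alpha> (h + t *\<^sub>R l) v w) has_vector_derivative
    (\<integral>x. integrand_deriv h l v w x \<partial>\<mu>)) (at 0)"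
proof (rule has_vector_derivative_at_0I)
  let ?q = "\<lambda>t x. (1 / t) *\<^sub>R (integrand (h + t *\<^sub>R l) v w x - integrand h v w x)"
  note sq = sections_sesquis[OF v] sections_sesquis[OF w]
  note hp = pos_herms_line[OF h l]
  have i: "integrable \<mu> (integrand k v w)" if "k \<in> pos_herms" for k
    by (rule continuous_integrable[OF integrand_continuous[OF that v w]])
  have ev: "\<forall>\<^sub>F t in at 0. integrable \<mu> (?q t)"
    using hp by eventually_elim (intro integrable_scaleR_right Bochner_Integration.integrable_diff i h)
  have "((\<lambda>t. \<integral>x. ?q t x \<partial>\<mu>) \<longlongrightarrow> (\<integral>x. integrand_deriv h l v w x \<partial>\<mu>)) (at 0)"
    by (rule tendsto_integral_uniform_limit[OF finite_vol uniform_limit_integrand[OF assms] ev])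
      (rule continuous_integrable[OF integrand_deriv_continuous[OF h herms_sections[OF l] v w]])
  then show "((\<lambda>t. (1 / t) *\<^sub>R (L2_metric E \<mu> \<alpha> (h + t *\<^sub>R l) v w - L2_metric E \<mu> \<alpha> (h + 0 *\<^sub>R l) v w))
      \<longlongrightarrow> (\<integral>x. integrand_deriv h l v w x \<partial>\<mu>)) (at 0)"
  proof (rule Lim_transform_eventually)
    show "\<forall>\<^sub>F t in at 0. (\<integral>x. ?q t x \<partial>\<mu>) =
        (1 / t) *\<^sub>R (L2_metric E \<mu> \<alpha> (h + t *\<^sub>R l) v w - L2_metric E \<mu> \<alpha> (h + 0 *\<^sub>R l) v w)"
      using hp
    proof eventually_elim
      case (elim t)
      have "L2_metric E \<mu> \<alpha> (h + 0 *\<^sub>R l) v w = (\<integral>x. integrand h v w x \<partial>\<mu>)"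
        using L2_metric_eq[OF pos_herms_nondeg[OF h] sq] by simp
      then show ?case
        unfolding L2_metric_eq[OF pos_herms_nondeg[OF elim] sq]
        using i[OF elim] i[OF h] by (simp add: Bochner_Integration.integral_diff)
    qed
  qed
qed

text \<open>With V = h^-1 v and L = h^-1 l, half the derivative along l is - tr (L V^2) - \<alpha>
  tr (L V) tr V, and the derivative along v is - 2 tr (V^2 L) - \<alpha> (tr (V^2) tr L + tr V tr (V
  L)). In the difference the mixed terms cancel and tr (V^2 L) + \<alpha> tr (V^2) tr L is left, the
  integrand for v h^-1 v and l; so \<alpha> does not enter the spray.\<close>

lemma integrand_spray:
  assumes h: "h \<in> nondeg" and s: "v \<in> sesquis" "l \<in> sesquis"
  shows "integrand h (form_mult E h v v) l x =
    (1 / 2) *\<^sub>R integrand_deriv h l v v x - integrand_deriv h v v l x"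
proof -
  let ?m = "form_mult E h" and ?t = "\<lambda>s. form_trace h s x"
  note c = form_trace_mult_comm[OF h h] and a = form_mult_assoc[OF h h] and m = form_mult_sesquis[OF h]
  have 1: "?t (?m l (?m v v)) = ?t (?m (?m v v) l)"
    by (rule c[OF s(2) m[OF s(1,1)]])
  have 2: "?t (?m v (?m v l)) = ?t (?m (?m v v) l)"
    by (simp only: a[OF s(1,1,2)])
  have 3: "?t (?m v (?m l v)) = ?t (?m (?m v v) l)"
    using c[OF s(1) m[OF s(2,1)], of x] 1 by (simp only: a[OF s(2,1,1)])
  have 4: "?t (?m l v) = ?t (?m v l)"
    by (rule c[OF s(2,1)])
  show ?thesis
    unfolding integrand_def integrand_deriv_def 1 2 3 4
    by (simp add: scaleR_conv_of_real algebra_simps)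
qed

lemma L2_metric_spray:
  assumes h: "h \<in> pos_herms" and v: "v \<in> herms" and l: "l \<in> herms"
  shows "L2_metric E \<mu> \<alpha> h (spray h v v) l =
    (1 / 2) *\<^sub>R (\<integral>x. integrand_deriv h l v v x \<partial>\<mu>) - (\<integral>x. integrand_deriv h v v l x \<partial>\<mu>)"
proof -
  note hn = pos_herms_nondeg[OF h] and vs = herms_sections[OF v] and ls = herms_sections[OF l]
  note sq = sections_sesquis[OF vs] sections_sesquis[OF ls]
  have "spray h v v = form_mult E h v v"
    unfolding spray_def scaleR_add_left[symmetric] by simp
  then have "L2_metric E \<mu> \<alpha> h (spray h v v) l = (\<integral>x. integrand h (form_mult E h v v) l x \<partial>\<mu>)"
    using L2_metric_eq[OF hn form_mult_sesquis[OF hn sq(1,1)] sq(2)] by simp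
  also have "\<dots> = (\<integral>x. (1 / 2) *\<^sub>R integrand_deriv h l v v x - integrand_deriv h v v l x \<partial>\<mu>)"
    by (simp only: integrand_spray[OF hn sq])
  also have "\<dots> = (1 / 2) *\<^sub>R (\<integral>x. integrand_deriv h l v v x \<partial>\<mu>) - (\<integral>x. integrand_deriv h v v l x \<partial>\<mu>)"
    using continuous_integrable[OF integrand_deriv_continuous[OF h ls vs vs]]
      continuous_integrable[OF integrand_deriv_continuous[OF h vs vs ls]]
    by (simp add: Bochner_Integration.integral_diff)
  finally show ?thesis .
qed

section \<open>Definiteness of the metric and uniqueness of the spray\<close>

lemma integrand_pos:
  assumes h: "h \<in> pos_herms" and d: "d \<in> herms"
  shows "\<exists>s\<ge>0. integrand h d d x = of_real s \<and> (s = 0 \<longrightarrow>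
    (\<forall>(V, \<tau>)\<in>trivs E. x \<in> V \<longrightarrow> form_matrix E x (\<tau> x) (d x) = 0))"
proof -
  note hn = pos_herms_nondeg[OF h] and ds = sections_sesquis[OF herms_sections[OF d]]
  have *: "\<exists>s\<ge>0. integrand h d d x = of_real s \<and> (s = 0 \<longrightarrow> form_matrix E x (\<tau> x) (d x) = 0)"
    if V: "(V, \<tau>) \<in> trivs E" "x \<in> V" for V \<tau>
  proof -
    let ?H = "form_matrix E x (\<tau> x) (h x)" and ?S = "form_matrix E x (\<tau> x) (d x)"
    obtain s where s: "trace ((matrix_inv ?H ** ?S) ** (matrix_inv ?H ** ?S))
        + of_real (\<alpha> x) * trace (matrix_inv ?H ** ?S) * trace (matrix_inv ?H ** ?S) = of_real s"
      "s \<ge> 0" "s = 0 \<longleftrightarrow> ?S = 0"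
      by (rule trace_form_posdef[OF pos_herms_posdef[OF h V] form_matrix_hermitian_section[OF d V] alpha_gt[of x]])
    have "integrand h d d x = cnj (of_real s)"
      unfolding s(1)[symmetric] integrand_def form_trace_frame[OF hn ds V]
        form_trace_frame[OF hn form_mult_sesquis[OF hn ds ds] V] form_matrix_form_mult[OF hn ds ds V]
      by (simp add: matrix_mul_assoc)
    with s(2,3) show ?thesis by auto
  qed
  obtain c V \<tau> where V: "c \<in> A" "(V, \<tau>) \<in> trivs E" "x \<in> fst c" "x \<in> V" by (rule cover)
  obtain s where s: "s \<ge> 0" "integrand h d d x = of_real s" using *[OF V(2,4)] by blast
  \<comment> \<open>The value s is that of the integrand and hence the same for all frames at x, so
    s = 0 makes the matrix vanish in each of them.\<close>
  have "form_matrix E x (\<tau>' x) (d x) = 0" if "s = 0" "(V', \<tau>') \<in> trivs E" "x \<in> V'" for V' \<tau>'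
    using *[OF that(2,3)] s(2) that(1) by auto
  with s show ?thesis by blast
qed

text \<open>\<open>L2_metric\<close> is a complex integral; the positivity argument runs on the real
  part of the integrand, which is all of it by \<open>integrand_pos\<close>.\<close>

lemma L2_metric_nondegenerate:
  assumes h: "h \<in> pos_herms" and d: "d \<in> herms" and 0: "L2_metric E \<mu> \<alpha> h d d = 0"
  shows "d = 0"
proof (rule sesquis_eqI)
  note ds = herms_sections[OF d]
  note c = integrand_continuous[OF h ds ds]
  show "d \<in> sesquis" "0 \<in> sesquis" by (rule sections_sesquis[OF ds], rule sesquis_closed)
  have "(\<integral>x. Re (integrand h d d x) \<partial>\<mu>) = Re (\<integral>x. integrand h d d x \<partial>\<mu>)"
    by (rule integral_Re[OF continuous_integrable[OF c]])
  also have "\<dots> = 0"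
    using 0 L2_metric_eq[OF pos_herms_nondeg[OF h] sections_sesquis[OF ds] sections_sesquis[OF ds]] by simp
  finally have I: "(\<integral>x. Re (integrand h d d x) \<partial>\<mu>) = 0" .
  have nn: "Re (integrand h d d x) \<ge> 0" for x
    using integrand_pos[OF h d, of x] by auto
  have R: "Re (integrand h d d x) = 0" for x
    by (rule continuous_integral_eq_0[OF continuous_on_Re[OF c] nn I])
  fix V \<tau> x assume V: "(V, \<tau>) \<in> trivs E" "x \<in> V"
  have "form_matrix E x (\<tau> x) (d x) = 0"
    using integrand_pos[OF h d, of x] R[of x] V by fastforce
  then show "form_matrix E x (\<tau> x) (d x) = form_matrix E x (\<tau> x) (0 x)"
    by (simp add: form_matrix_def vec_eq_iff)
qed

lemma L2_metric_diff:
  assumes h: "h \<in> pos_herms" and a: "a \<in> herms" "b \<in> herms" and l: "l \<in> herms"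
  shows "L2_metric E \<mu> \<alpha> h (a - b) l = L2_metric E \<mu> \<alpha> h a l - L2_metric E \<mu> \<alpha> h b l"
proof -
  note hn = pos_herms_nondeg[OF h]
  note S = herms_sections[OF a(1)] herms_sections[OF a(2)] herms_sections[OF herms_diff[OF a]] herms_sections[OF l]
  note sq = S[THEN sections_sesquis]
  have m: "form_trace h (form_mult E h (a - b) l) x =
      form_trace h (form_mult E h a l) x - form_trace h (form_mult E h b l) x" for x
  proof -
    obtain c V \<tau> where V: "c \<in> A" "(V, \<tau>) \<in> trivs E" "x \<in> fst c" "x \<in> V" by (rule cover)
    have "form_matrix E x (\<tau> x) ((a - b) x) = form_matrix E x (\<tau> x) (a x) - form_matrix E x (\<tau> x) (b x)"
      by (simp add: form_matrix_def vec_eq_iff)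
    then show ?thesis
      using form_trace_frame[OF hn form_mult_sesquis[OF hn sq(1,4)] V(2,4)]
        form_trace_frame[OF hn form_mult_sesquis[OF hn sq(2,4)] V(2,4)]
        form_trace_frame[OF hn form_mult_sesquis[OF hn sq(3,4)] V(2,4)]
        form_matrix_form_mult[OF hn sq(1,4) V(2,4)] form_matrix_form_mult[OF hn sq(2,4) V(2,4)]
        form_matrix_form_mult[OF hn sq(3,4) V(2,4)]
      by (simp only: matrix_sub_distrib trace_sub complex_cnj_diff)
  qed
  have "integrand h (a - b) l = (\<lambda>x. integrand h a l x - integrand h b l x)"
    unfolding integrand_def m form_trace_diff[OF hn sq(1,2,3)] by (simp add: algebra_simps)
  moreover have "integrable \<mu> (integrand h a l)" "integrable \<mu> (integrand h b l)"
    by (intro continuous_integrable integrand_continuous h S)+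
  ultimately show ?thesis
    unfolding L2_metric_eq[OF hn sq(1,4)] L2_metric_eq[OF hn sq(2,4)] L2_metric_eq[OF hn sq(3,4)]
    by simp
qed

lemma spray_is_metric_spray: "is_metric_spray n A E \<mu> \<alpha> spray"
  unfolding is_metric_spray_def Let_def
proof (intro conjI ballI allI)
  fix h v l assume h: "h \<in> pos_herms" and v: "v \<in> herms" and l: "l \<in> herms"
  note vs = herms_sections[OF v] and ls = herms_sections[OF l]
  show "\<exists>D1 D2. ((\<lambda>t. L2_metric E \<mu> \<alpha> (h + t *\<^sub>R l) v v) has_vector_derivative D1) (at 0) \<and>
     ((\<lambda>t. L2_metric E \<mu> \<alpha> (h + t *\<^sub>R v) v l) has_vector_derivative D2) (at 0) \<and>
     L2_metric E \<mu> \<alpha> h (spray h v v) l = (1 / 2) *\<^sub>R D1 - D2"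
    using L2_metric_derivative[OF h l vs vs] L2_metric_derivative[OF h v vs ls] L2_metric_spray[OF h v l]
    by blast
qed (use spray_herms spray_smooth spray_sym spray_bilinear in blast)+

lemma metric_spray_unique:
  assumes B: "is_metric_spray n A E \<mu> \<alpha> B" and h: "h \<in> pos_herms" and v: "v \<in> herms" and w: "w \<in> herms"
  shows "B h v w = spray h v w"
proof -
  have BH: "B h v w \<in> herms" if "v \<in> herms" "w \<in> herms" for v w
    using B h that unfolding is_metric_spray_def Let_def by blast
  have Bsym: "B h v w = B h w v" if "v \<in> herms" "w \<in> herms" for v w
    using B h that unfolding is_metric_spray_def Let_def by blast
  have Blin: "B h (s *\<^sub>R v + s' *\<^sub>R v') w = s *\<^sub>R B h v w + s' *\<^sub>R B h v' w"
    if "v \<in> herms" "v' \<in> herms" "w \<in> herms" for s s' v v' w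
    using B h that unfolding is_metric_spray_def Let_def by blast
  have diag: "B h v v = spray h v v" if v: "v \<in> herms" for v
  proof -
    \<comment> \<open>The defect itself is the test direction: B and \<open>spray\<close> satisfy
      the same equation against l, so (l, l) = 0 by linearity in the first argument.\<close>
    define l where "l = B h v v - spray h v v"
    have l: "l \<in> herms" unfolding l_def by (intro herms_diff BH spray_herms h v)
    note vs = herms_sections[OF v] and ls = herms_sections[OF l]
    obtain D1 D2 where D: "((\<lambda>t. L2_metric E \<mu> \<alpha> (h + t *\<^sub>R l) v v) has_vector_derivative D1) (at 0)"
       "((\<lambda>t. L2_metric E \<mu> \<alpha> (h + t *\<^sub>R v) v l) has_vector_derivative D2) (at 0)"
       "L2_metric E \<mu> \<alpha> h (B h v v) l = (1 / 2) *\<^sub>R D1 - D2"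
      using B h v l unfolding is_metric_spray_def Let_def by blast
    have "D1 = (\<integral>x. integrand_deriv h l v v x \<partial>\<mu>)" "D2 = (\<integral>x. integrand_deriv h v v l x \<partial>\<mu>)"
      by (rule vector_derivative_unique_at[OF D(1) L2_metric_derivative[OF h l vs vs]],
        rule vector_derivative_unique_at[OF D(2) L2_metric_derivative[OF h v vs ls]])
    then have "L2_metric E \<mu> \<alpha> h (B h v v) l = L2_metric E \<mu> \<alpha> h (spray h v v) l"
      using D(3) L2_metric_spray[OF h v l] by simp
    then have "L2_metric E \<mu> \<alpha> h l l = 0"
      using L2_metric_diff[OF h BH[OF v v] spray_herms[OF h v v] l] by (simp add: l_def)
    then have "l = 0" by (rule L2_metric_nondegenerate[OF h l])
    then show ?thesis by (simp add: l_def)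
  qed
  \<comment> \<open>Stated for any symmetric bilinear C, in order to be applied to both
    \<open>B h\<close> and \<open>spray h\<close>; their diagonals agree at v, w and v + w.\<close>
  have polar: "C (v + w) (v + w) = C v v + 2 *\<^sub>R C v w + C w w"
    if lin: "\<And>s s' v v' w. v \<in> herms \<Longrightarrow> v' \<in> herms \<Longrightarrow> w \<in> herms \<Longrightarrow>
        C (s *\<^sub>R v + s' *\<^sub>R v') w = s *\<^sub>R C v w + s' *\<^sub>R C v' w"
      and sym: "\<And>v w. v \<in> herms \<Longrightarrow> w \<in> herms \<Longrightarrow> C v w = C w v"
    for C :: "('m, 'v) form_field \<Rightarrow> ('m, 'v) form_field \<Rightarrow> ('m, 'v) form_field"
  proof -
    have add: "C (a + b) c = C a c + C b c" if "a \<in> herms" "b \<in> herms" "c \<in> herms" for a b c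
      using lin[OF that, of 1 1] by (simp only: scaleR_one)
    have vw: "v + w \<in> herms" by (rule herms_closed(1)[OF v w])
    have "C (v + w) (v + w) = C (v + w) v + C (v + w) w"
      by (simp only: add[OF v w vw] sym[OF v vw] sym[OF w vw])
    also have "\<dots> = (C v v + C v w) + (C v w + C w w)"
      by (simp only: add[OF v w v] add[OF v w w] sym[OF w v])
    finally show ?thesis
      by (simp only: scaleR_2 add.assoc)
  qed
  have vw: "v + w \<in> herms" by (rule herms_closed(1)[OF v w])
  have "B h v v + 2 *\<^sub>R B h v w + B h w w = spray h v v + 2 *\<^sub>R spray h v w + spray h w w"
    using diag[OF vw] polar[of "B h", OF Blin Bsym] polar[of "spray h", OF spray_bilinear[OF h] spray_sym]
    by metis
  then have "2 *\<^sub>R B h v w = 2 *\<^sub>R spray h v w"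
    by (simp only: diag[OF v] diag[OF w] add_left_cancel add_right_cancel)
  then show ?thesis by (simp only: scaleR_cancel_left, simp)
qed

end

theorem theorem3p1:
  fixes n :: nat
    and A :: "'m::{t2_space, second_countable_topology} chart set"
    and g :: "'m metric_components"
    and \<mu> :: "'m measure"
    and E :: "('m, 'v::ab_group_add, 'r::finite) vector_bundle"
    and \<alpha> :: "'m \<Rightarrow> real"
  assumes "closed_oriented_manifold n A"
    and "riemannian_metric n A g"
    and "is_volume_measure n A g \<mu>"
    and "smooth_complex_vector_bundle n A E"
    and "smooth_scalar n A \<alpha>"
    and "\<forall>x. \<alpha> x > - 1 / real CARD('r)"
  shows "is_metric_spray n A E \<mu> \<alpha>
           (\<lambda>h v w. (1 / 2) *\<^sub>R form_mult E h v w + (1 / 2) *\<^sub>R form_mult E h w v) \<and>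
         (\<forall>B. is_metric_spray n A E \<mu> \<alpha> B \<longrightarrow>
           (\<forall>h\<in>pos_herm_sections n A E. \<forall>v\<in>herm_sections n A E. \<forall>w\<in>herm_sections n A E.
             B h v w = (1 / 2) *\<^sub>R form_mult E h v w + (1 / 2) *\<^sub>R form_mult E h w v))"
proof -
  interpret riemannian_bundle n A E g \<mu> \<alpha>
    using assms by unfold_locales auto
  have eq: "(\<lambda>h v w. (1 / 2) *\<^sub>R form_mult E h v w + (1 / 2) *\<^sub>R form_mult E h w v) = spray"
    by (rule ext, rule ext, rule ext, rule spray_def[symmetric])
  show ?thesis
    unfolding eq
  proof (intro conjI allI impI ballI)
    show "is_metric_spray n A E \<mu> \<alpha> spray" by (rule spray_is_metric_spray)
  next
    fix B h v w
    assume "is_metric_spray n A E \<mu> \<alpha> B" "h \<in> pos_herms" "v \<in> herms" "w \<in> herms"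
    from metric_spray_unique[OF this]
    show "B h v w = (1 / 2) *\<^sub>R form_mult E h v w + (1 / 2) *\<^sub>R form_mult E h w v"
      unfolding spray_def .
  qed
qed

end
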